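(* Let $\mathtt{A}$ be a type that has two different closed terms $\mathtt{s1}$ and $\mathtt{s2}$ (i.e. $\mathtt{s1}\neq_{\beta\eta c}\mathtt{s2}$). Then $\mathtt{A}$ is functionally complete with regard to $\mathtt{s1}$ and $\mathtt{s2}$: for every $n\ge 1$ and every function $f:\{0,1\}^n\to\{0,1\}$ there is a closed term $\mathtt{t}$, poly-typable by $\underbrace{\mathtt{A\to\cdots\to A}}_{n}\mathtt{\to A}$ with respect to every sequence of $n$ arguments drawn from $\{\mathtt{s1},\mathtt{s2}\}$, such that for all $(x_1,\dots,x_n)\in\{0,1\}^n$ and $y\in\{0,1\}$, \[ f(x_1,\dots,x_n) = y \iff \mathtt{t}\,\mathtt{x1}\cdots\mathtt{xn} =_{\beta\eta c} \mathtt{y}, \] where $\mathtt{x1},\dots,\mathtt{xn},\mathtt{y}$ are the images of $x_1,\dots,x_n,y$ under the map $0\mapsto\mathtt{s1}$, $1\mapsto\mathtt{s2}$.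
   Context: Linear $\lambda$-calculus in ML-like notation. Types: $\mathtt{A} ::= \mathtt{'a} \mid \mathtt{A1 * A2} \mid \mathtt{A1 \to A2}$ ($\mathtt{'a}$ type variables, $*$ tensor, $\to$ linear implication). Terms: $\mathtt{t} ::= \mathtt{x} \mid \mathtt{t}\,\mathtt{s} \mid \mathtt{fn\ x => t} \mid \mathtt{(s,t)} \mid \mathtt{let\ val\ (x,y)=s\ in\ t\ end}$. Typing judgements $\Gamma \vdash \mathtt{t:A}$ are derived by: $\mathtt{x:A}\vdash\mathtt{x:A}$; exchange; from $\mathtt{x:A},\Gamma\vdash \mathtt{t:B}$ infer $\Gamma\vdash\mathtt{fn\ x=>t : A\to B}$; from $\Gamma\vdash\mathtt{t:A\to B}$ and $\Delta\vdash\mathtt{s:A}$ infer $\Gamma,\Delta\vdash\mathtt{t\,s:B}$; from $\Gamma\vdash\mathtt{s:A}$ and $\Delta\vdash\mathtt{t:B}$ infer $\Gamma,\Delta\vdash\mathtt{(s,t):A*B}$; from $\Gamma\vdash\mathtt{s:A*B}$ and $\mathtt{x:A},\mathtt{y:B},\Delta\vdash\mathtt{t:C}$ infer $\Gamma,\Delta\vdash\mathtt{let\ val\ (x,y)=s\ in\ t\ end:C}$ ($\Gamma,\Delta$ disjoint lists of distinct variables). A closed term of type $\mathtt{A}$ is a term with $\vdash\mathtt{t:A}$ derivable. The equality $=_{\beta\eta c}$ is the least congruence on typed terms containing: $(\mathtt{fn\ x=>t})\,\mathtt{s} = \mathtt{t[s/x]}$; $\mathtt{let\ val\ (x,y)=(u,v)\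 in\ w\ end} = \mathtt{w[u/x,v/y]}$; $\mathtt{fn\ x=>(t\ x)} = \mathtt{t}$; $\mathtt{let\ val\ (x,y)=t\ in\ (x,y)\ end} = \mathtt{t}$; and $C[\mathtt{let\ val\ (x,y)=t\ in\ u\ end}] = \mathtt{let\ val\ (x,y)=t\ in}\ C[\mathtt{u}]\ \mathtt{end}$ for every one-hole context $C$ in which $\mathtt{x},\mathtt{y}$ are not free and whose binders capture no free variable of $\mathtt{t}$. Poly-typability: the principal type $\mathrm{PT}(\mathtt{t})$ of a typable term is a type $\mathtt{A}$ with $\Gamma\vdash\mathtt{t:A}$ derivable for some $\Gamma$ such that every derivable typing of $\mathtt{t}$ is a substitution instance of it. For closed terms $\mathtt{t},\mathtt{s}_1,\dots,\mathtt{s}_n$ with $\vdash \mathtt{t : A'_1\to\cdots\to A'_n\to B'}$ derivable for some types and $\vdash\mathtt{s}_i\mathtt{:A}_i$, $\mathtt{t}$ is poly-typable by $\mathtt{A_1\to\cdots\to A_n\to B}$ with respect to $\mathtt{s}_1,\dots,\mathtt{s}_n$ if there is a type substitution $\theta$ with $\theta(\mathrm{PT}(\mathtt{t})) = \mathtt{A''_1\to\cdots\to A''_n\to B}$ and $\theta(\mathrm{PT}(\mathtt{s}_i)) = \mathtt{A''_i}$ for each $i$. *)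

theory Defs
  imports "HOL-Library.Multiset"
begin

type_synonym name = nat

datatype ty =
    TVar name
  | Tensor ty ty (infixr "\<otimes>" 72)
  | Lolli ty ty (infixr "\<rightarrow>" 70)

text \<open>Terms are named; \<^term>\<open>LetTup x y s t\<close> is \<open>let val (x,y) = s in t end\<close>, binding
  \<open>x\<close> and \<open>y\<close> in \<open>t\<close> only. Alpha-conversion is part of the equality below.\<close>

datatype trm =
    Var name
  | App trm trm
  | Fn name trm
  | Tup trm trm
  | LetTup name name trm trm

fun fv :: "trm \<Rightarrow> name set" where
  "fv (Var x) = {x}"
| "fv (App t s) = fv t \<union> fv s"
| "fv (Fn x t) = fv t - {x}"
| "fv (Tup s t) = fv s \<union> fv t"
| "fv (LetTup x y s t) = fv s \<union> (fv t - {x, y})"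

fun bv :: "trm \<Rightarrow> name set" where
  "bv (Var x) = {}"
| "bv (App t s) = bv t \<union> bv s"
| "bv (Fn x t) = insert x (bv t)"
| "bv (Tup s t) = bv s \<union> bv t"
| "bv (LetTup x y s t) = bv s \<union> {x, y} \<union> bv t"

text \<open>Simultaneous substitution. It does not rename bound variables, so it is the
  capture-avoiding substitution only if the binders of the term bind no free variable of a
  substituted term; every use below carries that side condition.\<close>

fun subst :: "(name \<Rightarrow> trm) \<Rightarrow> trm \<Rightarrow> trm" where
  "subst \<sigma> (Var x) = \<sigma> x"
| "subst \<sigma> (App t s) = App (subst \<sigma> t) (subst \<sigma> s)"
| "subst \<sigma> (Fn x t) = Fn x (subst (\<sigma>(x := Var x)) t)"
| "subst \<sigma> (Tup s t) = Tup (subst \<sigma> s) (subst \<sigma> t)"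
| "subst \<sigma> (LetTup x y s t) = LetTup x y (subst \<sigma> s) (subst (\<sigma>(x := Var x, y := Var y)) t)"


type_synonym ctxt = "(name \<times> ty) list"

definition dom_ctxt :: "ctxt \<Rightarrow> name set" where
  "dom_ctxt \<Gamma> = fst ` set \<Gamma>"

text \<open>The disjointness premises make every derivable context a list of distinct variables; in
  particular a bound variable never occurs in the context of the conclusion of \<open>fn\<close>, and
  \<open>x \<noteq> y\<close> in every typable \<open>let\<close>.\<close>

inductive typing :: "ctxt \<Rightarrow> trm \<Rightarrow> ty \<Rightarrow> bool" ("(_ \<turnstile>/ _ \<^bold>:/ _)" [50, 50, 50] 50) where
  var: "[(x, A)] \<turnstile> Var x \<^bold>: A"
| exchange: "\<lbrakk>\<Gamma> \<turnstile> t \<^bold>: A; mset \<Delta> = mset \<Gamma>\<rbrakk> \<Longrightarrow> \<Delta> \<turnstile> t \<^bold>: A"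
| "fn": "(x, A) # \<Gamma> \<turnstile> t \<^bold>: B \<Longrightarrow> \<Gamma> \<turnstile> Fn x t \<^bold>: A \<rightarrow> B"
| app: "\<lbrakk>\<Gamma> \<turnstile> t \<^bold>: A \<rightarrow> B; \<Delta> \<turnstile> s \<^bold>: A; dom_ctxt \<Gamma> \<inter> dom_ctxt \<Delta> = {}\<rbrakk>
    \<Longrightarrow> \<Gamma> @ \<Delta> \<turnstile> App t s \<^bold>: B"
| tup: "\<lbrakk>\<Gamma> \<turnstile> s \<^bold>: A; \<Delta> \<turnstile> t \<^bold>: B; dom_ctxt \<Gamma> \<inter> dom_ctxt \<Delta> = {}\<rbrakk>
    \<Longrightarrow> \<Gamma> @ \<Delta> \<turnstile> Tup s t \<^bold>: A \<otimes> B"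
| let_tup: "\<lbrakk>\<Gamma> \<turnstile> s \<^bold>: A \<otimes> B; (x, A) # (y, B) # \<Delta> \<turnstile> t \<^bold>: C; dom_ctxt \<Gamma> \<inter> dom_ctxt \<Delta> = {}\<rbrakk>
    \<Longrightarrow> \<Gamma> @ \<Delta> \<turnstile> LetTup x y s t \<^bold>: C"


datatype one_hole =
    Hole
  | CAppL one_hole trm
  | CAppR trm one_hole
  | CFn name one_hole
  | CTupL one_hole trm
  | CTupR trm one_hole
  | CLetL name name one_hole trm
  | CLetR name name trm one_hole

fun plug :: "one_hole \<Rightarrow> trm \<Rightarrow> trm" where
  "plug Hole r = r"
| "plug (CAppL C s) r = App (plug C r) s"
| "plug (CAppR t C) r = App t (plug C r)"
| "plug (CFn x C) r = Fn x (plug C r)"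
| "plug (CTupL C t) r = Tup (plug C r) t"
| "plug (CTupR s C) r = Tup s (plug C r)"
| "plug (CLetL x y C t) r = LetTup x y (plug C r) t"
| "plug (CLetR x y s C) r = LetTup x y s (plug C r)"

fun fv_hole :: "one_hole \<Rightarrow> name set" where
  "fv_hole Hole = {}"
| "fv_hole (CAppL C s) = fv_hole C \<union> fv s"
| "fv_hole (CAppR t C) = fv t \<union> fv_hole C"
| "fv_hole (CFn x C) = fv_hole C - {x}"
| "fv_hole (CTupL C t) = fv_hole C \<union> fv t"
| "fv_hole (CTupR s C) = fv s \<union> fv_hole C"
| "fv_hole (CLetL x y C t) = fv_hole C \<union> (fv t - {x, y})"
| "fv_hole (CLetR x y s C) = fv s \<union> (fv_hole C - {x, y})"

text \<open>The variables whose binders have the hole in their scope.\<close>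

fun binders_hole :: "one_hole \<Rightarrow> name set" where
  "binders_hole Hole = {}"
| "binders_hole (CAppL C s) = binders_hole C"
| "binders_hole (CAppR t C) = binders_hole C"
| "binders_hole (CFn x C) = insert x (binders_hole C)"
| "binders_hole (CTupL C t) = binders_hole C"
| "binders_hole (CTupR s C) = binders_hole C"
| "binders_hole (CLetL x y C t) = binders_hole C"
| "binders_hole (CLetR x y s C) = {x, y} \<union> binders_hole C"


text \<open>The generating equations, on raw terms. They are only used between terms that are
  both typable in the same context with the same type. This also rules out the instances of
  \<open>commute\<close> in which a binder of \<open>C\<close> around the hole is \<open>x\<close> or \<open>y\<close>: the right-hand side is then
  not linear.\<close>

inductive conv_axiom :: "trm \<Rightarrow> trm \<Rightarrow> bool" where
  alpha_fn: "z \<notin> fv t \<union> bv t \<Longrightarrow>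
    conv_axiom (Fn x t) (Fn z (subst (Var(x := Var z)) t))"
| alpha_let: "{z, w} \<inter> (fv t \<union> bv t) = {} \<Longrightarrow>
    conv_axiom (LetTup x y s t) (LetTup z w s (subst (Var(x := Var z, y := Var w)) t))"
| beta_fn: "bv t \<inter> fv s = {} \<Longrightarrow>
    conv_axiom (App (Fn x t) s) (subst (Var(x := s)) t)"
| beta_let: "bv w \<inter> (fv u \<union> fv v) = {} \<Longrightarrow>
    conv_axiom (LetTup x y (Tup u v) w) (subst (Var(x := u, y := v)) w)"
| eta_fn: "x \<notin> fv t \<Longrightarrow> conv_axiom (Fn x (App t (Var x))) t"
| eta_let: "conv_axiom (LetTup x y t (Tup (Var x) (Var y))) t"
| commute: "\<lbrakk>x \<notin> fv_hole C; y \<notin> fv_hole C; binders_hole C \<inter> fv t = {}\<rbrakk> \<Longrightarrow>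
    conv_axiom (plug C (LetTup x y t u)) (LetTup x y t (plug C u))"

inductive equality :: "ctxt \<Rightarrow> trm \<Rightarrow> trm \<Rightarrow> ty \<Rightarrow> bool"
    ("(_ \<turnstile>/ _ \<doteq>/ _ \<^bold>:/ _)" [50, 50, 50, 50] 50) where
  ax: "\<lbrakk>conv_axiom t s; \<Gamma> \<turnstile> t \<^bold>: A; \<Gamma> \<turnstile> s \<^bold>: A\<rbrakk> \<Longrightarrow> \<Gamma> \<turnstile> t \<doteq> s \<^bold>: A"
| refl: "\<Gamma> \<turnstile> t \<^bold>: A \<Longrightarrow> \<Gamma> \<turnstile> t \<doteq> t \<^bold>: A"
| sym: "\<Gamma> \<turnstile> t \<doteq> s \<^bold>: A \<Longrightarrow> \<Gamma> \<turnstile> s \<doteq> t \<^bold>: A"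
| trans: "\<lbrakk>\<Gamma> \<turnstile> t \<doteq> s \<^bold>: A; \<Gamma> \<turnstile> s \<doteq> r \<^bold>: A\<rbrakk> \<Longrightarrow> \<Gamma> \<turnstile> t \<doteq> r \<^bold>: A"
| cong_exchange: "\<lbrakk>\<Gamma> \<turnstile> t \<doteq> s \<^bold>: A; mset \<Delta> = mset \<Gamma>\<rbrakk> \<Longrightarrow> \<Delta> \<turnstile> t \<doteq> s \<^bold>: A"
| cong_fn: "(x, A) # \<Gamma> \<turnstile> t \<doteq> t' \<^bold>: B \<Longrightarrow> \<Gamma> \<turnstile> Fn x t \<doteq> Fn x t' \<^bold>: A \<rightarrow> B"
| cong_app: "\<lbrakk>\<Gamma> \<turnstile> t \<doteq> t' \<^bold>: A \<rightarrow> B; \<Delta> \<turnstile> s \<doteq> s' \<^bold>: A; dom_ctxt \<Gamma> \<inter> dom_ctxt \<Delta> = {}\<rbrakk>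
    \<Longrightarrow> \<Gamma> @ \<Delta> \<turnstile> App t s \<doteq> App t' s' \<^bold>: B"
| cong_tup: "\<lbrakk>\<Gamma> \<turnstile> s \<doteq> s' \<^bold>: A; \<Delta> \<turnstile> t \<doteq> t' \<^bold>: B; dom_ctxt \<Gamma> \<inter> dom_ctxt \<Delta> = {}\<rbrakk>
    \<Longrightarrow> \<Gamma> @ \<Delta> \<turnstile> Tup s t \<doteq> Tup s' t' \<^bold>: A \<otimes> B"
| cong_let: "\<lbrakk>\<Gamma> \<turnstile> s \<doteq> s' \<^bold>: A \<otimes> B; (x, A) # (y, B) # \<Delta> \<turnstile> t \<doteq> t' \<^bold>: C;
      dom_ctxt \<Gamma> \<inter> dom_ctxt \<Delta> = {}\<rbrakk>
    \<Longrightarrow> \<Gamma> @ \<Delta> \<turnstile> LetTup x y s t \<doteq> LetTup x y s' t' \<^bold>: C"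


fun tsubst :: "(name \<Rightarrow> ty) \<Rightarrow> ty \<Rightarrow> ty" where
  "tsubst \<theta> (TVar a) = \<theta> a"
| "tsubst \<theta> (A \<otimes> B) = tsubst \<theta> A \<otimes> tsubst \<theta> B"
| "tsubst \<theta> (A \<rightarrow> B) = tsubst \<theta> A \<rightarrow> tsubst \<theta> B"

definition principal_type :: "trm \<Rightarrow> ty \<Rightarrow> bool" where
  "principal_type t A \<longleftrightarrow>
    (\<exists>\<Gamma>. \<Gamma> \<turnstile> t \<^bold>: A \<and>
      (\<forall>\<Delta> B. \<Delta> \<turnstile> t \<^bold>: B \<longrightarrow>
        (\<exists>\<theta>. mset \<Delta> = mset (map (map_prod id (tsubst \<theta>)) \<Gamma>) \<and> B = tsubst \<theta> A)))"

definition arrows :: "ty list \<Rightarrow> ty \<Rightarrow> ty" where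
  "arrows As B = foldr (\<rightarrow>) As B"

definition apps :: "trm \<Rightarrow> trm list \<Rightarrow> trm" where
  "apps t ss = foldl App t ss"

text \<open>A principal type is determined only up to renaming of type variables. The principal types
  \<open>P\<close> and \<open>Ps\<close> are therefore arbitrary representatives, one for each argument position, so
  that they can be taken without common type variables; in particular a term that
  occurs at two positions may be used at two different instances of its principal type.\<close>

definition poly_typable :: "trm \<Rightarrow> ty list \<Rightarrow> ty \<Rightarrow> trm list \<Rightarrow> bool" where
  "poly_typable t As B ss \<longleftrightarrow>
    (\<exists>As' B'. length As' = length ss \<and> [] \<turnstile> t \<^bold>: arrows As' B') \<and>
    list_all2 (\<lambda>s A. [] \<turnstile> s \<^bold>: A) ss As \<and>
    (\<exists>\<theta> P Ps As''. principal_type t P \<and> list_all2 principal_type ss Ps \<and>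
      tsubst \<theta> P = arrows As'' B \<and> map (tsubst \<theta>) Ps = As'')"

definition functionally_complete :: "ty \<Rightarrow> trm \<Rightarrow> trm \<Rightarrow> bool" where
  "functionally_complete A s1 s2 \<longleftrightarrow>
    (let enc = (\<lambda>b. if b then s2 else s1) in
      \<forall>n\<ge>1. \<forall>f :: bool list \<Rightarrow> bool. \<exists>t.
        (\<forall>ss. length ss = n \<and> set ss \<subseteq> {s1, s2} \<longrightarrow> poly_typable t (replicate n A) A ss) \<and>
        (\<forall>xs y. length xs = n \<longrightarrow>
          (f xs = y \<longleftrightarrow> [] \<turnstile> apps t (map enc xs) \<doteq> enc y \<^bold>: A)))"

end

theory Submission
  imports Defs "HOL-Library.Countable"
begin

text \<open>The terms are closed and linear, so a term of type \<open>A\<close> is given by a linking: it matches the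
  occurrences of type variables in \<open>A\<close> that have to be provided with the occurrences that provide
  them. Coherence says that the linking determines the term up to equality.

  Instantiate the type variables of \<open>A\<close> by types of state transformers. A term of type \<open>A\<close> then
  becomes a single transformer, the composition of one letter for each providing occurrence, in the
  order in which a depth-first traversal of the linking meets them. The order determines the linking,
  so there are two occurrences whose letters come in different order in \<open>s1\<close> and \<open>s2\<close>. If these two
  letters overwrite the state by \<open>u1\<close> and \<open>u2\<close> and the others do nothing, the last one wins, and the
  result is a closed term that maps \<open>s1\<close> to \<open>u1\<close> and \<open>s2\<close> to \<open>u2\<close>. Iterating it over the arguments
  yields every Boolean function.

  A state can be overwritten because closed terms can be erased: at \<open>q \<rightarrow> q\<close> instead of the type
  variables, the composition of all transformers in \<open>u\<close> is a closed term of type \<open>q \<rightarrow> q\<close>, hence the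
  identity. The typing of the result depends on the arguments; this is what poly-typability allows.\<close>

subsection \<open>Typing without contexts\<close>

text \<open>Coherence holds only where each type variable occurs at most once in each polarity, and
  \<open>A\<close> need not be of this kind. So the occurrences in \<open>A\<close> first get
  distinct labels, which gives \<open>L\<close> with \<open>ren f L = A\<close>. Each term then has
  a type \<open>ren l L\<close> of its own, in which the labels are identified along its linking
  \<open>l\<close>, and coherence applies there. If \<open>s1\<close> and \<open>s2\<close> had the
  same linking, they would be equal at that type and hence at its instance \<open>A\<close>. The
  constructed term is applied to \<open>s1\<close> and \<open>s2\<close> themselves, whereas the
  linking is read off cut-free forms. Normalisation is therefore more than an equality: each of its
  steps also has to reflect typings, and linearity makes this possible. The observer
  \<open>K\<close> gives \<open>s1\<close> and \<open>s2\<close> the different types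
  \<open>ty1\<close> and \<open>ty2\<close>, each with a single closed inhabitant up to equality:
  the composition of two arguments in one order or in the other. So the terms
  \<open>App K s1\<close> and \<open>App K s2\<close> never have to be computed; their types say how
  they behave.\<close>

lemma finite_fv [simp]: "finite (fv t)"
  by (induction t) auto

lemma finite_bv [simp]: "finite (bv t)"
  by (induction t) auto

text \<open>A derivable context has exactly the free variables of the term as its domain, so the way
  it is split between subterms can be read off the term. Typing therefore falls apart into
  linearity, which mentions no types, and simple typing under a total assignment. Conversions can
  then be compared by \<open>has_ty\<close> alone, at all assignments at once.\<close>

fun lin :: "trm \<Rightarrow> bool" where
  "lin (Var x) \<longleftrightarrow> True"
| "lin (App t s) \<longleftrightarrow> lin t \<and> lin s \<and> fv t \<inter> fv s = {}"
| "lin (Fn x t) \<longleftrightarrow> lin t \<and> x \<in> fv t"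
| "lin (Tup s t) \<longleftrightarrow> lin s \<and> lin t \<and> fv s \<inter> fv t = {}"
| "lin (LetTup x y s t) \<longleftrightarrow>
    lin s \<and> lin t \<and> x \<noteq> y \<and> x \<in> fv t \<and> y \<in> fv t \<and> fv s \<inter> (fv t - {x, y}) = {}"

fun has_ty :: "(name \<Rightarrow> ty) \<Rightarrow> trm \<Rightarrow> ty \<Rightarrow> bool" where
  "has_ty \<tau> (Var x) C \<longleftrightarrow> \<tau> x = C"
| "has_ty \<tau> (App t s) C \<longleftrightarrow> (\<exists>A. has_ty \<tau> t (A \<rightarrow> C) \<and> has_ty \<tau> s A)"
| "has_ty \<tau> (Fn x t) C \<longleftrightarrow> (\<exists>A B. C = A \<rightarrow> B \<and> has_ty (\<tau>(x := A)) t B)"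
| "has_ty \<tau> (Tup s t) C \<longleftrightarrow> (\<exists>A B. C = A \<otimes> B \<and> has_ty \<tau> s A \<and> has_ty \<tau> t B)"
| "has_ty \<tau> (LetTup x y s t) C \<longleftrightarrow>
    (\<exists>A B. has_ty \<tau> s (A \<otimes> B) \<and> has_ty (\<tau>(x := A, y := B)) t C)"

lemma has_ty_cong: "(\<And>x. x \<in> fv t \<Longrightarrow> \<tau> x = \<tau>' x) \<Longrightarrow> has_ty \<tau> t A \<longleftrightarrow> has_ty \<tau>' t A"
proof (induction t arbitrary: \<tau> \<tau>' A)
  case (Fn x t)
  have "has_ty (\<tau>(x := A)) t B \<longleftrightarrow> has_ty (\<tau>'(x := A)) t B" for A B
    by (rule Fn.IH) (use Fn.prems in auto)
  then show ?case by simp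
next
  case (LetTup x y s t)
  have "has_ty (\<tau>(x := A, y := B)) t C \<longleftrightarrow> has_ty (\<tau>'(x := A, y := B)) t C" for A B C
    by (rule LetTup.IH) (use LetTup.prems in auto)
  moreover have "has_ty \<tau> s A \<longleftrightarrow> has_ty \<tau>' s A" for A
    by (rule LetTup.IH) (use LetTup.prems in auto)
  ultimately show ?case by simp
next
  case (App t s)
  have "has_ty \<tau> t A \<longleftrightarrow> has_ty \<tau>' t A" "has_ty \<tau> s A \<longleftrightarrow> has_ty \<tau>' s A" for A
    by (rule App.IH; use App.prems in auto)+
  then show ?case by simp
next
  case (Tup t s)
  have "has_ty \<tau> t A \<longleftrightarrow> has_ty \<tau>' t A" "has_ty \<tau> s A \<longleftrightarrow> has_ty \<tau>' s A" for A
    by (rule Tup.IH; use Tup.prems in auto)+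
  then show ?case by simp
qed auto

definition wt :: "(name \<Rightarrow> ty) \<Rightarrow> trm \<Rightarrow> ty \<Rightarrow> bool" where
  "wt \<tau> t A \<longleftrightarrow> lin t \<and> has_ty \<tau> t A"

lemma wt_cong: "(\<And>x. x \<in> fv t \<Longrightarrow> \<tau> x = \<tau>' x) \<Longrightarrow> wt \<tau> t A \<longleftrightarrow> wt \<tau>' t A"
  using has_ty_cong[of t \<tau> \<tau>' A] by (auto simp: wt_def)

lemma wt_simps:
  "wt \<tau> (Var x) C \<longleftrightarrow> \<tau> x = C"
  "wt \<tau> (App t s) C \<longleftrightarrow> (\<exists>A. wt \<tau> t (A \<rightarrow> C) \<and> wt \<tau> s A) \<and> fv t \<inter> fv s = {}"
  "wt \<tau> (Fn x t) C \<longleftrightarrow> (\<exists>A B. C = A \<rightarrow> B \<and> wt (\<tau>(x := A)) t B) \<and> x \<in> fv t"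
  "wt \<tau> (Tup s t) C \<longleftrightarrow> (\<exists>A B. C = A \<otimes> B \<and> wt \<tau> s A \<and> wt \<tau> t B) \<and> fv s \<inter> fv t = {}"
  "wt \<tau> (LetTup x y s t) C \<longleftrightarrow>
    (\<exists>A B. wt \<tau> s (A \<otimes> B) \<and> wt (\<tau>(x := A, y := B)) t C)
      \<and> x \<noteq> y \<and> x \<in> fv t \<and> y \<in> fv t \<and> fv s \<inter> (fv t - {x, y}) = {}"
  by (auto simp: wt_def)

text \<open>The bridge between the two styles: \<Gamma> lists the restriction of \<tau> to
  \<open>V\<close>, and is thereby determined up to exchange (\<open>fits_unique\<close>).\<close>

definition fits :: "ctxt \<Rightarrow> (name \<Rightarrow> ty) \<Rightarrow> name set \<Rightarrow> bool" where
  "fits \<Gamma> \<tau> V \<longleftrightarrow> distinct (map fst \<Gamma>) \<and> dom_ctxt \<Gamma> = V \<and> (\<forall>(x, A) \<in> set \<Gamma>. \<tau> x = A)"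

lemma dom_ctxt_simps [simp]:
  "dom_ctxt [] = {}" "dom_ctxt (p # \<Gamma>) = insert (fst p) (dom_ctxt \<Gamma>)"
  "dom_ctxt (\<Gamma> @ \<Delta>) = dom_ctxt \<Gamma> \<union> dom_ctxt \<Delta>"
  by (auto simp: dom_ctxt_def)

lemma dom_ctxt_mset: "mset \<Delta> = mset \<Gamma> \<Longrightarrow> dom_ctxt \<Delta> = dom_ctxt \<Gamma>"
  by (metis dom_ctxt_def set_mset_mset)

lemma fits_dom: "fits \<Gamma> \<tau> V \<Longrightarrow> dom_ctxt \<Gamma> = V"
  by (simp add: fits_def)

lemma fits_mset: "fits \<Gamma> \<tau> V \<Longrightarrow> mset \<Delta> = mset \<Gamma> \<Longrightarrow> fits \<Delta> \<tau> V"
  unfolding fits_def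
  using dom_ctxt_mset[of \<Delta> \<Gamma>] mset_eq_setD[of \<Delta> \<Gamma>]
    mset_eq_imp_distinct_iff[of "map fst \<Delta>" "map fst \<Gamma>"] by simp

lemma fits_set: "fits \<Gamma> \<tau> V \<Longrightarrow> set \<Gamma> = (\<lambda>x. (x, \<tau> x)) ` V"
  by (force simp: fits_def dom_ctxt_def image_iff)

lemma fits_unique:
  assumes "fits \<Gamma> \<tau> V" "fits \<Delta> \<tau> V"
  shows "mset \<Delta> = mset \<Gamma>"
proof -
  have "set \<Gamma> = set \<Delta>"
    using fits_set[OF assms(1)] fits_set[OF assms(2)] by simp
  moreover have "distinct \<Gamma>" "distinct \<Delta>"
    using assms by (simp_all add: fits_def distinct_map)
  ultimately show ?thesis
    by (simp add: set_eq_iff_mset_eq_distinct)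
qed

lemma fits_cong: "(\<And>x. x \<in> V \<Longrightarrow> \<tau> x = \<tau>' x) \<Longrightarrow> fits \<Gamma> \<tau> V \<longleftrightarrow> fits \<Gamma> \<tau>' V"
  by (fastforce simp: fits_def dom_ctxt_def intro: rev_image_eqI)

lemma fits_exists:
  assumes "finite V"
  shows "\<exists>\<Gamma>. fits \<Gamma> \<tau> V"
proof -
  obtain xs where "set xs = V" "distinct xs"
    using assms finite_distinct_list by blast
  then have "fits (map (\<lambda>x. (x, \<tau> x)) xs) \<tau> V"
    by (auto simp: fits_def dom_ctxt_def comp_def image_image)
  then show ?thesis ..
qed

lemma fits_empty [simp]: "fits \<Gamma> \<tau> {} \<longleftrightarrow> \<Gamma> = []"
  by (auto simp: fits_def dom_ctxt_def)

lemma fits_Cons: "fits ((x, A) # \<Gamma>) \<tau> V \<longleftrightarrow> x \<in> V \<and> \<tau> x = A \<and> fits \<Gamma> \<tau> (V - {x})"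
  by (auto simp: fits_def dom_ctxt_def)

lemma fits_append:
  "fits \<Gamma> \<tau> V \<Longrightarrow> fits \<Delta> \<tau> W \<Longrightarrow> V \<inter> W = {} \<Longrightarrow> fits (\<Gamma> @ \<Delta>) \<tau> (V \<union> W)"
  by (auto simp: fits_def dom_ctxt_def)

lemma fits_appendD: "fits (\<Gamma> @ \<Delta>) \<tau> V \<Longrightarrow> fits \<Gamma> \<tau> (dom_ctxt \<Gamma>) \<and> fits \<Delta> \<tau> (dom_ctxt \<Delta>)"
  by (auto simp: fits_def)

lemma fits_update:
  "x \<notin> V \<Longrightarrow> fits \<Gamma> (\<tau>(x := A)) V \<longleftrightarrow> fits \<Gamma> \<tau> V"
  by (rule fits_cong) auto

lemma fits_bind: "x \<in> V \<Longrightarrow> fits \<Gamma> \<tau> (V - {x}) \<Longrightarrow> fits ((x, A) # \<Gamma>) (\<tau>(x := A)) V"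
  by (simp add: fits_Cons fits_update)

lemma fits_bind2:
  "x \<in> V \<Longrightarrow> y \<in> V \<Longrightarrow> x \<noteq> y \<Longrightarrow> fits \<Gamma> \<tau> (V - {x, y})
    \<Longrightarrow> fits ((x, A) # (y, B) # \<Gamma>) (\<tau>(x := A, y := B)) V"
  using Diff_insert2[of V x "{y}"] by (simp add: fits_Cons fits_update)

lemma typing_imp:
  "\<Gamma> \<turnstile> t \<^bold>: A \<Longrightarrow> lin t \<and> distinct (map fst \<Gamma>) \<and> dom_ctxt \<Gamma> = fv t \<and> (\<forall>\<tau>. fits \<Gamma> \<tau> (fv t) \<longrightarrow> has_ty \<tau> t A)"
proof (induction rule: typing.induct)
  case (exchange \<Gamma> t A \<Delta>)
  then show ?case
    by (metis dom_ctxt_mset fits_mset mset_eq_imp_distinct_iff mset_map)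
next
  case ("fn" x A \<Gamma> t B)
  then have x: "x \<in> fv t" "dom_ctxt \<Gamma> = fv t - {x}"
    by (auto simp: dom_ctxt_def)
  with "fn" show ?case
    by (auto intro!: fits_bind)
next
  case (app \<Gamma> t A B \<Delta> s)
  then have "distinct (map fst (\<Gamma> @ \<Delta>))"
    by (auto simp: dom_ctxt_def)
  moreover have "has_ty \<tau> (App t s) (B)" if "fits (\<Gamma> @ \<Delta>) \<tau> V" for \<tau> V
    using app.IH fits_appendD[OF that] by auto
  ultimately show ?case
    using app by auto
next
  case (tup \<Gamma> s A \<Delta> t B)
  then have "distinct (map fst (\<Gamma> @ \<Delta>))"
    by (auto simp: dom_ctxt_def)
  moreover have "has_ty \<tau> (Tup s t) (A \<otimes> B)" if "fits (\<Gamma> @ \<Delta>) \<tau> V" for \<tau> V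
    using tup.IH fits_appendD[OF that] by auto
  ultimately show ?case
    using tup by auto
next
  case (let_tup \<Gamma> s A B x y \<Delta> t C)
  then have x: "x \<in> fv t" "y \<in> fv t" "x \<noteq> y" "dom_ctxt \<Delta> = fv t - {x, y}"
    by (auto simp: dom_ctxt_def)
  have "has_ty \<tau> (LetTup x y s t) C" if "fits (\<Gamma> @ \<Delta>) \<tau> (fv (LetTup x y s t))" for \<tau>
  proof -
    have "fits \<Gamma> \<tau> (fv s)" "fits \<Delta> \<tau> (fv t - {x, y})"
      using fits_appendD[OF that] let_tup.IH(1) x(4) by simp_all
    then have "has_ty \<tau> s (A \<otimes> B)" "has_ty (\<tau>(x := A, y := B)) t C"
      using let_tup.IH fits_bind2[of x "fv t" y \<Delta> \<tau> A B] x(1-3) by blast+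
    then show ?thesis
      by auto
  qed
  with let_tup x show ?case
    by (auto simp: dom_ctxt_def)
qed (auto simp: fits_def dom_ctxt_def)

lemma wt_imp_typing: "wt \<tau> t A \<Longrightarrow> fits \<Gamma> \<tau> (fv t) \<Longrightarrow> \<Gamma> \<turnstile> t \<^bold>: A"
proof (induction t arbitrary: \<tau> A \<Gamma>)
  case (Var x)
  then have "mset \<Gamma> = mset [(x, A)]"
    by (intro fits_unique[of _ \<tau> "{x}"]) (auto simp: fits_def wt_simps)
  then show ?case
    using typing.exchange typing.var by blast
next
  case (App t s)
  obtain \<Gamma>1 \<Gamma>2 where \<Gamma>: "fits \<Gamma>1 \<tau> (fv t)" "fits \<Gamma>2 \<tau> (fv s)"
    using fits_exists by (meson finite_fv)
  from App.prems have "fv t \<inter> fv s = {}"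
    by (auto simp: wt_simps)
  then have "mset \<Gamma> = mset (\<Gamma>1 @ \<Gamma>2)"
    using fits_unique[OF fits_append[OF \<Gamma>]] App.prems by auto
  moreover have "\<Gamma>1 @ \<Gamma>2 \<turnstile> App t s \<^bold>: A"
    using App.prems(1) App.IH \<Gamma> unfolding wt_simps by (metis fits_dom typing.app)
  ultimately show ?case
    by (rule typing.exchange[rotated])
next
  case (Fn x t)
  then show ?case
    by (auto simp: wt_simps intro!: typing.fn fits_bind)
next
  case (Tup t s)
  obtain \<Gamma>1 \<Gamma>2 where \<Gamma>: "fits \<Gamma>1 \<tau> (fv t)" "fits \<Gamma>2 \<tau> (fv s)"
    using fits_exists by (meson finite_fv)
  from Tup.prems have "fv t \<inter> fv s = {}"
    by (auto simp: wt_simps)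
  then have "mset \<Gamma> = mset (\<Gamma>1 @ \<Gamma>2)"
    using fits_unique[OF fits_append[OF \<Gamma>]] Tup.prems by auto
  moreover have "\<Gamma>1 @ \<Gamma>2 \<turnstile> Tup t s \<^bold>: A"
    using Tup.prems(1) Tup.IH \<Gamma> unfolding wt_simps by (metis fits_dom typing.tup)
  ultimately show ?case
    by (rule typing.exchange[rotated])
next
  case (LetTup x y s t)
  obtain \<Gamma>1 \<Gamma>2 where \<Gamma>: "fits \<Gamma>1 \<tau> (fv s)" "fits \<Gamma>2 \<tau> (fv t - {x, y})"
    using fits_exists by (meson finite_fv finite_Diff)
  from LetTup.prems obtain B C where *: "wt \<tau> s (B \<otimes> C)" "wt (\<tau>(x := B, y := C)) t A"
    "x \<noteq> y" "x \<in> fv t" "y \<in> fv t" "fv s \<inter> (fv t - {x, y}) = {}"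
    by (auto simp: wt_simps)
  have "\<Gamma>1 @ \<Gamma>2 \<turnstile> LetTup x y s t \<^bold>: A"
    using typing.let_tup[OF LetTup.IH(1)[OF *(1) \<Gamma>(1)]
        LetTup.IH(2)[OF *(2) fits_bind2[OF *(4,5,3) \<Gamma>(2)]]] *(6)
    by (simp add: fits_dom[OF \<Gamma>(1)] fits_dom[OF \<Gamma>(2)])
  moreover have "mset \<Gamma> = mset (\<Gamma>1 @ \<Gamma>2)"
    by (rule fits_unique[OF fits_append[OF \<Gamma>]]) (use * LetTup.prems in auto)
  ultimately show ?case
    by (rule typing.exchange)
qed

lemma typing_iff_wt: "fits \<Gamma> \<tau> (fv t) \<Longrightarrow> \<Gamma> \<turnstile> t \<^bold>: A \<longleftrightarrow> wt \<tau> t A"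
  using typing_imp[of \<Gamma> t A] wt_imp_typing[of \<tau> t A \<Gamma>] unfolding wt_def by blast

lemma closed_typing_iff: "[] \<turnstile> t \<^bold>: A \<longleftrightarrow> fv t = {} \<and> wt \<tau> t A"
  using typing_imp[of "[]" t A] typing_iff_wt[of "[]" \<tau> t A] by auto

section \<open>Equality relative to an assignment of types to names\<close>

lemma equality_typed: "\<Gamma> \<turnstile> t \<doteq> s \<^bold>: A \<Longrightarrow> \<Gamma> \<turnstile> t \<^bold>: A \<and> \<Gamma> \<turnstile> s \<^bold>: A"
  by (induction rule: equality.induct) (blast intro: typing.intros)+

text \<open>One listing of the free variables is enough, since exchange leads to every other
  (\<open>eqt_equality\<close>); the congruence rules then need no splitting of contexts.\<close>

definition eqt :: "(name \<Rightarrow> ty) \<Rightarrow> trm \<Rightarrow> trm \<Rightarrow> ty \<Rightarrow> bool" where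
  "eqt \<tau> t s A \<longleftrightarrow> (\<exists>\<Gamma>. fits \<Gamma> \<tau> (fv t) \<and> \<Gamma> \<turnstile> t \<doteq> s \<^bold>: A)"

lemma eqt_typed:
  assumes "eqt \<tau> t s A"
  shows "wt \<tau> t A" "wt \<tau> s A" "fv s = fv t"
proof -
  obtain \<Gamma> where \<Gamma>: "fits \<Gamma> \<tau> (fv t)" "\<Gamma> \<turnstile> t \<^bold>: A" "\<Gamma> \<turnstile> s \<^bold>: A"
    using assms equality_typed by (auto simp: eqt_def)
  then show "fv s = fv t"
    using typing_imp fits_dom by metis
  with \<Gamma> show "wt \<tau> t A" "wt \<tau> s A"
    using typing_iff_wt by auto
qed

lemma eqt_equality: "eqt \<tau> t s A \<Longrightarrow> fits \<Gamma> \<tau> (fv t) \<Longrightarrow> \<Gamma> \<turnstile> t \<doteq> s \<^bold>: A"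
  unfolding eqt_def using equality.cong_exchange fits_unique by blast

lemma eqt_closed_iff: "[] \<turnstile> t \<doteq> s \<^bold>: A \<longleftrightarrow> fv t = {} \<and> eqt \<tau> t s A"
proof
  assume *: "[] \<turnstile> t \<doteq> s \<^bold>: A"
  then have "fv t = {}"
    using equality_typed closed_typing_iff by blast
  with * show "fv t = {} \<and> eqt \<tau> t s A"
    by (simp add: eqt_def)
qed (auto intro: eqt_equality)

lemma eqt_cong: "(\<And>x. x \<in> fv t \<Longrightarrow> \<tau> x = \<tau>' x) \<Longrightarrow> eqt \<tau> t s A \<longleftrightarrow> eqt \<tau>' t s A"
  using fits_cong[of "fv t" \<tau> \<tau>'] by (auto simp: eqt_def)

lemma eqt_ax: "conv_axiom t s \<Longrightarrow> wt \<tau> t A \<Longrightarrow> wt \<tau> s A \<Longrightarrow> fv s = fv t \<Longrightarrow> eqt \<tau> t s A"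
  unfolding eqt_def using fits_exists[of "fv t" \<tau>] typing_iff_wt equality.ax
  by (metis finite_fv)

lemma eqt_refl: "wt \<tau> t A \<Longrightarrow> eqt \<tau> t t A"
  unfolding eqt_def using fits_exists[of "fv t" \<tau>] typing_iff_wt equality.refl
  by (metis finite_fv)

lemma eqt_sym: "eqt \<tau> t s A \<Longrightarrow> eqt \<tau> s t A"
  using eqt_typed(3)[of \<tau> t s A] unfolding eqt_def by (auto intro: equality.sym)

lemma eqt_trans [trans]: "eqt \<tau> t s A \<Longrightarrow> eqt \<tau> s r A \<Longrightarrow> eqt \<tau> t r A"
  using eqt_typed(3)[of \<tau> t s A] eqt_equality[of \<tau> s r A] unfolding eqt_def
  by (metis equality.trans)

lemma eqt_Fn: "eqt (\<tau>(x := A)) t t' B \<Longrightarrow> x \<in> fv t \<Longrightarrow> eqt \<tau> (Fn x t) (Fn x t') (A \<rightarrow> B)"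
  using fits_exists[of "fv t - {x}" \<tau>] eqt_equality fits_bind
  by (metis equality.cong_fn eqt_def finite_Diff finite_fv fv.simps(3))

lemma eqt_App:
  assumes "eqt \<tau> t t' (A \<rightarrow> B)" "eqt \<tau> s s' A" "fv t \<inter> fv s = {}"
  shows "eqt \<tau> (App t s) (App t' s') B"
proof -
  obtain \<Gamma> \<Delta> where *: "fits \<Gamma> \<tau> (fv t)" "\<Gamma> \<turnstile> t \<doteq> t' \<^bold>: A \<rightarrow> B" "fits \<Delta> \<tau> (fv s)" "\<Delta> \<turnstile> s \<doteq> s' \<^bold>: A"
    using assms by (auto simp: eqt_def)
  then have "\<Gamma> @ \<Delta> \<turnstile> App t s \<doteq> App t' s' \<^bold>: B"
    using assms(3) by (intro equality.cong_app) (auto simp: fits_dom)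
  then show ?thesis
    using fits_append[OF *(1,3) assms(3)] by (auto simp: eqt_def)
qed

lemma eqt_Tup:
  assumes "eqt \<tau> t t' A" "eqt \<tau> s s' B" "fv t \<inter> fv s = {}"
  shows "eqt \<tau> (Tup t s) (Tup t' s') (A \<otimes> B)"
proof -
  obtain \<Gamma> \<Delta> where *: "fits \<Gamma> \<tau> (fv t)" "\<Gamma> \<turnstile> t \<doteq> t' \<^bold>: A" "fits \<Delta> \<tau> (fv s)" "\<Delta> \<turnstile> s \<doteq> s' \<^bold>: B"
    using assms by (auto simp: eqt_def)
  then have "\<Gamma> @ \<Delta> \<turnstile> Tup t s \<doteq> Tup t' s' \<^bold>: A \<otimes> B"
    using assms(3) by (intro equality.cong_tup) (auto simp: fits_dom)
  then show ?thesis
    using fits_append[OF *(1,3) assms(3)] by (auto simp: eqt_def)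
qed

lemma eqt_Let:
  assumes "eqt \<tau> s s' (A \<otimes> B)" "eqt (\<tau>(x := A, y := B)) t t' C"
    "x \<noteq> y" "x \<in> fv t" "y \<in> fv t" "fv s \<inter> (fv t - {x, y}) = {}"
  shows "eqt \<tau> (LetTup x y s t) (LetTup x y s' t') C"
proof -
  obtain \<Gamma> where *: "fits \<Gamma> \<tau> (fv s)" "\<Gamma> \<turnstile> s \<doteq> s' \<^bold>: A \<otimes> B"
    using assms by (auto simp: eqt_def)
  obtain \<Delta> where \<Delta>: "fits \<Delta> \<tau> (fv t - {x, y})"
    using fits_exists by (meson finite_fv finite_Diff)
  have "\<Gamma> @ \<Delta> \<turnstile> LetTup x y s t \<doteq> LetTup x y s' t' \<^bold>: C"
    using equality.cong_let[OF *(2) eqt_equality[OF assms(2) fits_bind2[OF assms(4,5,3) \<Delta>]]] assms(6)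
    by (simp add: fits_dom[OF *(1)] fits_dom[OF \<Delta>])
  then show ?thesis
    using fits_append[OF *(1) \<Delta> assms(6)] by (auto simp: eqt_def)
qed

subsection \<open>Substitution\<close>

text \<open>Variables have size 0, so that a linear substitution adds sizes exactly and every beta
  step makes the term strictly smaller.\<close>

fun sz :: "trm \<Rightarrow> nat" where
  "sz (Var x) = 0"
| "sz (App t s) = Suc (sz t + sz s)"
| "sz (Fn x t) = Suc (sz t)"
| "sz (Tup s t) = Suc (sz s + sz t)"
| "sz (LetTup x y s t) = Suc (sz s + sz t)"

lemma has_ty_upd_fresh: "x \<notin> fv t \<Longrightarrow> has_ty (\<tau>(x := B)) t A \<longleftrightarrow> has_ty \<tau> t A"
  by (rule has_ty_cong) auto

text \<open>The first disjunct makes the condition stable under binders: \<open>subst\<close> resets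
  a bound name to itself, and that name may be bound again further inside.\<close>

definition nocap :: "(name \<Rightarrow> trm) \<Rightarrow> trm \<Rightarrow> bool" where
  "nocap \<sigma> t \<longleftrightarrow> (\<forall>y \<in> fv t. \<sigma> y = Var y \<or> bv t \<inter> fv (\<sigma> y) = {})"

lemma nocap_Fn: "nocap \<sigma> (Fn z t) \<Longrightarrow> nocap (\<sigma>(z := Var z)) t"
  by (auto simp: nocap_def)

lemma nocap_Let: "nocap \<sigma> (LetTup x y s t) \<Longrightarrow> nocap (\<sigma>(x := Var x, y := Var y)) t"
  by (auto simp: nocap_def)

lemma nocap_sub:
  "nocap \<sigma> (App t s) \<Longrightarrow> nocap \<sigma> t" "nocap \<sigma> (App t s) \<Longrightarrow> nocap \<sigma> s"
  "nocap \<sigma> (Tup t s) \<Longrightarrow> nocap \<sigma> t" "nocap \<sigma> (Tup t s) \<Longrightarrow> nocap \<sigma> s"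
  "nocap \<sigma> (LetTup x y s t) \<Longrightarrow> nocap \<sigma> s"
  by (auto simp: nocap_def)

lemma nocap_Fn_fresh: "nocap \<sigma> (Fn z t) \<Longrightarrow> y \<in> fv t \<Longrightarrow> y \<noteq> z \<Longrightarrow> z \<notin> fv (\<sigma> y)"
  by (force simp: nocap_def)

lemma nocap_Let_fresh:
  "nocap \<sigma> (LetTup x1 x2 s t) \<Longrightarrow> y \<in> fv t \<Longrightarrow> y \<noteq> x1 \<Longrightarrow> y \<noteq> x2
    \<Longrightarrow> x1 \<notin> fv (\<sigma> y) \<and> x2 \<notin> fv (\<sigma> y)"
  by (force simp: nocap_def)

lemma fv_subst: "nocap \<sigma> t \<Longrightarrow> fv (subst \<sigma> t) = (\<Union>y \<in> fv t. fv (\<sigma> y))"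
proof (induction t arbitrary: \<sigma>)
  case (Fn z t)
  have "fv (subst (\<sigma>(z := Var z)) t) = (\<Union>y \<in> fv t. fv ((\<sigma>(z := Var z)) y))"
    by (rule Fn.IH[OF nocap_Fn[OF Fn.prems]])
  then show ?case
    using nocap_Fn_fresh[OF Fn.prems] by (auto split: if_splits)
next
  case (LetTup x y s t)
  have "fv (subst (\<sigma>(x := Var x, y := Var y)) t)
      = (\<Union>z \<in> fv t. fv ((\<sigma>(x := Var x, y := Var y)) z))"
    by (rule LetTup.IH(2)[OF nocap_Let[OF LetTup.prems]])
  then show ?case
    using LetTup.IH(1)[OF nocap_sub(5)[OF LetTup.prems]] nocap_Let_fresh[OF LetTup.prems]
    by (auto split: if_splits)
next
  case (App t s)
  then show ?case using nocap_sub(1,2)[OF App.prems] by auto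
next
  case (Tup t s)
  then show ?case using nocap_sub(3,4)[OF Tup.prems] by auto
qed auto

lemma bv_subst: "bv (subst \<sigma> t) \<subseteq> bv t \<union> (\<Union>y \<in> fv t. bv (\<sigma> y))"
proof (induction t arbitrary: \<sigma>)
  case (Fn z t)
  have "bv (subst (\<sigma>(z := Var z)) t) \<subseteq> bv t \<union> (\<Union>y \<in> fv t. bv ((\<sigma>(z := Var z)) y))"
    by (rule Fn.IH)
  then show ?case
    by (auto split: if_splits)
next
  case (LetTup x y s t)
  have "bv (subst (\<sigma>(x := Var x, y := Var y)) t)
      \<subseteq> bv t \<union> (\<Union>z \<in> fv t. bv ((\<sigma>(x := Var x, y := Var y)) z))"
    by (rule LetTup.IH)
  then show ?case
    using LetTup.IH(1)[of \<sigma>] by (auto split: if_splits)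
next
  case (App t s)
  then show ?case using App.IH[of \<sigma>] by auto
next
  case (Tup t s)
  then show ?case using Tup.IH[of \<sigma>] by auto
qed auto

lemma subst_ident: "(\<And>y. y \<in> fv t \<Longrightarrow> \<sigma> y = Var y) \<Longrightarrow> subst \<sigma> t = t"
  by (induction t arbitrary: \<sigma>) auto

text \<open>Linearity makes this an equation: every substituted term is used exactly once.\<close>

lemma sz_subst: "lin t \<Longrightarrow> sz (subst \<sigma> t) = sz t + (\<Sum>y \<in> fv t. sz (\<sigma> y))"
proof (induction t arbitrary: \<sigma>)
  case (Fn z t)
  have "(\<Sum>y \<in> fv t. sz ((\<sigma>(z := Var z)) y)) = (\<Sum>y \<in> fv t - {z}. sz (\<sigma> y))"
    by (rule sum.mono_neutral_cong_right) auto
  moreover have "sz (subst (\<sigma>(z := Var z)) t) = sz t + (\<Sum>y \<in> fv t. sz ((\<sigma>(z := Var z)) y))"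
    by (rule Fn.IH) (use Fn.prems in simp)
  ultimately show ?case by (simp del: fun_upd_apply)
next
  case (LetTup x y s t)
  have "(\<Sum>z \<in> fv t. sz ((\<sigma>(x := Var x, y := Var y)) z)) = (\<Sum>z \<in> fv t - {x, y}. sz (\<sigma> z))"
    by (rule sum.mono_neutral_cong_right) auto
  moreover have "(\<Sum>z \<in> fv s \<union> (fv t - {x, y}). sz (\<sigma> z))
      = (\<Sum>z \<in> fv s. sz (\<sigma> z)) + (\<Sum>z \<in> fv t - {x, y}. sz (\<sigma> z))"
    using LetTup.prems by (intro sum.union_disjoint) auto
  moreover have "sz (subst (\<sigma>(x := Var x, y := Var y)) t)
      = sz t + (\<Sum>z \<in> fv t. sz ((\<sigma>(x := Var x, y := Var y)) z))"
    by (rule LetTup.IH) (use LetTup.prems in simp)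
  ultimately show ?case
    using LetTup.IH(1)[of \<sigma>] LetTup.prems by (simp del: fun_upd_apply)
qed (auto simp: sum.union_disjoint)

lemma lin_subst:
  assumes "lin t" "nocap \<sigma> t" "\<And>y. y \<in> fv t \<Longrightarrow> lin (\<sigma> y)"
    "\<And>y y'. y \<in> fv t \<Longrightarrow> y' \<in> fv t \<Longrightarrow> y \<noteq> y' \<Longrightarrow> fv (\<sigma> y) \<inter> fv (\<sigma> y') = {}"
  shows "lin (subst \<sigma> t)"
  using assms
proof (induction t arbitrary: \<sigma>)
  case (App t s)
  have "lin (subst \<sigma> t)" "lin (subst \<sigma> s)"
    using App.prems nocap_sub(1,2)[OF App.prems(2)] by (auto intro!: App.IH)
  moreover have "fv (subst \<sigma> t) \<inter> fv (subst \<sigma> s) = {}"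
    using App.prems(1,4) nocap_sub(1,2)[OF App.prems(2)] by (fastforce simp: fv_subst)
  ultimately show ?case by simp
next
  case (Tup t s)
  have "lin (subst \<sigma> t)" "lin (subst \<sigma> s)"
    using Tup.prems nocap_sub(3,4)[OF Tup.prems(2)] by (auto intro!: Tup.IH)
  moreover have "fv (subst \<sigma> t) \<inter> fv (subst \<sigma> s) = {}"
    using Tup.prems(1,4) nocap_sub(3,4)[OF Tup.prems(2)] by (fastforce simp: fv_subst)
  ultimately show ?case by simp
next
  case (Fn z t)
  note nc = nocap_Fn[OF Fn.prems(2)] nocap_Fn_fresh[OF Fn.prems(2)]
  have "lin (subst (\<sigma>(z := Var z)) t)"
    by (rule Fn.IH[OF _ nc(1)]) (use Fn.prems nc(2) in \<open>auto\<close>)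
  moreover have "z \<in> fv (subst (\<sigma>(z := Var z)) t)"
    using Fn.prems(1) by (auto simp: fv_subst[OF nc(1)])
  ultimately show ?case by simp
next
  case (LetTup x y s t)
  note nc = nocap_Let[OF LetTup.prems(2)] nocap_Let_fresh[OF LetTup.prems(2)]
  have "lin (subst (\<sigma>(x := Var x, y := Var y)) t)"
    by (rule LetTup.IH(2)[OF _ nc(1)]) (use LetTup.prems nc(2) in \<open>auto\<close>)
  moreover have "x \<in> fv (subst (\<sigma>(x := Var x, y := Var y)) t)"
      "y \<in> fv (subst (\<sigma>(x := Var x, y := Var y)) t)"
    using LetTup.prems(1) by (auto simp: fv_subst[OF nc(1)])
  moreover have "lin (subst \<sigma> s)"
    by (rule LetTup.IH(1)[OF _ nocap_sub(5)[OF LetTup.prems(2)]]) (use LetTup.prems in auto)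
  moreover have "fv (subst \<sigma> s) \<inter> (fv (subst (\<sigma>(x := Var x, y := Var y)) t) - {x, y}) = {}"
  proof -
    have "v = x \<or> v = y \<or> False" if v: "v \<in> fv (\<sigma> p)" "p \<in> fv s"
      "v \<in> fv ((\<sigma>(x := Var x, y := Var y)) q)" "q \<in> fv t" for v p q
    proof (cases "q = x \<or> q = y")
      case False
      then have "p \<noteq> q"
        using LetTup.prems(1) v by auto
      then show ?thesis
        using LetTup.prems(4)[of p q] v False by auto
    qed (use v in \<open>auto split: if_splits\<close>)
    then show ?thesis
      using LetTup.prems(1) by (fastforce simp: fv_subst[OF nc(1)] fv_subst[OF nocap_sub(5)[OF LetTup.prems(2)]])
  qed
  ultimately show ?case
    using LetTup.prems(1) by simp
qed auto

lemma has_ty_subst: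
  assumes "nocap \<sigma> t" "has_ty \<tau>' t A" "\<And>y. y \<in> fv t \<Longrightarrow> has_ty \<tau> (\<sigma> y) (\<tau>' y)"
  shows "has_ty \<tau> (subst \<sigma> t) A"
  using assms
proof (induction t arbitrary: \<sigma> \<tau> \<tau>' A)
  case (App t s)
  then obtain B where "has_ty \<tau>' t (B \<rightarrow> A)" "has_ty \<tau>' s B" by auto
  then have "has_ty \<tau> (subst \<sigma> t) (B \<rightarrow> A)" "has_ty \<tau> (subst \<sigma> s) B"
    using App.IH nocap_sub(1,2)[OF App.prems(1)] App.prems(3) by auto
  then show ?case by auto
next
  case (Tup t s)
  then obtain B C where "A = B \<otimes> C" "has_ty \<tau>' t B" "has_ty \<tau>' s C" by auto
  moreover from this have "has_ty \<tau> (subst \<sigma> t) B" "has_ty \<tau> (subst \<sigma> s) C"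
    using Tup.IH nocap_sub(3,4)[OF Tup.prems(1)] Tup.prems(3) by auto
  ultimately show ?case by auto
next
  case (Fn z t)
  then obtain B C where A: "A = B \<rightarrow> C" "has_ty (\<tau>'(z := B)) t C" by auto
  have "has_ty (\<tau>(z := B)) ((\<sigma>(z := Var z)) y) ((\<tau>'(z := B)) y)" if "y \<in> fv t" for y
    using Fn.prems(3)[of y] nocap_Fn_fresh[OF Fn.prems(1) that] that
    by (auto simp: has_ty_upd_fresh)
  then have "has_ty (\<tau>(z := B)) (subst (\<sigma>(z := Var z)) t) C"
    by (rule Fn.IH[OF nocap_Fn[OF Fn.prems(1)] A(2)])
  then show ?case using A by simp
next
  case (LetTup u v s t)
  then obtain B C where A: "has_ty \<tau>' s (B \<otimes> C)" "has_ty (\<tau>'(u := B, v := C)) t A" by auto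
  have "has_ty (\<tau>(u := B, v := C)) ((\<sigma>(u := Var u, v := Var v)) y) ((\<tau>'(u := B, v := C)) y)"
    if "y \<in> fv t" for y
  proof (cases "y = u \<or> y = v")
    case False
    then have "has_ty (\<tau>(u := B, v := C)) (\<sigma> y) (\<tau>' y)"
      using LetTup.prems(3)[of y] nocap_Let_fresh[OF LetTup.prems(1) that] that
      by (auto simp: has_ty_upd_fresh)
    then show ?thesis using False by auto
  qed auto
  then have "has_ty (\<tau>(u := B, v := C)) (subst (\<sigma>(u := Var u, v := Var v)) t) A"
    by (rule LetTup.IH(2)[OF nocap_Let[OF LetTup.prems(1)] A(2)])
  moreover have "has_ty \<tau> (subst \<sigma> s) (B \<otimes> C)"
    using LetTup.IH(1)[OF nocap_sub(5)[OF LetTup.prems(1)] A(1)] LetTup.prems(3) by auto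
  ultimately show ?case by auto
qed auto

text \<open>Subject expansion finds an assignment for each of two subterms independently. They can
  be glued because linear subterms share no free variable.\<close>

lemma has_ty_merge:
  assumes "has_ty \<tau>1 t A" "\<And>y. y \<in> fv t \<Longrightarrow> has_ty \<tau> (\<sigma> y) (\<tau>1 y)"
    "has_ty \<tau>2 s B" "\<And>y. y \<in> fv s \<Longrightarrow> has_ty \<tau> (\<sigma> y) (\<tau>2 y)" "fv t \<inter> fv s = {}"
  shows "\<exists>\<tau>'. has_ty \<tau>' t A \<and> has_ty \<tau>' s B \<and> (\<forall>y \<in> fv t \<union> fv s. has_ty \<tau> (\<sigma> y) (\<tau>' y))"
proof (intro exI conjI)
  let ?\<tau> = "\<lambda>y. if y \<in> fv t then \<tau>1 y else \<tau>2 y"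
  show "has_ty ?\<tau> t A"
    using assms(1) has_ty_cong[of t \<tau>1 ?\<tau>] by simp
  have "\<And>y. y \<in> fv s \<Longrightarrow> \<tau>2 y = ?\<tau> y"
    using assms(5) by auto
  from has_ty_cong[of s \<tau>2 ?\<tau>, OF this] assms(3) show "has_ty ?\<tau> s B"
    by blast
qed (use assms in auto)

text \<open>Subject expansion, which fails for terms that are not linear.\<close>

lemma has_ty_subst_inv:
  assumes "lin t" "nocap \<sigma> t" "has_ty \<tau> (subst \<sigma> t) A"
  shows "\<exists>\<tau>'. has_ty \<tau>' t A \<and> (\<forall>y \<in> fv t. has_ty \<tau> (\<sigma> y) (\<tau>' y))"
  using assms
proof (induction t arbitrary: \<sigma> \<tau> A)
  case (Var x)
  then show ?case by (intro exI[of _ "\<lambda>_. A"]) auto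
next
  case (App t s)
  then obtain B where "has_ty \<tau> (subst \<sigma> t) (B \<rightarrow> A)" "has_ty \<tau> (subst \<sigma> s) B" by auto
  with App.IH App.prems nocap_sub(1,2)[OF App.prems(2)] obtain \<tau>1 \<tau>2 where
    *: "has_ty \<tau>1 t (B \<rightarrow> A)" "\<And>y. y \<in> fv t \<Longrightarrow> has_ty \<tau> (\<sigma> y) (\<tau>1 y)"
    "has_ty \<tau>2 s B" "\<And>y. y \<in> fv s \<Longrightarrow> has_ty \<tau> (\<sigma> y) (\<tau>2 y)"
    by (metis lin.simps(2))
  then show ?case
    using has_ty_merge[OF *] App.prems(1) by auto
next
  case (Tup t s)
  then obtain B C where A: "A = B \<otimes> C" "has_ty \<tau> (subst \<sigma> t) B" "has_ty \<tau> (subst \<sigma> s) C" by auto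
  with Tup.IH Tup.prems nocap_sub(3,4)[OF Tup.prems(2)] obtain \<tau>1 \<tau>2 where
    *: "has_ty \<tau>1 t B" "\<And>y. y \<in> fv t \<Longrightarrow> has_ty \<tau> (\<sigma> y) (\<tau>1 y)"
    "has_ty \<tau>2 s C" "\<And>y. y \<in> fv s \<Longrightarrow> has_ty \<tau> (\<sigma> y) (\<tau>2 y)"
    by (metis lin.simps(4))
  then show ?case
    using has_ty_merge[OF *] Tup.prems(1) A(1) by auto
next
  case (Fn z t)
  then obtain B C where A: "A = B \<rightarrow> C" "has_ty (\<tau>(z := B)) (subst (\<sigma>(z := Var z)) t) C"
    by auto
  have "\<exists>\<tau>'. has_ty \<tau>' t C \<and> (\<forall>y \<in> fv t. has_ty (\<tau>(z := B)) ((\<sigma>(z := Var z)) y) (\<tau>' y))"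
    by (rule Fn.IH[OF _ nocap_Fn[OF Fn.prems(2)] A(2)]) (use Fn.prems(1) in simp)
  then obtain \<tau>' where \<tau>': "has_ty \<tau>' t C"
    "\<And>y. y \<in> fv t \<Longrightarrow> has_ty (\<tau>(z := B)) ((\<sigma>(z := Var z)) y) (\<tau>' y)"
    by blast
  \<comment> \<open>Linearity puts \<open>z\<close> into the body, where it is replaced by itself;
    so its type there is forced.\<close>
  have "\<tau>' z = B"
    using \<tau>'(2)[of z] Fn.prems(1) by auto
  then have "has_ty \<tau>' (Fn z t) A"
    using \<tau>'(1) A(1) by auto
  moreover have "has_ty \<tau> (\<sigma> y) (\<tau>' y)" if "y \<in> fv (Fn z t)" for y
    using \<tau>'(2)[of y] that nocap_Fn_fresh[OF Fn.prems(2), of y]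
    by (auto simp: has_ty_upd_fresh split: if_splits)
  ultimately show ?case by blast
next
  case (LetTup u v s t)
  then obtain B C where A: "has_ty \<tau> (subst \<sigma> s) (B \<otimes> C)"
    "has_ty (\<tau>(u := B, v := C)) (subst (\<sigma>(u := Var u, v := Var v)) t) A"
    by auto
  have "\<exists>\<tau>2. has_ty \<tau>2 t A
      \<and> (\<forall>y \<in> fv t. has_ty (\<tau>(u := B, v := C)) ((\<sigma>(u := Var u, v := Var v)) y) (\<tau>2 y))"
    by (rule LetTup.IH(2)[OF _ nocap_Let[OF LetTup.prems(2)] A(2)]) (use LetTup.prems(1) in simp)
  then obtain \<tau>2 where \<tau>2: "has_ty \<tau>2 t A"
    "\<And>y. y \<in> fv t \<Longrightarrow> has_ty (\<tau>(u := B, v := C)) ((\<sigma>(u := Var u, v := Var v)) y) (\<tau>2 y)"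
    by blast
  from A obtain \<tau>1 where \<tau>1: "has_ty \<tau>1 s (B \<otimes> C)" "\<And>y. y \<in> fv s \<Longrightarrow> has_ty \<tau> (\<sigma> y) (\<tau>1 y)"
    using LetTup.IH(1)[OF _ nocap_sub(5)[OF LetTup.prems(2)] A(1)] LetTup.prems(1) by auto
  have \<tau>2': "has_ty \<tau> (\<sigma> y) (\<tau>2 y)" if "y \<in> fv t - {u, v}" for y
    using \<tau>2(2)[of y] that nocap_Let_fresh[OF LetTup.prems(2), of y]
    by (auto simp: has_ty_upd_fresh split: if_splits)
  have uv: "\<tau>2 u = B" "\<tau>2 v = C"
    using \<tau>2(2)[of u] \<tau>2(2)[of v] LetTup.prems(1) by auto
  let ?\<tau> = "\<lambda>y. if y \<in> fv s then \<tau>1 y else \<tau>2 y"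
  have "has_ty ?\<tau> s (B \<otimes> C)"
    using \<tau>1(1) has_ty_cong[of s \<tau>1 ?\<tau>] by simp
  moreover have "\<And>y. y \<in> fv t \<Longrightarrow> \<tau>2 y = (?\<tau>(u := B, v := C)) y"
    using LetTup.prems(1) uv by auto
  from has_ty_cong[of t \<tau>2 "?\<tau>(u := B, v := C)", OF this] \<tau>2(1)
  have "has_ty (?\<tau>(u := B, v := C)) t A" by blast
  ultimately have "has_ty ?\<tau> (LetTup u v s t) A" by auto
  moreover have "\<forall>y \<in> fv (LetTup u v s t). has_ty \<tau> (\<sigma> y) (?\<tau> y)"
    using \<tau>1(2) \<tau>2' by auto
  ultimately show ?case by blast
qed

lemma nocap_single: "bv t \<inter> fv u = {} \<Longrightarrow> nocap (Var(x := u)) t"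
  by (auto simp: nocap_def)

lemma nocap_double: "bv t \<inter> (fv u \<union> fv v) = {} \<Longrightarrow> nocap (Var(x := u, y := v)) t"
  by (auto simp: nocap_def)

lemma fv_subst_single:
  assumes "bv t \<inter> fv u = {}" "x \<in> fv t"
  shows "fv (subst (Var(x := u)) t) = fv u \<union> (fv t - {x})"
  using assms by (auto simp: fv_subst[OF nocap_single] split: if_splits)

lemma fv_subst_double:
  assumes "bv t \<inter> (fv u \<union> fv v) = {}" "x \<in> fv t" "y \<in> fv t" "x \<noteq> y"
  shows "fv (subst (Var(x := u, y := v)) t) = fv u \<union> fv v \<union> (fv t - {x, y})"
  using assms by (auto simp: fv_subst[OF nocap_double] split: if_splits)

lemma sz_subst_single:
  assumes "lin t" "x \<in> fv t"
  shows "sz (subst (Var(x := u)) t) = sz t + sz u"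
proof -
  have "(\<Sum>y \<in> fv t. sz ((Var(x := u)) y)) = (\<Sum>y \<in> {x}. sz ((Var(x := u)) y))"
    by (rule sum.mono_neutral_right) (use assms in auto)
  then show ?thesis
    using assms by (simp add: sz_subst)
qed

lemma sz_subst_double:
  assumes "lin t" "x \<in> fv t" "y \<in> fv t" "x \<noteq> y"
  shows "sz (subst (Var(x := u, y := v)) t) = sz t + sz u + sz v"
proof -
  have "(\<Sum>z \<in> fv t. sz ((Var(x := u, y := v)) z)) = (\<Sum>z \<in> {x, y}. sz ((Var(x := u, y := v)) z))"
    by (rule sum.mono_neutral_right) (use assms in auto)
  then show ?thesis
    using assms by (simp add: sz_subst)
qed

text \<open>From left to right this is subject expansion: a type for \<open>u\<close> is recovered
  at the one place where \<open>x\<close> stands.\<close>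

lemma has_ty_subst_single_iff:
  assumes "lin t" "x \<in> fv t" "bv t \<inter> fv u = {}"
  shows "has_ty \<tau> (subst (Var(x := u)) t) A \<longleftrightarrow> (\<exists>B. has_ty (\<tau>(x := B)) t A \<and> has_ty \<tau> u B)"
proof
  assume "has_ty \<tau> (subst (Var(x := u)) t) A"
  then obtain \<tau>' where *: "has_ty \<tau>' t A" "\<And>y. y \<in> fv t \<Longrightarrow> has_ty \<tau> ((Var(x := u)) y) (\<tau>' y)"
    using has_ty_subst_inv[OF assms(1) nocap_single[OF assms(3)]] by blast
  have "has_ty (\<tau>(x := \<tau>' x)) t A"
    using *(1) by (rule has_ty_cong[THEN iffD1, rotated]) (use *(2) in force)
  with *(2)[OF assms(2)] show "\<exists>B. has_ty (\<tau>(x := B)) t A \<and> has_ty \<tau> u B"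
    by auto
qed (auto intro: has_ty_subst[OF nocap_single[OF assms(3)]])

lemma has_ty_subst_double_iff:
  assumes "lin t" "x \<in> fv t" "y \<in> fv t" "x \<noteq> y" "bv t \<inter> (fv u \<union> fv v) = {}"
  shows "has_ty \<tau> (subst (Var(x := u, y := v)) t) A
    \<longleftrightarrow> (\<exists>B C. has_ty (\<tau>(x := B, y := C)) t A \<and> has_ty \<tau> u B \<and> has_ty \<tau> v C)"
proof
  assume "has_ty \<tau> (subst (Var(x := u, y := v)) t) A"
  then obtain \<tau>' where *: "has_ty \<tau>' t A"
      "\<And>z. z \<in> fv t \<Longrightarrow> has_ty \<tau> ((Var(x := u, y := v)) z) (\<tau>' z)"
    using has_ty_subst_inv[OF assms(1) nocap_double[OF assms(5)]] by blast
  have "has_ty (\<tau>(x := \<tau>' x, y := \<tau>' y)) t A"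
    using *(1) by (rule has_ty_cong[THEN iffD1, rotated]) (use *(2) in force)
  with *(2)[OF assms(2)] *(2)[OF assms(3)] assms(4)
  show "\<exists>B C. has_ty (\<tau>(x := B, y := C)) t A \<and> has_ty \<tau> u B \<and> has_ty \<tau> v C"
    by auto
qed (use assms(4) in \<open>auto intro: has_ty_subst[OF nocap_double[OF assms(5)]]\<close>)

lemma lin_subst_single:
  assumes "lin t" "lin u" "bv t \<inter> fv u = {}" "(fv t - {x}) \<inter> fv u = {}"
  shows "lin (subst (Var(x := u)) t)"
  by (rule lin_subst[OF assms(1) nocap_single[OF assms(3)]]) (use assms in auto)

lemma lin_subst_double:
  assumes "lin t" "lin u" "lin v" "bv t \<inter> (fv u \<union> fv v) = {}" "(fv t - {x, y}) \<inter> (fv u \<union> fv v) = {}"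
    "fv u \<inter> fv v = {}"
  shows "lin (subst (Var(x := u, y := v)) t)"
  by (rule lin_subst[OF assms(1) nocap_double[OF assms(4)]]) (use assms in auto)

subsection \<open>Conversions that do not lose typings\<close>

primrec tmap :: "(name \<Rightarrow> ty) \<Rightarrow> ctxt \<Rightarrow> ctxt" where
  "tmap \<theta> [] = []"
| "tmap \<theta> (p # \<Gamma>) = (fst p, tsubst \<theta> (snd p)) # tmap \<theta> \<Gamma>"

lemma tmap_append [simp]: "tmap \<theta> (\<Gamma> @ \<Delta>) = tmap \<theta> \<Gamma> @ tmap \<theta> \<Delta>"
  by (induction \<Gamma>) auto

lemma tmap_eq_map: "tmap \<theta> \<Gamma> = map (\<lambda>p. (fst p, tsubst \<theta> (snd p))) \<Gamma>"
  by (induction \<Gamma>) auto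

lemma dom_tmap [simp]: "dom_ctxt (tmap \<theta> \<Gamma>) = dom_ctxt \<Gamma>"
  by (induction \<Gamma>) auto

lemma mset_tmap: "mset \<Delta> = mset \<Gamma> \<Longrightarrow> mset (tmap \<theta> \<Delta>) = mset (tmap \<theta> \<Gamma>)"
  by (simp add: tmap_eq_map)

lemma typing_tsubst: "\<Gamma> \<turnstile> t \<^bold>: A \<Longrightarrow> tmap \<theta> \<Gamma> \<turnstile> t \<^bold>: tsubst \<theta> A"
proof (induction rule: typing.induct)
  case (exchange \<Gamma> t A \<Delta>)
  then show ?case using typing.exchange mset_tmap by blast
qed (simp_all add: typing.var typing.fn typing.app typing.tup typing.let_tup)

lemma equality_tsubst: "\<Gamma> \<turnstile> t \<doteq> s \<^bold>: A \<Longrightarrow> tmap \<theta> \<Gamma> \<turnstile> t \<doteq> s \<^bold>: tsubst \<theta> A"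
proof (induction rule: equality.induct)
  case (cong_exchange \<Gamma> t s A \<Delta>)
  then show ?case using equality.cong_exchange mset_tmap by blast
next
  case (trans \<Gamma> t s A r)
  then show ?case using equality.trans by blast
next
  case (sym \<Gamma> t s A)
  then show ?case using equality.sym by blast
qed (simp_all add: typing_tsubst equality.ax equality.refl equality.cong_fn equality.cong_app
      equality.cong_tup equality.cong_let)

text \<open>Beta reduction and eta expansion are of this kind, so every type that is found for a normal
  form is also a type of the given term.\<close>

definition red :: "(name \<Rightarrow> ty) \<Rightarrow> trm \<Rightarrow> trm \<Rightarrow> ty \<Rightarrow> bool" where
  "red \<tau> t t' A \<longleftrightarrow> eqt \<tau> t t' A \<and> (\<forall>\<tau>' A'. has_ty \<tau>' t' A' \<longrightarrow> has_ty \<tau>' t A')"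

lemma red_eqt: "red \<tau> t t' A \<Longrightarrow> eqt \<tau> t t' A"
  and red_has_ty: "red \<tau> t t' A \<Longrightarrow> has_ty \<tau>' t' A' \<Longrightarrow> has_ty \<tau>' t A'"
  by (auto simp: red_def)

lemma red_wt: "red \<tau> t t' A \<Longrightarrow> wt \<tau> t' A"
  and red_fv: "red \<tau> t t' A \<Longrightarrow> fv t' = fv t"
  using eqt_typed by (auto simp: red_def)

lemma red_refl: "wt \<tau> t A \<Longrightarrow> red \<tau> t t A"
  by (simp add: red_def eqt_refl)

lemma red_trans [trans]: "red \<tau> t s A \<Longrightarrow> red \<tau> s r A \<Longrightarrow> red \<tau> t r A"
  by (auto simp: red_def intro: eqt_trans)

lemma red_Fn: "red (\<tau>(x := A)) t t' B \<Longrightarrow> x \<in> fv t \<Longrightarrow> red \<tau> (Fn x t) (Fn x t') (A \<rightarrow> B)"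
  by (auto simp: red_def intro: eqt_Fn)

lemma red_App:
  "red \<tau> t t' (A \<rightarrow> B) \<Longrightarrow> red \<tau> s s' A \<Longrightarrow> fv t \<inter> fv s = {} \<Longrightarrow> red \<tau> (App t s) (App t' s') B"
  unfolding red_def using eqt_App[of \<tau> t t' A B s s'] by auto blast

lemma red_Tup:
  "red \<tau> t t' A \<Longrightarrow> red \<tau> s s' B \<Longrightarrow> fv t \<inter> fv s = {} \<Longrightarrow> red \<tau> (Tup t s) (Tup t' s') (A \<otimes> B)"
  unfolding red_def using eqt_Tup[of \<tau> t t' A s s' B] by auto

lemma red_Let:
  assumes "red \<tau> s s' (A \<otimes> B)" "red (\<tau>(x := A, y := B)) t t' C"
    "x \<noteq> y" "x \<in> fv t" "y \<in> fv t" "fv s \<inter> (fv t - {x, y}) = {}"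
  shows "red \<tau> (LetTup x y s t) (LetTup x y s' t') C"
  using assms eqt_Let[of \<tau> s s' A B x y t t' C] unfolding red_def by auto blast

lemma ex_fresh: "finite (X :: name set) \<Longrightarrow> \<exists>z. z \<notin> X"
  by (simp add: ex_new_if_finite infinite_UNIV_nat)

lemma red_alpha_Fn:
  assumes "wt \<tau> (Fn x t) C" "z \<notin> fv t \<union> bv t"
  shows "red \<tau> (Fn x t) (Fn z (subst (Var(x := Var z)) t)) C"
proof -
  let ?t = "subst (Var(x := Var z)) t"
  have t: "lin t" "x \<in> fv t" "bv t \<inter> fv (Var z) = {}"
    using assms by (auto simp: wt_def)
  have fv: "fv ?t = insert z (fv t - {x})"
    using fv_subst_single[OF t(3,2)] by auto
  have "lin ?t"
    by (rule lin_subst_single) (use t assms in auto)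
  moreover have ty: "has_ty \<tau>' (Fn z ?t) A \<longleftrightarrow> has_ty \<tau>' (Fn x t) A" for \<tau>' A
  proof -
    have "has_ty (\<tau>'(z := D, x := B)) t E \<longleftrightarrow> has_ty (\<tau>'(x := B)) t E" for D B E
      by (rule has_ty_cong) (use assms in auto)
    then show ?thesis
      by (auto simp: has_ty_subst_single_iff[OF t])
  qed
  ultimately have "wt \<tau> (Fn z ?t) C"
    using assms(1) fv ty[of \<tau> C] by (simp only: wt_def lin.simps) blast
  then have "eqt \<tau> (Fn x t) (Fn z ?t) C"
    using assms fv by (intro eqt_ax conv_axiom.alpha_fn) auto
  then show ?thesis
    unfolding red_def using ty by blast
qed

lemma red_alpha_Let:
  assumes "wt \<tau> (LetTup x y s t) C" "{z, w} \<inter> (fv t \<union> bv t) = {}" "z \<noteq> w"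
  shows "red \<tau> (LetTup x y s t) (LetTup z w s (subst (Var(x := Var z, y := Var w)) t)) C"
proof -
  let ?t = "subst (Var(x := Var z, y := Var w)) t"
  have t: "lin t" "x \<in> fv t" "y \<in> fv t" "x \<noteq> y" "bv t \<inter> (fv (Var z) \<union> fv (Var w)) = {}"
    using assms by (auto simp: wt_def)
  have fv: "fv ?t = {z, w} \<union> (fv t - {x, y})"
    using fv_subst_double[OF t(5,2-4)] by auto
  have "lin ?t"
    by (rule lin_subst_double) (use t assms in auto)
  moreover have ty: "has_ty \<tau>' (LetTup z w s ?t) A \<longleftrightarrow> has_ty \<tau>' (LetTup x y s t) A" for \<tau>' A
  proof -
    have "has_ty (\<tau>'(z := D, w := D', x := B, y := B')) t E \<longleftrightarrow> has_ty (\<tau>'(x := B, y := B')) t E"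
      for D D' B B' E
      by (rule has_ty_cong) (use assms in auto)
    then show ?thesis
      using assms(3) by (auto simp: has_ty_subst_double_iff[OF t])
  qed
  moreover have "fv s \<inter> (fv t - {x, y}) = {}" "lin s"
    using assms(1) by (auto simp: wt_def)
  ultimately have "wt \<tau> (LetTup z w s ?t) C"
    using assms(1,3) assms(2) fv ty[of \<tau> C] by (simp only: wt_def lin.simps) blast
  then have "eqt \<tau> (LetTup x y s t) (LetTup z w s ?t) C"
    using assms fv by (intro eqt_ax conv_axiom.alpha_let) auto
  then show ?thesis
    unfolding red_def using ty by blast
qed

text \<open>\<open>subst\<close> does not rename, so a beta step may need a renaming first. The size
  is kept, which lets inductions on \<open>sz\<close> pass through the renaming.\<close>

lemma freshen:
  "wt \<tau> t A \<Longrightarrow> finite X \<Longrightarrow> \<exists>t'. red \<tau> t t' A \<and> bv t' \<inter> X = {} \<and> sz t' = sz t"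
proof (induction t arbitrary: \<tau> A)
  case (Var x)
  then show ?case by (intro exI[of _ "Var x"]) (auto simp: red_refl)
next
  case (App t s)
  then obtain B where *: "wt \<tau> t (B \<rightarrow> A)" "wt \<tau> s B" "fv t \<inter> fv s = {}"
    by (auto simp: wt_simps)
  with App.IH App.prems obtain t' s' where "red \<tau> t t' (B \<rightarrow> A)" "bv t' \<inter> X = {}" "sz t' = sz t"
    "red \<tau> s s' B" "bv s' \<inter> X = {}" "sz s' = sz s"
    by meson
  with * show ?case
    by (intro exI[of _ "App t' s'"]) (auto intro: red_App)
next
  case (Tup t s)
  then obtain B C where *: "A = B \<otimes> C" "wt \<tau> t B" "wt \<tau> s C" "fv t \<inter> fv s = {}"
    by (auto simp: wt_simps)
  with Tup.IH Tup.prems obtain t' s' where "red \<tau> t t' B" "bv t' \<inter> X = {}" "sz t' = sz t"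
    "red \<tau> s s' C" "bv s' \<inter> X = {}" "sz s' = sz s"
    by meson
  with * show ?case
    by (intro exI[of _ "Tup t' s'"]) (auto intro: red_Tup)
next
  case (Fn x t)
  then obtain B C where *: "A = B \<rightarrow> C" "wt (\<tau>(x := B)) t C" "x \<in> fv t"
    by (auto simp: wt_simps)
  from Fn.IH[OF *(2) Fn.prems(2)] obtain t' where
    t': "red (\<tau>(x := B)) t t' C" "bv t' \<inter> X = {}" "sz t' = sz t"
    by blast
  obtain z where z: "z \<notin> X \<union> fv t' \<union> bv t'"
    using ex_fresh[of "X \<union> fv t' \<union> bv t'"] Fn.prems(2) by auto
  let ?t = "subst (Var(x := Var z)) t'"
  have 1: "red \<tau> (Fn x t) (Fn x t') A"
    using t' * by (auto intro: red_Fn)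
  then have "red \<tau> (Fn x t) (Fn z ?t) A"
    using z by (intro red_trans[OF 1] red_alpha_Fn) (auto dest: red_wt)
  moreover have "bv ?t \<subseteq> bv t'"
    using bv_subst[of "Var(x := Var z)" t'] by (auto split: if_splits)
  moreover have "sz ?t = sz t'"
    by (subst sz_subst_single) (use red_wt[OF 1] in \<open>auto simp: wt_def\<close>)
  ultimately show ?case
    using t' z by (intro exI[of _ "Fn z ?t"]) auto
next
  case (LetTup x y s t)
  then obtain B C where *: "wt \<tau> s (B \<otimes> C)" "wt (\<tau>(x := B, y := C)) t A"
    "x \<noteq> y" "x \<in> fv t" "y \<in> fv t" "fv s \<inter> (fv t - {x, y}) = {}"
    by (auto simp: wt_simps)
  from LetTup.IH(2)[OF *(2) LetTup.prems(2)] obtain t' where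
    t': "red (\<tau>(x := B, y := C)) t t' A" "bv t' \<inter> X = {}" "sz t' = sz t"
    by blast
  from LetTup.IH(1)[OF *(1) LetTup.prems(2)] obtain s' where
    s': "red \<tau> s s' (B \<otimes> C)" "bv s' \<inter> X = {}" "sz s' = sz s"
    by blast
  obtain z where z: "z \<notin> X \<union> fv t' \<union> bv t'"
    using ex_fresh[of "X \<union> fv t' \<union> bv t'"] LetTup.prems(2) by auto
  obtain w where w: "w \<notin> insert z (X \<union> fv t' \<union> bv t')"
    using ex_fresh[of "insert z (X \<union> fv t' \<union> bv t')"] LetTup.prems(2) by auto
  let ?t = "subst (Var(x := Var z, y := Var w)) t'"
  have 1: "red \<tau> (LetTup x y s t) (LetTup x y s' t') A"
    using t' s' * by (auto intro: red_Let)
  then have "red \<tau> (LetTup x y s t) (LetTup z w s' ?t) A"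
    using z w by (intro red_trans[OF 1] red_alpha_Let) (auto dest: red_wt)
  moreover have "bv ?t \<subseteq> bv t'"
    using bv_subst[of "Var(x := Var z, y := Var w)" t'] by (auto split: if_splits)
  moreover have "sz ?t = sz t'"
    by (subst sz_subst_double) (use red_wt[OF 1] in \<open>auto simp: wt_def\<close>)
  ultimately show ?case
    using t' s' z w by (intro exI[of _ "LetTup z w s' ?t"]) auto
qed

lemma red_beta_Fn:
  assumes "wt \<tau> (App (Fn x t) u) C" "bv t \<inter> fv u = {}"
  shows "red \<tau> (App (Fn x t) u) (subst (Var(x := u)) t) C"
proof -
  have t: "lin t" "x \<in> fv t" "bv t \<inter> fv u = {}" "lin u" "(fv t - {x}) \<inter> fv u = {}"
    using assms by (auto simp: wt_def)
  have "has_ty \<tau>' (subst (Var(x := u)) t) A \<longleftrightarrow> has_ty \<tau>' (App (Fn x t) u) A" for \<tau>' A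
    by (auto simp: has_ty_subst_single_iff[OF t(1-3)])
  then show ?thesis
    using assms t fv_subst_single[OF t(3,2)] unfolding red_def
    by (auto intro!: eqt_ax conv_axiom.beta_fn lin_subst_single simp: wt_def)
qed

lemma red_beta_Let:
  assumes "wt \<tau> (LetTup x y (Tup u v) t) C" "bv t \<inter> (fv u \<union> fv v) = {}"
  shows "red \<tau> (LetTup x y (Tup u v) t) (subst (Var(x := u, y := v)) t) C"
proof -
  have t: "lin t" "x \<in> fv t" "y \<in> fv t" "x \<noteq> y" "bv t \<inter> (fv u \<union> fv v) = {}"
    and u: "lin u" "lin v" "(fv t - {x, y}) \<inter> (fv u \<union> fv v) = {}" "fv u \<inter> fv v = {}"
    using assms by (auto simp: wt_def)
  have "has_ty \<tau>' (subst (Var(x := u, y := v)) t) A \<longleftrightarrow> has_ty \<tau>' (LetTup x y (Tup u v) t) A"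
    for \<tau>' A
    by (auto simp: has_ty_subst_double_iff[OF t])
  then show ?thesis
    using assms t u fv_subst_double[OF t(5,2-4)] lin_subst_double[OF t(1) u(1,2) t(5) u(3,4)]
    unfolding red_def by (auto intro!: eqt_ax conv_axiom.beta_let simp: wt_def)
qed

lemma red_beta_Fn_sz:
  assumes "wt \<tau> (App (Fn x t) u) C"
  shows "\<exists>r. red \<tau> (App (Fn x t) u) r C \<and> sz r = sz t + sz u"
proof -
  from assms obtain A where A: "wt (\<tau>(x := A)) t C" "x \<in> fv t" "wt \<tau> u A" "(fv t - {x}) \<inter> fv u = {}"
    by (auto simp: wt_simps)
  from freshen[OF A(1), of "fv u"] obtain t' where
    t': "red (\<tau>(x := A)) t t' C" "bv t' \<inter> fv u = {}" "sz t' = sz t" by auto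
  have 1: "red \<tau> (App (Fn x t) u) (App (Fn x t') u) C"
    using t' A by (intro red_App red_Fn red_refl) auto
  show ?thesis
  proof (intro exI conjI)
    show "red \<tau> (App (Fn x t) u) (subst (Var(x := u)) t') C"
      using red_trans[OF 1 red_beta_Fn[OF red_wt[OF 1] t'(2)]] .
    show "sz (subst (Var(x := u)) t') = sz t + sz u"
      by (subst sz_subst_single) (use red_wt[OF 1] t'(3) in \<open>auto simp: wt_def\<close>)
  qed
qed

lemma red_beta_Let_sz:
  assumes "wt \<tau> (LetTup x y (Tup u v) t) C"
  shows "\<exists>r. red \<tau> (LetTup x y (Tup u v) t) r C \<and> sz r = sz t + sz u + sz v"
proof -
  from assms obtain A B where A: "wt (\<tau>(x := A, y := B)) t C" "x \<noteq> y" "x \<in> fv t" "y \<in> fv t"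
    "wt \<tau> (Tup u v) (A \<otimes> B)" "fv (Tup u v) \<inter> (fv t - {x, y}) = {}"
    unfolding wt_simps(5) by blast
  from freshen[OF A(1), of "fv u \<union> fv v"] obtain t' where
    t': "red (\<tau>(x := A, y := B)) t t' C" "bv t' \<inter> (fv u \<union> fv v) = {}" "sz t' = sz t" by auto
  have 1: "red \<tau> (LetTup x y (Tup u v) t) (LetTup x y (Tup u v) t') C"
    using t'(1) A by (intro red_Let red_refl) auto
  show ?thesis
  proof (intro exI conjI)
    show "red \<tau> (LetTup x y (Tup u v) t) (subst (Var(x := u, y := v)) t') C"
      using red_trans[OF 1 red_beta_Let[OF red_wt[OF 1] t'(2)]] .
    show "sz (subst (Var(x := u, y := v)) t') = sz t + sz u + sz v"
      by (subst sz_subst_double) (use red_wt[OF 1] t'(3) in \<open>auto simp: wt_def\<close>)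
  qed
qed

text \<open>Contraction with a body that has already been renamed: the form in which the two sides
  of a floating law are brought to one contractum.\<close>

lemma eqt_beta_fresh:
  assumes "eqt (\<tau>(x := B)) t t' C" "x \<in> fv t" "wt \<tau> u B" "(fv t - {x}) \<inter> fv u = {}"
    "bv t' \<inter> fv u = {}"
  shows "eqt \<tau> (App (Fn x t) u) (subst (Var(x := u)) t') C"
proof -
  have 1: "eqt \<tau> (App (Fn x t) u) (App (Fn x t') u) C"
    using assms by (intro eqt_App eqt_Fn eqt_refl) auto
  from eqt_trans[OF this red_eqt[OF red_beta_Fn[OF eqt_typed(2)[OF 1] assms(5)]]]
  show ?thesis .
qed

subsection \<open>Moving redexes outwards\<close>

lemma eqt_upd_fresh: "x \<notin> fv t \<Longrightarrow> eqt (\<tau>(x := B)) t s A \<longleftrightarrow> eqt \<tau> t s A"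
  by (rule eqt_cong) auto

lemma wt_upd_fresh: "x \<notin> fv t \<Longrightarrow> wt (\<tau>(x := B)) t A \<longleftrightarrow> wt \<tau> t A"
  by (rule wt_cong) auto

lemma subst_fresh: "x \<notin> fv t \<Longrightarrow> subst (Var(x := u)) t = t"
  by (rule subst_ident) auto

lemma freshen_eqt:
  assumes "wt \<tau> t A" "finite X"
  obtains t' where "eqt \<tau> t t' A" "bv t' \<inter> X = {}" "fv t' = fv t"
  using freshen[OF assms] red_eqt red_fv by blast

text \<open>A redex \<open>App (Fn x r) u\<close> acts as a \<open>let\<close> with one variable,
  and this is its commuting conversion: \<open>x\<close> is not free in \<open>s\<close>, so both
  sides contract to the same term. The constructor \<open>c\<close> is abstract because
  \<open>App\<close> and \<open>Tup\<close>, with the redex in either position, are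
  instances.\<close>

lemma float_binary:
  assumes c: "\<And>p q. fv (c p q) = fv p \<union> fv q" "\<And>p q. bv (c p q) = bv p \<union> bv q"
      "\<And>\<sigma> p q. subst \<sigma> (c p q) = c (subst \<sigma> p) (subst \<sigma> q)"
      "\<And>\<tau> p p' q q'. eqt \<tau> p p' C \<Longrightarrow> eqt \<tau> q q' D \<Longrightarrow> fv p \<inter> fv q = {} \<Longrightarrow> eqt \<tau> (c p q) (c p' q') A"
    and w: "wt \<tau> (App (Fn x r) u) C" "wt \<tau> s D" "fv (App (Fn x r) u) \<inter> fv s = {}" and x: "x \<notin> fv s"
  shows "eqt \<tau> (c (App (Fn x r) u) s) (App (Fn x (c r s)) u) A"
proof -
  from w obtain B where *: "wt (\<tau>(x := B)) r C" "x \<in> fv r" "wt \<tau> u B" "(fv r - {x}) \<inter> fv u = {}"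
    unfolding wt_simps fv.simps by blast
  obtain r' where r': "eqt (\<tau>(x := B)) r r' C" "bv r' \<inter> fv u = {}" "fv r' = fv r"
    using freshen_eqt[OF *(1)] finite_fv by blast
  obtain s' where s': "eqt \<tau> s s' D" "bv s' \<inter> fv u = {}" "fv s' = fv s"
    using freshen_eqt[OF w(2)] finite_fv by blast
  have "eqt \<tau> (c (App (Fn x r) u) s) (c (subst (Var(x := u)) r') s') A"
    using * r' s' w(3) by (intro c(4) eqt_beta_fresh) auto
  also have "c (subst (Var(x := u)) r') s' = subst (Var(x := u)) (c r' s')"
    using x s' by (simp add: c(3) subst_fresh)
  also have "eqt \<tau> (subst (Var(x := u)) (c r' s')) (App (Fn x (c r s)) u) A"
    using * r' s' w(3) x
    by (intro eqt_sym[OF eqt_beta_fresh[of _ _ B]] c(4)) (auto simp: eqt_upd_fresh c(1,2))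
  finally show ?thesis .
qed

lemma float_AppL:
  assumes "wt \<tau> (App (App (Fn x r) u) s) A" "x \<notin> fv s"
  shows "eqt \<tau> (App (App (Fn x r) u) s) (App (Fn x (App r s)) u) A"
proof -
  from assms obtain C where "wt \<tau> (App (Fn x r) u) (C \<rightarrow> A)" "wt \<tau> s C" "fv (App (Fn x r) u) \<inter> fv s = {}"
    unfolding wt_simps(2)[of _ _ s] by blast
  then show ?thesis
    by (intro float_binary[of App, OF _ _ _ eqt_App] assms(2)) auto
qed

lemma float_AppR:
  assumes "wt \<tau> (App s (App (Fn x r) u)) A" "x \<notin> fv s"
  shows "eqt \<tau> (App s (App (Fn x r) u)) (App (Fn x (App s r)) u) A"
proof -
  from assms obtain C where *: "wt \<tau> (App (Fn x r) u) C" "wt \<tau> s (C \<rightarrow> A)" "fv (App (Fn x r) u) \<inter> fv s = {}"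
    unfolding wt_simps(2)[of _ s] by blast
  show ?thesis
    by (rule float_binary[of "\<lambda>r s. App s r" C "C \<rightarrow> A", OF _ _ _ eqt_App *(1,2,3) assms(2)]) auto
qed

lemma float_TupL:
  assumes "wt \<tau> (Tup (App (Fn x r) u) s) A" "x \<notin> fv s"
  shows "eqt \<tau> (Tup (App (Fn x r) u) s) (App (Fn x (Tup r s)) u) A"
proof -
  from assms obtain C D where *: "wt \<tau> (App (Fn x r) u) C" "wt \<tau> s D" "fv (App (Fn x r) u) \<inter> fv s = {}"
    "A = C \<otimes> D"
    unfolding wt_simps(4) by blast
  show ?thesis
    unfolding *(4) by (rule float_binary[of Tup, OF _ _ _ eqt_Tup *(1-3) assms(2)]) auto
qed

lemma float_TupR:
  assumes "wt \<tau> (Tup s (App (Fn x r) u)) A" "x \<notin> fv s"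
  shows "eqt \<tau> (Tup s (App (Fn x r) u)) (App (Fn x (Tup s r)) u) A"
proof -
  from assms obtain C D where *: "wt \<tau> (App (Fn x r) u) C" "wt \<tau> s D" "fv (App (Fn x r) u) \<inter> fv s = {}"
    "A = D \<otimes> C"
    unfolding wt_simps(4) by blast
  show ?thesis
    unfolding *(4)
    by (rule float_binary[of "\<lambda>r s. Tup s r" C D, OF _ _ _ eqt_Tup *(1-3) assms(2)]) auto
qed

lemma float_Fn:
  assumes "wt \<tau> (Fn z (App (Fn x r) u)) A" "x \<noteq> z" "z \<notin> fv u"
  shows "eqt \<tau> (Fn z (App (Fn x r) u)) (App (Fn x (Fn z r)) u) A"
proof -
  from assms obtain B C D where *: "wt (\<tau>(z := C, x := B)) r D" "x \<in> fv r" "z \<in> fv r"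
    "wt \<tau> u B" "A = C \<rightarrow> D" "(fv r - {x}) \<inter> fv u = {}"
    by (auto simp: wt_simps wt_upd_fresh)
  have tw: "\<tau>(z := C, x := B) = \<tau>(x := B, z := C)"
    using assms(2) by auto
  obtain r' where r': "eqt (\<tau>(z := C, x := B)) r r' D" "bv r' \<inter> fv u = {}" "fv r' = fv r"
    using freshen_eqt[OF *(1)] finite_fv by blast
  have "eqt \<tau> (Fn z (App (Fn x r) u)) (Fn z (subst (Var(x := u)) r')) A"
    unfolding *(5) using * r' assms
    by (intro eqt_Fn eqt_beta_fresh) (auto simp: wt_upd_fresh)
  also have "Fn z (subst (Var(x := u)) r') = subst (Var(x := u)) (Fn z r')"
    using assms(2) by (simp add: fun_upd_twist[of x z] fun_upd_idem)
  also have "eqt \<tau> (subst (Var(x := u)) (Fn z r')) (App (Fn x (Fn z r)) u) A"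
    unfolding *(5) using * r'(1)[unfolded tw] r'(2,3) assms
    by (intro eqt_sym[OF eqt_beta_fresh[of _ _ B]] eqt_Fn) auto
  finally show ?thesis .
qed

lemma float_LetL:
  assumes "wt \<tau> (LetTup a b (App (Fn x r) u) s) A" "x \<notin> fv s" "{a, b} \<inter> fv u = {}"
  shows "eqt \<tau> (LetTup a b (App (Fn x r) u) s) (App (Fn x (LetTup a b r s)) u) A"
proof -
  from assms obtain B C D where *: "wt (\<tau>(x := B)) r (C \<otimes> D)" "x \<in> fv r" "wt \<tau> u B"
    "(fv r - {x}) \<inter> fv u = {}" "wt (\<tau>(a := C, b := D)) s A" "a \<noteq> b" "a \<in> fv s" "b \<in> fv s"
    "(fv r - {x}) \<inter> (fv s - {a, b}) = {}" "fv u \<inter> (fv s - {a, b}) = {}"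
    unfolding wt_simps fv.simps by blast
  obtain r' where r': "eqt (\<tau>(x := B)) r r' (C \<otimes> D)" "bv r' \<inter> fv u = {}" "fv r' = fv r"
    using freshen_eqt[OF *(1)] finite_fv by blast
  obtain s' where s': "eqt (\<tau>(a := C, b := D)) s s' A" "bv s' \<inter> fv u = {}" "fv s' = fv s"
    using freshen_eqt[OF *(5)] finite_fv by blast
  have tw: "\<tau>(x := B, a := C, b := D) = \<tau>(a := C, b := D, x := B)"
    using assms(2) * by auto
  have "eqt \<tau> (LetTup a b (App (Fn x r) u) s) (LetTup a b (subst (Var(x := u)) r') s') A"
    using * r' s' by (intro eqt_Let eqt_beta_fresh) auto
  also have "LetTup a b (subst (Var(x := u)) r') s' = subst (Var(x := u)) (LetTup a b r' s')"
    using assms(2) s' by (auto intro!: subst_ident[symmetric])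
  also have "eqt \<tau> (subst (Var(x := u)) (LetTup a b r' s')) (App (Fn x (LetTup a b r s)) u) A"
  proof (rule eqt_sym[OF eqt_beta_fresh[of _ _ B]])
    show "eqt (\<tau>(x := B)) (LetTup a b r s) (LetTup a b r' s') A"
      using * r' s' assms(2) by (intro eqt_Let) (auto simp: tw eqt_upd_fresh)
  qed (use * r' s' assms in auto)
  finally show ?thesis .
qed

lemma float_LetR:
  assumes "wt \<tau> (LetTup a b s (App (Fn x r) u)) A" "x \<notin> fv s" "{a, b} \<inter> insert x (fv u) = {}"
  shows "eqt \<tau> (LetTup a b s (App (Fn x r) u)) (App (Fn x (LetTup a b s r)) u) A"
proof -
  from assms obtain B C D where "wt (\<tau>(a := C, b := D, x := B)) r A" "wt \<tau> u B" "wt \<tau> s (C \<otimes> D)"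
    by (auto simp: wt_simps wt_upd_fresh)
  moreover have "x \<in> fv r" "(fv r - {x}) \<inter> fv u = {}" "a \<noteq> b" "a \<in> fv r" "b \<in> fv r"
    "fv s \<inter> (fv r - {a, b}) = {}" "fv s \<inter> fv u = {}"
    using assms by (auto simp: wt_simps)
  ultimately have *: "wt (\<tau>(a := C, b := D, x := B)) r A" "x \<in> fv r" "wt \<tau> u B"
    "(fv r - {x}) \<inter> fv u = {}" "wt \<tau> s (C \<otimes> D)" "a \<noteq> b" "a \<in> fv r" "b \<in> fv r"
    "fv s \<inter> (fv r - {a, b}) = {}" "fv s \<inter> fv u = {}"
    by blast+
  obtain r' where r': "eqt (\<tau>(a := C, b := D, x := B)) r r' A" "bv r' \<inter> fv u = {}" "fv r' = fv r"
    using freshen_eqt[OF *(1)] finite_fv by blast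
  obtain s' where s': "eqt \<tau> s s' (C \<otimes> D)" "bv s' \<inter> fv u = {}" "fv s' = fv s"
    using freshen_eqt[OF *(5)] finite_fv by blast
  have tw: "\<tau>(x := B, a := C, b := D) = \<tau>(a := C, b := D, x := B)"
    using assms(3) by auto
  have tw': "(Var(x := u))(a := Var a, b := Var b) = Var(x := u)"
    using assms(3) by auto
  have "eqt \<tau> (LetTup a b s (App (Fn x r) u)) (LetTup a b s' (subst (Var(x := u)) r')) A"
    using * r' s' assms by (intro eqt_Let eqt_beta_fresh) (auto simp: wt_upd_fresh)
  also have "LetTup a b s' (subst (Var(x := u)) r') = subst (Var(x := u)) (LetTup a b s' r')"
    unfolding subst.simps tw' using assms(2) s' by (simp add: subst_fresh)
  also have "eqt \<tau> (subst (Var(x := u)) (LetTup a b s' r')) (App (Fn x (LetTup a b s r)) u) A"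
  proof (rule eqt_sym[OF eqt_beta_fresh[of _ _ B]])
    show "eqt (\<tau>(x := B)) (LetTup a b s r) (LetTup a b s' r') A"
      using * r' s' assms(2) by (intro eqt_Let) (auto simp: tw eqt_upd_fresh)
  qed (use * r' s' assms in auto)
  finally show ?thesis .
qed

text \<open>Expansion is the direction that reflects typings: the expanded term has an arrow type
  only if \<open>s\<close> has it.\<close>

lemma red_eta_Fn:
  assumes "wt \<tau> s (A \<rightarrow> B)" "x \<notin> fv s"
  shows "red \<tau> s (Fn x (App s (Var x))) (A \<rightarrow> B)"
proof -
  have "wt \<tau> (Fn x (App s (Var x))) (A \<rightarrow> B)"
    using assms by (auto simp: wt_simps wt_upd_fresh)
  then have "eqt \<tau> s (Fn x (App s (Var x))) (A \<rightarrow> B)"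
    using assms by (intro eqt_sym[OF eqt_ax] conv_axiom.eta_fn) auto
  then show ?thesis
    using assms by (auto simp: red_def has_ty_upd_fresh)
qed

lemma eqt_expand_Var:
  assumes "wt \<tau> s C" "z \<in> fv s"
  shows "eqt \<tau> s (App (Fn z s) (Var z)) C"
proof -
  obtain s' where s': "eqt \<tau> s s' C" "bv s' \<inter> {z} = {}" "fv s' = fv s"
    using freshen_eqt[OF assms(1), of "{z}"] by blast
  have "eqt \<tau> (App (Fn z s) (Var z)) (subst (Var(z := Var z)) s') C"
    using s' assms by (intro eqt_beta_fresh[of _ _ "\<tau> z"]) (auto simp: wt_simps)
  also have "subst (Var(z := Var z)) s' = s'"
    by (rule subst_ident) auto
  finally show ?thesis
    using s'(1) eqt_sym eqt_trans by blast
qed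

lemma commute_AppR:
  assumes "wt \<tau> (LetTup u v p (App f q)) C" "{u, v} \<inter> fv f = {}"
  shows "eqt \<tau> (App f (LetTup u v p q)) (LetTup u v p (App f q)) C"
proof (rule eqt_ax)
  show "conv_axiom (App f (LetTup u v p q)) (LetTup u v p (App f q))"
    using conv_axiom.commute[of u "CAppR f Hole" v p q] assms by simp
  show "wt \<tau> (App f (LetTup u v p q)) C"
    using assms by (auto simp: wt_simps wt_upd_fresh)
qed (use assms in \<open>auto simp: wt_simps\<close>)

lemma commute_TupL:
  assumes "wt \<tau> (LetTup u v p (Tup q f)) C" "{u, v} \<inter> fv f = {}"
  shows "eqt \<tau> (Tup (LetTup u v p q) f) (LetTup u v p (Tup q f)) C"
proof (rule eqt_ax)
  show "conv_axiom (Tup (LetTup u v p q) f) (LetTup u v p (Tup q f))"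
    using conv_axiom.commute[of u "CTupL Hole f" v p q] assms by simp
  show "wt \<tau> (Tup (LetTup u v p q) f) C"
    using assms by (auto simp: wt_simps wt_upd_fresh)
qed (use assms in \<open>auto simp: wt_simps\<close>)

lemma commute_TupR:
  assumes "wt \<tau> (LetTup u v p (Tup f q)) C" "{u, v} \<inter> fv f = {}"
  shows "eqt \<tau> (Tup f (LetTup u v p q)) (LetTup u v p (Tup f q)) C"
proof (rule eqt_ax)
  show "conv_axiom (Tup f (LetTup u v p q)) (LetTup u v p (Tup f q))"
    using conv_axiom.commute[of u "CTupR f Hole" v p q] assms by simp
  show "wt \<tau> (Tup f (LetTup u v p q)) C"
    using assms by (auto simp: wt_simps wt_upd_fresh)
qed (use assms in \<open>auto simp: wt_simps\<close>)

text \<open>In the redex \<open>(fn z => s) z\<close> the argument is replaced by its own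
  \<open>let\<close> expansion, and the \<open>let\<close> is commuted out. The remaining redex
  stays uncontracted, which does no harm because \<open>red_cf\<close> measures types and not
  terms.\<close>

lemma red_eta_Let:
  assumes "wt \<tau> s C" "z \<in> fv s" "\<tau> z = A \<otimes> B" "u \<noteq> v" "u \<notin> fv s" "v \<notin> fv s"
  shows "red \<tau> s (LetTup u v (Var z) (App (Fn z s) (Tup (Var u) (Var v)))) C"
proof -
  let ?q = "App (Fn z s) (Tup (Var u) (Var v))"
  have wz: "wt (\<tau>(z := A \<otimes> B)) s C"
    using assms by (simp add: fun_upd_idem)
  have "wt (\<tau>(u := A, v := B, z := A \<otimes> B)) s C"
    by (rule wt_cong[THEN iffD1, OF _ wz]) (use assms in auto)
  then have w: "wt \<tau> (LetTup u v (Var z) ?q) C"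
    using assms by (auto simp: wt_simps)
  have e: "eqt \<tau> (LetTup u v (Var z) (Tup (Var u) (Var v))) (Var z) (A \<otimes> B)"
    using assms by (intro eqt_ax conv_axiom.eta_let) (auto simp: wt_simps)
  have "eqt \<tau> s (App (Fn z s) (Var z)) C"
    using assms by (intro eqt_expand_Var)
  also have "eqt \<tau> (App (Fn z s) (Var z)) (App (Fn z s) (LetTup u v (Var z) (Tup (Var u) (Var v)))) C"
    by (rule eqt_App[OF eqt_refl eqt_sym[OF e]]) (use assms(2) wz in \<open>auto simp: wt_simps\<close>)
  also have "eqt \<tau> (App (Fn z s) (LetTup u v (Var z) (Tup (Var u) (Var v)))) (LetTup u v (Var z) ?q) C"
    using assms w by (intro commute_AppR) auto
  finally have "eqt \<tau> s (LetTup u v (Var z) ?q) C" .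
  moreover have "has_ty \<tau>' s A'" if ty: "has_ty \<tau>' (LetTup u v (Var z) ?q) A'" for \<tau>' A'
  proof -
    from ty assms(4) obtain D E where "\<tau>' z = D \<otimes> E" "has_ty (\<tau>'(u := D, v := E, z := D \<otimes> E)) s A'"
      by auto
    moreover have "(\<tau>'(u := D, v := E, z := D \<otimes> E)) x = \<tau>' x" if "x \<in> fv s" for x
      using that assms(5,6) \<open>\<tau>' z = D \<otimes> E\<close> by auto
    ultimately show ?thesis
      using has_ty_cong[of s "\<tau>'(u := D, v := E, z := D \<otimes> E)" \<tau>' A'] by blast
  qed
  ultimately show ?thesis
    unfolding red_def by blast
qed

subsection \<open>Cut-free forms\<close>

text \<open>The last form reads: let \<open>x\<close> be \<open>h t\<close> in \<open>r\<close>; it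
  brings the head variable with its first argument to the root. Only abstractions and pairs carry a
  size bound, since only they can become part of a new redex.\<close>

definition head_form :: "name set \<Rightarrow> trm \<Rightarrow> nat \<Rightarrow> bool" where
  "head_form X s n \<longleftrightarrow> (\<exists>x. s = Var x) \<or> (\<exists>x r. s = Fn x r \<and> sz s \<le> n)
    \<or> (\<exists>p q. s = Tup p q \<and> sz s \<le> n) \<or> (\<exists>x r h t. s = App (Fn x r) (App (Var h) t) \<and> x \<notin> X)"

lemma head_form_mono: "head_form X s n \<Longrightarrow> n \<le> m \<Longrightarrow> head_form X s m"
  unfolding head_form_def by (elim disjE) (auto intro: le_trans)

text \<open>No free variable has a tensor type, so no \<open>let\<close> is stuck on a variable. An
  elimination then either meets its introduction and is contracted, which decreases
  \<open>sz\<close>, or applies a variable, or acts on a named application, which floats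
  out.\<close>

lemma red_head_form:
  assumes "wt \<tau> s C" "\<And>x A B. x \<in> fv s \<Longrightarrow> \<tau> x \<noteq> A \<otimes> B" "finite X" "fv s \<subseteq> X"
  shows "\<exists>s'. red \<tau> s s' C \<and> head_form X s' (sz s)"
  using assms
proof (induction "sz s" arbitrary: s C X rule: less_induct)
  case less
  obtain s0 where s0: "red \<tau> s s0 C" "bv s0 \<inter> X = {}" "sz s0 = sz s"
    using freshen[OF less.prems(1,3)] by blast
  note w0 = red_wt[OF s0(1)]
  have fv0: "fv s0 \<subseteq> X" "\<And>x A B. x \<in> fv s0 \<Longrightarrow> \<tau> x \<noteq> A \<otimes> B"
    using red_fv[OF s0(1)] less.prems by auto
  have "\<exists>s'. red \<tau> s0 s' C \<and> head_form X s' (sz s0)"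
  proof (cases s0)
    case (Var x)
    then show ?thesis
      using w0 by (intro exI[of _ s0]) (auto simp: red_refl head_form_def)
  next
    case (Fn x r)
    then show ?thesis
      using w0 by (intro exI[of _ s0]) (auto simp: red_refl head_form_def)
  next
    case (Tup p q)
    then show ?thesis
      using w0 by (intro exI[of _ s0]) (auto simp: red_refl head_form_def)
  next
    case (App t u)
    then obtain B where B: "wt \<tau> t (B \<rightarrow> C)" "wt \<tau> u B" "fv t \<inter> fv u = {}"
      using w0 by (auto simp: wt_simps)
    have "\<exists>t'. red \<tau> t t' (B \<rightarrow> C) \<and> head_form X t' (sz t)"
      by (rule less.hyps[OF _ B(1)]) (use App fv0 s0(3) less.prems in auto)
    then obtain t' where t': "red \<tau> t t' (B \<rightarrow> C)" "head_form X t' (sz t)"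
      by blast
    note wt' = red_wt[OF t'(1)]
    have 1: "red \<tau> s0 (App t' u) C"
      unfolding App by (intro red_App[OF t'(1)] red_refl B)
    note w1 = red_wt[OF 1]
    from t'(2) consider (var) h where "t' = Var h" | (fn_) x r where "t' = Fn x r" "sz t' \<le> sz t"
      | (tup) p q where "t' = Tup p q"
      | (app) x r h a where "t' = App (Fn x r) (App (Var h) a)" "x \<notin> X"
      unfolding head_form_def by blast
    then show ?thesis
    proof cases
      case var
      obtain x where x: "x \<notin> X"
        using ex_fresh less.prems(3) by blast
      \<comment> \<open>Beta expansion with the trivial continuation: the application of
        \<open>h\<close> gets the name \<open>x\<close>.\<close>
      let ?s = "App (Fn x (Var x)) (App (Var h) u)"
      have "wt \<tau> ?s C"
        using w1 var by (auto simp: wt_simps)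
      then have "eqt \<tau> (App t' u) ?s C"
        using red_eqt[OF red_beta_Fn[of \<tau> x "Var x" "App (Var h) u" C]] var
        by (auto intro: eqt_sym)
      then have "red \<tau> (App t' u) ?s C"
        using var by (auto simp: red_def)
      with 1 x show ?thesis
        unfolding head_form_def using red_trans by blast
    next
      case fn_
      obtain r' where r': "red \<tau> (App t' u) r' C" "sz r' = sz r + sz u"
        using red_beta_Fn_sz[of \<tau> x r u C] w1 fn_ by auto
      have fvr: "fv r' = fv s0"
        using red_fv[OF r'(1)] red_fv[OF 1] by simp
      have "\<exists>s'. red \<tau> r' s' C \<and> head_form X s' (sz r')"
      proof (rule less.hyps[OF _ red_wt[OF r'(1)]])
        show "sz r' < sz s"
          using fn_ r'(2) App s0(3) by simp
      qed (use fv0 less.prems(3) fvr in auto)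
      moreover have "sz r' \<le> sz s0"
        using r' fn_ App by auto
      ultimately show ?thesis
        using red_trans[OF 1 red_trans[OF r'(1)]] head_form_mono by blast
    next
      case tup
      then show ?thesis
        using wt' by (auto simp: wt_simps)
    next
      case app
      let ?s = "App (Fn x (App r u)) (App (Var h) a)"
      have x: "x \<notin> fv u"
        using app(2) App fv0 by auto
      have "eqt \<tau> (App t' u) ?s C"
        using w1 x unfolding app by (intro float_AppL)
      moreover have "has_ty \<tau>' (App t' u) A'" if "has_ty \<tau>' ?s A'" for \<tau>' A'
        using that x unfolding app by (auto simp: has_ty_upd_fresh)
      ultimately have "red \<tau> (App t' u) ?s C"
        unfolding red_def by blast
      with 1 app(2) show ?thesis
        unfolding head_form_def using red_trans by blast
    qed
  next
    case (LetTup a b p q)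
    then obtain A B where B: "wt \<tau> p (A \<otimes> B)" "wt (\<tau>(a := A, b := B)) q C"
      "a \<noteq> b" "a \<in> fv q" "b \<in> fv q" "fv p \<inter> (fv q - {a, b}) = {}"
      using w0 unfolding LetTup wt_simps by blast
    \<comment> \<open>The new name has to avoid \<open>a\<close> and \<open>b\<close> as well: its
      binder will be moved around \<open>q\<close>, in which they are free.\<close>
    have "\<exists>t'. red \<tau> p t' (A \<otimes> B) \<and> head_form ({a, b} \<union> X) t' (sz p)"
      by (rule less.hyps[OF _ B(1)]) (use LetTup fv0 s0(3) less.prems in auto)
    then obtain t' where t': "red \<tau> p t' (A \<otimes> B)" "head_form ({a, b} \<union> X) t' (sz p)"
      by blast
    note wt' = red_wt[OF t'(1)]
    have 1: "red \<tau> s0 (LetTup a b t' q) C"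
      unfolding LetTup by (intro red_Let[OF t'(1)] red_refl B)
    note w1 = red_wt[OF 1]
    from t'(2) consider (var) h where "t' = Var h" | (fn_) x r where "t' = Fn x r"
      | (tup) p1 p2 where "t' = Tup p1 p2" "sz t' \<le> sz p"
      | (app) x r h u where "t' = App (Fn x r) (App (Var h) u)" "x \<notin> {a, b} \<union> X"
      unfolding head_form_def by blast
    then show ?thesis
    proof cases
      case var
      have "h \<in> fv s0"
        using red_fv[OF t'(1)] var LetTup by auto
      then show ?thesis
        using wt' fv0(2) var by (auto simp: wt_simps)
    next
      case fn_
      then show ?thesis
        using wt' by (auto simp: wt_simps)
    next
      case tup
      obtain r' where r': "red \<tau> (LetTup a b t' q) r' C" "sz r' = sz q + sz p1 + sz p2"
        using red_beta_Let_sz[of \<tau> a b p1 p2 q C] w1 tup by auto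
      have fvr: "fv r' = fv s0"
        using red_fv[OF r'(1)] red_fv[OF 1] by simp
      have "\<exists>s'. red \<tau> r' s' C \<and> head_form X s' (sz r')"
      proof (rule less.hyps[OF _ red_wt[OF r'(1)]])
        show "sz r' < sz s"
          using tup r'(2) LetTup s0(3) by simp
      qed (use fv0 less.prems(3) fvr in auto)
      moreover have "sz r' \<le> sz s0"
        using r' tup LetTup by auto
      ultimately show ?thesis
        using red_trans[OF 1 red_trans[OF r'(1)]] head_form_mono by blast
    next
      case app
      let ?s = "App (Fn x (LetTup a b r q)) (App (Var h) u)"
      have ab: "{a, b} \<inter> X = {}" "fv p \<subseteq> X" "fv q - {a, b} \<subseteq> X"
        using s0(2) LetTup fv0(1) by auto
      have fvu: "fv (App (Var h) u) \<subseteq> X" "fv r - {x} \<subseteq> X"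
        using red_fv[OF t'(1)] ab app by auto
      have x: "x \<notin> fv q"
        using ab(3) app(2) by auto
      have "eqt \<tau> (LetTup a b t' q) ?s C"
        using w1 x fvu ab unfolding app by (intro float_LetL) auto
      moreover have "has_ty \<tau>' (LetTup a b t' q) A'" if "has_ty \<tau>' ?s A'" for \<tau>' A'
      proof -
        have "has_ty (\<tau>'(x := D, a := A, b := B)) q A' \<longleftrightarrow> has_ty (\<tau>'(a := A, b := B)) q A'" for A B D
          by (rule has_ty_cong) (use x in auto)
        with that show ?thesis
          unfolding app by auto
      qed
      ultimately have "red \<tau> (LetTup a b t' q) ?s C"
        unfolding red_def by blast
      with 1 app(2) show ?thesis
        unfolding head_form_def using red_trans by blast
    qed
  qed
  then show ?case
    using s0 red_trans by metis
qed


lemma sum_upd: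
  fixes f :: "'b \<Rightarrow> 'a :: comm_monoid_add"
  assumes "finite V" "x \<in> V"
  shows "(\<Sum>y \<in> V. f ((\<tau>(x := B)) y)) = f B + (\<Sum>y \<in> V - {x}. f (\<tau> y))"
proof -
  have "(\<Sum>y \<in> V. f ((\<tau>(x := B)) y)) = f ((\<tau>(x := B)) x) + (\<Sum>y \<in> V - {x}. f ((\<tau>(x := B)) y))"
    by (rule sum.remove[OF assms])
  also have "(\<Sum>y \<in> V - {x}. f ((\<tau>(x := B)) y)) = (\<Sum>y \<in> V - {x}. f (\<tau> y))"
    by (rule sum.cong) auto
  finally show ?thesis by simp
qed

lemma sum_upd2:
  fixes f :: "'b \<Rightarrow> 'a :: comm_monoid_add"
  assumes "finite V" "x \<in> V" "y \<in> V" "x \<noteq> y"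
  shows "(\<Sum>z \<in> V. f ((\<tau>(x := A, y := B)) z)) = f A + f B + (\<Sum>z \<in> V - {x, y}. f (\<tau> z))"
proof -
  have "V - {y} - {x} = V - {x, y}" by auto
  then show ?thesis
    using assms sum_upd[of V y f "\<tau>(x := A)" B] sum_upd[of "V - {y}" x f \<tau> A]
    by (simp add: ac_simps del: fun_upd_apply)
qed

text \<open>Cut-free forms: the left rules of the sequent calculus appear as a \<open>let\<close> on a variable and
  as a beta-redex that names an application of a variable. The set \<open>X\<close> collects the names that
  the binders have to avoid.\<close>

inductive cf :: "name set \<Rightarrow> (name \<Rightarrow> ty) \<Rightarrow> trm \<Rightarrow> ty \<Rightarrow> bool" where
  cf_var: "\<tau> x = TVar a \<Longrightarrow> cf X \<tau> (Var x) (TVar a)"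
| cf_fn: "\<lbrakk>x \<notin> X; x \<in> fv s; cf (insert x X) (\<tau>(x := A)) s B\<rbrakk> \<Longrightarrow> cf X \<tau> (Fn x s) (A \<rightarrow> B)"
| cf_tup: "\<lbrakk>cf X \<tau> p A; cf X \<tau> q B; fv p \<inter> fv q = {}\<rbrakk> \<Longrightarrow> cf X \<tau> (Tup p q) (A \<otimes> B)"
| cf_let: "\<lbrakk>u \<noteq> v; u \<notin> X; v \<notin> X; z \<in> X; u \<in> fv s; v \<in> fv s; z \<notin> fv s; \<tau> z = A \<otimes> B;
    cf ({u, v} \<union> X) (\<tau>(u := A, v := B)) s C\<rbrakk> \<Longrightarrow> cf X \<tau> (LetTup u v (Var z) s) C"
| cf_app: "\<lbrakk>x \<notin> X; h \<in> X; x \<in> fv r; h \<notin> fv t; h \<notin> fv r; x \<notin> fv t; fv t \<inter> fv r = {};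
    \<tau> h = A \<rightarrow> B; cf X \<tau> t A; cf (insert x X) (\<tau>(x := B)) r C\<rbrakk>
    \<Longrightarrow> cf X \<tau> (App (Fn x r) (App (Var h) t)) C"

lemma cf_wt: "cf X \<tau> s C \<Longrightarrow> wt \<tau> s C"
proof (induction rule: cf.induct)
  case (cf_let u v X z s \<tau> A B C)
  have "wt (\<tau>(u := A, v := B)) s C"
    by (rule cf_let.IH)
  with cf_let.hyps show ?case by (auto simp: wt_simps)
next
  case (cf_app x X h r t \<tau> A B C)
  have "wt (\<tau>(x := B)) r C"
    by (rule cf_app.IH)
  with cf_app.hyps cf_app.IH(1) show ?case by (auto simp: wt_simps)
next
  case (cf_fn x X s \<tau> A B)
  have "wt (\<tau>(x := A)) s B"
    by (rule cf_fn.IH)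
  with cf_fn.hyps show ?case by (auto simp: wt_simps)
qed (auto simp: wt_simps)

fun tsz :: "ty \<Rightarrow> nat" where
  "tsz (TVar a) = 0"
| "tsz (A \<otimes> B) = Suc (tsz A + tsz B)"
| "tsz (A \<rightarrow> B) = Suc (tsz A + tsz B)"

text \<open>The induction is on the number of connectives in the sequent, because eta expansion lets
  the term grow. The two invertible rules, arrow in the goal and tensor among the assumptions, are
  applied by eta expansion as long as possible. After that the root of a head form shows the last
  rule, and its premises have fewer connectives.\<close>

lemma red_cf:
  assumes "wt \<tau> s C" "finite X" "fv s \<subseteq> X"
  shows "\<exists>s'. red \<tau> s s' C \<and> cf X \<tau> s' C"
  using assms
proof (induction "(\<Sum>x \<in> fv s. tsz (\<tau> x)) + tsz C" arbitrary: \<tau> s C X rule: less_induct)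
  case less
  consider (arrow) A B where "C = A \<rightarrow> B" | (tensor) z A B where "z \<in> fv s" "\<tau> z = A \<otimes> B"
    | (focus) "\<And>A B. C \<noteq> A \<rightarrow> B" "\<And>x A B. x \<in> fv s \<Longrightarrow> \<tau> x \<noteq> A \<otimes> B"
    by blast
  then show ?case
  proof cases
    case arrow
    obtain x where x: "x \<notin> X"
      using ex_fresh less.prems(2) by blast
    with less.prems(3) have x': "x \<notin> fv s" by blast
    have w: "wt (\<tau>(x := A)) (App s (Var x)) B"
      using less.prems(1) x' unfolding arrow by (auto simp: wt_simps wt_upd_fresh)
    have "\<exists>s'. red (\<tau>(x := A)) (App s (Var x)) s' B \<and> cf (insert x X) (\<tau>(x := A)) s' B"
    proof (rule less.hyps[OF _ w])
      have "(\<Sum>y \<in> fv (App s (Var x)). tsz ((\<tau>(x := A)) y)) = tsz A + (\<Sum>y \<in> fv s. tsz (\<tau> y))"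
        using x' by (subst sum_upd) auto
      then show "(\<Sum>y \<in> fv (App s (Var x)). tsz ((\<tau>(x := A)) y)) + tsz B
          < (\<Sum>x \<in> fv s. tsz (\<tau> x)) + tsz C"
        unfolding arrow by (simp del: fun_upd_apply)
    qed (use less.prems in auto)
    then obtain s' where s': "red (\<tau>(x := A)) (App s (Var x)) s' B" "cf (insert x X) (\<tau>(x := A)) s' B"
      by blast
    have "red \<tau> s (Fn x (App s (Var x))) C"
      using less.prems(1) x' unfolding arrow by (intro red_eta_Fn)
    also have "red \<tau> (Fn x (App s (Var x))) (Fn x s') C"
      unfolding arrow using s'(1) by (intro red_Fn) auto
    finally show ?thesis
      using s'(2) x red_fv[OF s'(1)] unfolding arrow by (intro exI[of _ "Fn x s'"]) (auto intro: cf_fn)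
  next
    case tensor
    obtain u where u: "u \<notin> X"
      using ex_fresh less.prems(2) by blast
    obtain v where v: "v \<notin> insert u X"
      using ex_fresh[of "insert u X"] less.prems(2) by blast
    have uv: "u \<notin> fv s" "v \<notin> fv s" "u \<noteq> v" "z \<noteq> u" "z \<noteq> v" "z \<in> X"
      using u v less.prems(3) tensor(1) by auto
    let ?q = "App (Fn z s) (Tup (Var u) (Var v))" and ?\<tau> = "\<tau>(u := A, v := B)"
    have 1: "red \<tau> s (LetTup u v (Var z) ?q) C"
      using less.prems(1) tensor uv by (intro red_eta_Let) auto
    from red_wt[OF 1] tensor have w: "wt ?\<tau> ?q C"
      by (auto simp: wt_simps(1,5))
    have fvq: "fv ?q = {u, v} \<union> (fv s - {z})"
      by auto
    have "\<exists>s'. red ?\<tau> ?q s' C \<and> cf ({u, v} \<union> X) ?\<tau> s' C"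
    proof (rule less.hyps[OF _ w])
      have "{u, v} \<union> (fv s - {z}) - {u, v} = fv s - {z}"
        using uv by auto
      then have "(\<Sum>y \<in> fv ?q. tsz (?\<tau> y)) = tsz A + tsz B + (\<Sum>y \<in> fv s - {z}. tsz (\<tau> y))"
        using sum_upd2[of "fv ?q" u v tsz \<tau> A B] uv fvq by simp
      moreover have "(\<Sum>y \<in> fv s. tsz (\<tau> y)) = tsz (A \<otimes> B) + (\<Sum>y \<in> fv s - {z}. tsz (\<tau> y))"
        using sum.remove[of "fv s" z "\<lambda>y. tsz (\<tau> y)"] tensor by simp
      ultimately show "(\<Sum>y \<in> fv ?q. tsz (?\<tau> y)) + tsz C < (\<Sum>y \<in> fv s. tsz (\<tau> y)) + tsz C"
        by (simp del: fun_upd_apply fv.simps)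
    qed (use less.prems in auto)
    then obtain s' where s': "red ?\<tau> ?q s' C" "cf ({u, v} \<union> X) ?\<tau> s' C"
      by blast
    note 1
    also have "red \<tau> (LetTup u v (Var z) ?q) (LetTup u v (Var z) s') C"
      using uv tensor by (intro red_Let[OF red_refl s'(1)]) (auto simp: wt_simps)
    finally have "red \<tau> s (LetTup u v (Var z) s') C" .
    moreover have "fv s' = {u, v} \<union> (fv s - {z})"
      using red_fv[OF s'(1)] fvq by simp
    then have "cf X \<tau> (LetTup u v (Var z) s') C"
      using u v uv by (intro cf_let[OF _ _ _ _ _ _ _ tensor(2) s'(2)]) simp_all
    ultimately show ?thesis by blast
  next
    case focus
    from red_head_form[OF less.prems(1) focus(2) less.prems(2,3)]
    obtain s' where s': "red \<tau> s s' C" "head_form X s' (sz s)" by blast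
    note w' = red_wt[OF s'(1)] and fv' = red_fv[OF s'(1)]
    from s'(2) consider (var) x where "s' = Var x" | (fn_) x r where "s' = Fn x r"
      | (tup) p q where "s' = Tup p q"
      | (app) x r h t where "s' = App (Fn x r) (App (Var h) t)" "x \<notin> X"
      unfolding head_form_def by blast
    then show ?thesis
    proof cases
      case var
      have "\<exists>a. C = TVar a"
        using w' fv' focus(1) focus(2)[of x] var by (cases C) (auto simp: wt_simps)
      then show ?thesis
        using w' var s'(1) cf_var by (auto simp: wt_simps)
    next
      case fn_
      then show ?thesis
        using w' focus(1) by (auto simp: wt_simps)
    next
      case tup
      then obtain A B where C: "C = A \<otimes> B" "wt \<tau> p A" "wt \<tau> q B" "fv p \<inter> fv q = {}"
        using w' by (auto simp: wt_simps)
      have fv: "fv s = fv p \<union> fv q"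
        using fv' tup by auto
      have sum: "(\<Sum>x \<in> fv s. tsz (\<tau> x)) = (\<Sum>x \<in> fv p. tsz (\<tau> x)) + (\<Sum>x \<in> fv q. tsz (\<tau> x))"
        unfolding fv using C by (intro sum.union_disjoint) auto
      have "\<exists>s'. red \<tau> p s' A \<and> cf X \<tau> s' A"
        by (rule less.hyps[OF _ C(2)]) (use sum C less.prems fv in auto)
      then obtain p' where p': "red \<tau> p p' A" "cf X \<tau> p' A" by blast
      have "\<exists>s'. red \<tau> q s' B \<and> cf X \<tau> s' B"
        by (rule less.hyps[OF _ C(3)]) (use sum C less.prems fv in auto)
      then obtain q' where q': "red \<tau> q q' B" "cf X \<tau> q' B" by blast
      have "red \<tau> s' (Tup p' q') C"
        unfolding tup C using p' q' C by (intro red_Tup)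
      moreover have "cf X \<tau> (Tup p' q') C"
        unfolding C using p' q' red_fv C by (intro cf_tup) auto
      ultimately show ?thesis
        using s'(1) red_trans by blast
    next
      case app
      from w' obtain A B where AB: "\<tau> h = A \<rightarrow> B" "wt \<tau> t A" "wt (\<tau>(x := B)) r C" "x \<in> fv r"
        "h \<notin> fv t" "h \<notin> fv r - {x}" "fv t \<inter> (fv r - {x}) = {}"
        unfolding app by (auto simp: wt_simps)
      have fv: "fv s = insert h (fv t \<union> (fv r - {x}))"
        using fv' app by auto
      have x: "x \<notin> fv t" "x \<noteq> h" "h \<in> X"
        using app(2) fv less.prems(3) by auto
      have sum: "(\<Sum>y \<in> fv s. tsz (\<tau> y)) = tsz (A \<rightarrow> B) + (\<Sum>y \<in> fv t. tsz (\<tau> y)) + (\<Sum>y \<in> fv r - {x}. tsz (\<tau> y))"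
        unfolding fv using AB by (simp add: sum.union_disjoint)
      have "\<exists>s'. red \<tau> t s' A \<and> cf X \<tau> s' A"
        by (rule less.hyps[OF _ AB(2)]) (use sum AB less.prems fv in auto)
      then obtain t' where t': "red \<tau> t t' A" "cf X \<tau> t' A" by blast
      have "\<exists>s'. red (\<tau>(x := B)) r s' C \<and> cf (insert x X) (\<tau>(x := B)) s' C"
      proof (rule less.hyps[OF _ AB(3)])
        show "(\<Sum>y \<in> fv r. tsz ((\<tau>(x := B)) y)) + tsz C < (\<Sum>y \<in> fv s. tsz (\<tau> y)) + tsz C"
          using sum sum_upd[of "fv r" x tsz \<tau> B] AB(4) by (simp del: fun_upd_apply)
      qed (use less.prems fv in auto)
      then obtain r' where r': "red (\<tau>(x := B)) r r' C" "cf (insert x X) (\<tau>(x := B)) r' C" by blast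
      have "red \<tau> (App (Var h) t) (App (Var h) t') B"
        using AB by (intro red_App[OF red_refl t'(1)]) (auto simp: wt_simps)
      then have "red \<tau> s' (App (Fn x r') (App (Var h) t')) C"
        unfolding app using AB by (intro red_App[OF red_Fn[OF r'(1)]]) auto
      moreover have "cf X \<tau> (App (Fn x r') (App (Var h) t')) C"
        using t' r' AB red_fv[OF t'(1)] red_fv[OF r'(1)] app(2) x by (intro cf_app) auto
      ultimately show ?thesis
        using s'(1) red_trans by blast
    qed
  qed
qed

subsection \<open>Coherence\<close>

fun tv :: "ty \<Rightarrow> name set" where
  "tv (TVar a) = {a}"
| "tv (A \<otimes> B) = tv A \<union> tv B"
| "tv (A \<rightarrow> B) = tv A \<union> tv B"

lemma tv_nonempty [simp]: "tv A \<noteq> {}"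
  by (induction A) auto

lemma tv_sub_compl: "tv A \<subseteq> S \<Longrightarrow> \<not> tv A \<subseteq> - S"
  using tv_nonempty[of A] by blast

section \<open>Two-colourings of the type variables and connectedness of linear proofs\<close>

definition coloured :: "name set \<Rightarrow> (name \<Rightarrow> ty) \<Rightarrow> name set \<Rightarrow> bool" where
  "coloured S \<tau> V \<longleftrightarrow> (\<forall>x \<in> V. tv (\<tau> x) \<subseteq> S \<or> tv (\<tau> x) \<subseteq> - S)"

lemma colouredD: "coloured S \<tau> V \<Longrightarrow> z \<in> V \<Longrightarrow> \<tau> z = A \<Longrightarrow> tv A \<subseteq> S \<or> tv A \<subseteq> - S"
  by (auto simp: coloured_def)

lemma coloured_compl: "coloured (- S) \<tau> V \<longleftrightarrow> coloured S \<tau> V"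
  by (auto simp: coloured_def)

lemma coloured_mono: "coloured S \<tau> V \<Longrightarrow> W \<subseteq> V \<Longrightarrow> coloured S \<tau> W"
  by (auto simp: coloured_def)

lemma coloured_upd:
  "coloured S \<tau> (V - {x}) \<Longrightarrow> tv A \<subseteq> S \<or> tv A \<subseteq> - S \<Longrightarrow> coloured S (\<tau>(x := A)) V"
  by (auto simp: coloured_def)

lemma coloured_upd2:
  "coloured S \<tau> (V - {x, y}) \<Longrightarrow> tv A \<subseteq> S \<or> tv A \<subseteq> - S \<Longrightarrow> tv B \<subseteq> S \<or> tv B \<subseteq> - S
    \<Longrightarrow> coloured S (\<tau>(x := A, y := B)) V"
  by (auto simp: coloured_def)

text \<open>A linear proof discards nothing, so every assumption is connected with the goal through
  axioms, and these preserve the colour. At a left rule the premise with the goal fixes the colour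
  of \<open>B\<close>; the colouring carries it over to the whole principal formula, and hence to
  \<open>A\<close>.\<close>

lemma cf_connected:
  "cf X \<tau> s C \<Longrightarrow> tv C \<subseteq> S \<Longrightarrow> coloured S \<tau> (fv s) \<Longrightarrow> x \<in> fv s \<Longrightarrow> tv (\<tau> x) \<subseteq> S"
proof (induction arbitrary: x rule: cf.induct)
  case (cf_var \<tau> y a X)
  then show ?case by simp
next
  case (cf_fn y X s \<tau> A B)
  have AB: "tv A \<subseteq> S" "tv B \<subseteq> S"
    using cf_fn.prems by auto
  have "coloured S (\<tau>(y := A)) (fv s)"
    by (rule coloured_upd) (use cf_fn.prems AB in auto)
  then have "tv ((\<tau>(y := A)) x) \<subseteq> S"
    by (rule cf_fn.IH[OF AB(2)]) (use cf_fn.prems in simp)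
  then show ?case using cf_fn.prems by (simp split: if_splits)
next
  case (cf_tup X \<tau> p A q B)
  have "coloured S \<tau> (fv p)" "coloured S \<tau> (fv q)" "tv A \<subseteq> S" "tv B \<subseteq> S"
    using cf_tup.prems by (auto simp: coloured_def)
  then show ?case
    using cf_tup.IH[of x] cf_tup.prems by auto
next
  case (cf_let u v X z s \<tau> A B C)
  have z: "tv (A \<otimes> B) \<subseteq> S \<or> tv (A \<otimes> B) \<subseteq> - S"
    using cf_let.prems(2) cf_let.hyps(8) by (auto simp: coloured_def)
  then have AB: "tv A \<subseteq> S \<or> tv A \<subseteq> - S" "tv B \<subseteq> S \<or> tv B \<subseteq> - S"
    by auto
  have col: "coloured S (\<tau>(u := A, v := B)) (fv s)"
    by (rule coloured_upd2[OF coloured_mono[OF cf_let.prems(2)] AB]) auto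
  have IH: "tv ((\<tau>(u := A, v := B)) y) \<subseteq> S" if "y \<in> fv s" for y
    by (rule cf_let.IH[OF cf_let.prems(1) col that])
  have "tv B \<subseteq> S"
    using IH[of v] cf_let.hyps by simp
  then have "tv (\<tau> z) \<subseteq> S"
    using z tv_sub_compl[of B] cf_let.hyps(8) by auto
  then show ?case
    using IH[of x] cf_let.prems(3) by (auto split: if_splits)
next
  case (cf_app y X h r t \<tau> A B C)
  have h: "tv (A \<rightarrow> B) \<subseteq> S \<or> tv (A \<rightarrow> B) \<subseteq> - S"
    using cf_app.prems(2) cf_app.hyps(8) by (auto simp: coloured_def)
  then have B: "tv B \<subseteq> S \<or> tv B \<subseteq> - S"
    by auto
  have col: "coloured S (\<tau>(y := B)) (fv r)"
    by (rule coloured_upd[OF coloured_mono[OF cf_app.prems(2)] B]) auto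
  have IH: "tv ((\<tau>(y := B)) x) \<subseteq> S" if "x \<in> fv r" for x
    by (rule cf_app.IH(2)[OF cf_app.prems(1) col that])
  have "tv B \<subseteq> S"
    using IH[of y] cf_app.hyps by simp
  then have h': "tv (\<tau> h) \<subseteq> S" "tv A \<subseteq> S"
    using h tv_sub_compl[of B] cf_app.hyps(8) by auto
  have t: "tv (\<tau> x) \<subseteq> S" if "x \<in> fv t" for x
    using cf_app.IH(1)[OF h'(2) coloured_mono[OF cf_app.prems(2)] that] by auto
  from cf_app.prems(3) consider "x = h" | "x \<in> fv t" | "x \<in> fv r" "x \<noteq> y"
    by auto
  then show ?case
    by cases (use h' t IH[of x] in simp_all)
qed



definition on_side :: "name set \<Rightarrow> (name \<Rightarrow> ty) \<Rightarrow> name set \<Rightarrow> name set" where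
  "on_side S \<tau> V = {y \<in> V. tv (\<tau> y) \<subseteq> S}"

lemma on_side_all: "(\<And>y. y \<in> V \<Longrightarrow> tv (\<tau> y) \<subseteq> S) \<Longrightarrow> on_side S \<tau> V = V"
  by (auto simp: on_side_def)

lemma on_side_none: "(\<And>y. y \<in> V \<Longrightarrow> tv (\<tau> y) \<subseteq> - S) \<Longrightarrow> on_side S \<tau> V = {}"
  unfolding on_side_def using tv_sub_compl by blast

lemma on_side_Un: "on_side S \<tau> (V \<union> W) = on_side S \<tau> V \<union> on_side S \<tau> W"
  by (auto simp: on_side_def)

lemma on_side_upd: "on_side S (\<tau>(x := A)) V
    = on_side S \<tau> (V - {x}) \<union> (if x \<in> V \<and> tv A \<subseteq> S then {x} else {})"
  by (auto simp: on_side_def)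

lemma on_side_sub: "on_side S \<tau> V \<subseteq> V"
  by (auto simp: on_side_def)

text \<open>Permutation of rules: \<open>cf_connected\<close> puts one premise of every rule on a single side of the
  colouring, so the left rule for \<open>h\<close> can be moved to the root of the proof.\<close>

lemma cf_permute_app:
  assumes "cf X \<tau> s C" "fv s \<subseteq> X" "h \<in> fv s" "\<tau> h = A \<rightarrow> B" "tv A \<subseteq> S" "tv B \<subseteq> - S"
    "tv C \<subseteq> - S" "coloured S \<tau> (fv s - {h})"
  shows "\<exists>x r t. x \<notin> X \<and> eqt \<tau> s (App (Fn x r) (App (Var h) t)) C
    \<and> fv t = on_side S \<tau> (fv s - {h})"
  using assms
proof (induction rule: cf.induct)
  case (cf_var \<tau> x a X)
  then show ?case by auto
next
  case (cf_fn y X s \<tau> A1 B1)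
  note hy = cf_fn.hyps cf_fn.prems
  have ne: "h \<noteq> y" and h: "h \<in> fv s" and X: "fv s \<subseteq> insert y X"
    using hy by auto
  have sub: "tv A1 \<subseteq> - S" "tv B1 \<subseteq> - S" using hy by auto
  have col: "coloured S (\<tau>(y := A1)) (fv s - {h})"
    by (rule coloured_upd) (use hy sub in \<open>auto simp: coloured_def\<close>)
  have "\<exists>x r t. x \<notin> insert y X \<and> eqt (\<tau>(y := A1)) s (App (Fn x r) (App (Var h) t)) B1
      \<and> fv t = on_side S (\<tau>(y := A1)) (fv s - {h})"
    by (rule cf_fn.IH[OF X h _ hy(7,8) sub(2) col]) (use ne hy in simp)
  then obtain x r t where IH: "x \<notin> insert y X"
    "eqt (\<tau>(y := A1)) s (App (Fn x r) (App (Var h) t)) B1"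
    "fv t = on_side S (\<tau>(y := A1)) (fv s - {h})" by blast
  have "fv s - {h} - {y} = fv (Fn y s) - {h}" by auto
  then have fvt: "fv t = on_side S \<tau> (fv (Fn y s) - {h})"
    using IH(3) tv_sub_compl[of A1 "- S"] sub by (simp add: on_side_upd)
  then have yt: "y \<notin> fv t"
    using on_side_sub by fastforce
  have "eqt \<tau> (Fn y s) (Fn y (App (Fn x r) (App (Var h) t))) (A1 \<rightarrow> B1)"
    using IH hy by (intro eqt_Fn)
  also have "eqt \<tau> (Fn y (App (Fn x r) (App (Var h) t))) (App (Fn x (Fn y r)) (App (Var h) t)) (A1 \<rightarrow> B1)"
    using IH yt ne eqt_typed(2)[OF calculation] by (intro float_Fn) auto
  finally show ?case
    using IH(1) fvt by blast
next
  case (cf_tup X \<tau> p A1 q B1)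
  note hy = cf_tup.hyps cf_tup.prems
  have sub: "tv A1 \<subseteq> - S" "tv B1 \<subseteq> - S" "fv p \<subseteq> X" "fv q \<subseteq> X" using hy by auto
  have w: "wt \<tau> p A1" "wt \<tau> q B1" using hy cf_wt by auto
  show ?case
  proof (cases "h \<in> fv p")
    case True
    then have hq: "h \<notin> fv q" using hy by auto
    have "tv (\<tau> y) \<subseteq> - S" if "y \<in> fv q" for y
      using cf_connected[OF hy(2) sub(2) _ that] hy(10) hq
      by (auto simp: coloured_compl coloured_def)
    then have q: "on_side S \<tau> (fv q) = {}" by (rule on_side_none)
    have "coloured S \<tau> (fv p - {h})"
      using hy(10) by (rule coloured_mono) auto
    from cf_tup.IH(1)[OF sub(3) True hy(6-8) sub(1) this] obtain x r t where IH: "x \<notin> X"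
      "eqt \<tau> p (App (Fn x r) (App (Var h) t)) A1" "fv t = on_side S \<tau> (fv p - {h})" by blast
    have fvt: "fv t = on_side S \<tau> (fv (Tup p q) - {h})"
    proof -
      have "fv (Tup p q) - {h} = (fv p - {h}) \<union> fv q" using hq by auto
      then show ?thesis using IH(3) q by (simp add: on_side_Un)
    qed
    have "eqt \<tau> (Tup p q) (Tup (App (Fn x r) (App (Var h) t)) q) (A1 \<otimes> B1)"
      by (rule eqt_Tup[OF IH(2) eqt_refl[OF w(2)] hy(3)])
    also have "eqt \<tau> (Tup (App (Fn x r) (App (Var h) t)) q) (App (Fn x (Tup r q)) (App (Var h) t)) (A1 \<otimes> B1)"
      by (rule float_TupL[OF eqt_typed(2)[OF calculation]]) (use IH(1) sub in auto)
    finally show ?thesis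
      using IH(1) fvt by blast
  next
    case False
    then have True: "h \<in> fv q" using hy by auto
    have "tv (\<tau> y) \<subseteq> - S" if "y \<in> fv p" for y
      using cf_connected[OF hy(1) sub(1) _ that] hy(10) False
      by (auto simp: coloured_compl coloured_def)
    then have p: "on_side S \<tau> (fv p) = {}" by (rule on_side_none)
    have "coloured S \<tau> (fv q - {h})"
      using hy(10) by (rule coloured_mono) auto
    from cf_tup.IH(2)[OF sub(4) True hy(6-8) sub(2) this] obtain x r t where IH: "x \<notin> X"
      "eqt \<tau> q (App (Fn x r) (App (Var h) t)) B1" "fv t = on_side S \<tau> (fv q - {h})" by blast
    have fvt: "fv t = on_side S \<tau> (fv (Tup p q) - {h})"
    proof -
      have "fv (Tup p q) - {h} = fv p \<union> (fv q - {h})" using False by auto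
      then show ?thesis using IH(3) p by (simp add: on_side_Un)
    qed
    have "eqt \<tau> (Tup p q) (Tup p (App (Fn x r) (App (Var h) t))) (A1 \<otimes> B1)"
      by (rule eqt_Tup[OF eqt_refl[OF w(1)] IH(2) hy(3)])
    also have "eqt \<tau> (Tup p (App (Fn x r) (App (Var h) t))) (App (Fn x (Tup p r)) (App (Var h) t)) (A1 \<otimes> B1)"
      by (rule float_TupR[OF eqt_typed(2)[OF calculation]]) (use IH(1) sub in auto)
    finally show ?thesis
      using IH(1) fvt by blast
  qed
next
  case (cf_let u v X z s \<tau> A1 B1 D)
  note hy = cf_let.hyps cf_let.prems
  have ne: "h \<noteq> z" "h \<noteq> u" "h \<noteq> v" using hy by auto
  have h: "h \<in> fv s" using hy ne by auto
  have Xs: "fv s \<subseteq> {u, v} \<union> X" using hy by auto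
  have z: "tv (A1 \<otimes> B1) \<subseteq> S \<or> tv (A1 \<otimes> B1) \<subseteq> - S"
    by (rule colouredD[OF hy(16) _ hy(8)]) (use ne in auto)
  then have AB: "tv A1 \<subseteq> S \<or> tv A1 \<subseteq> - S" "tv B1 \<subseteq> S \<or> tv B1 \<subseteq> - S" by auto
  have col: "coloured S (\<tau>(u := A1, v := B1)) (fv s - {h})"
    by (rule coloured_upd2[OF coloured_mono[OF hy(16)] AB]) auto
  have "\<exists>x r t. x \<notin> {u, v} \<union> X \<and> eqt (\<tau>(u := A1, v := B1)) s (App (Fn x r) (App (Var h) t)) D
      \<and> fv t = on_side S (\<tau>(u := A1, v := B1)) (fv s - {h})"
    by (rule cf_let.IH[OF Xs h _ hy(13-15) col]) (use ne hy in simp)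
  then obtain x r t where IH: "x \<notin> {u, v} \<union> X"
    "eqt (\<tau>(u := A1, v := B1)) s (App (Fn x r) (App (Var h) t)) D"
    "fv t = on_side S (\<tau>(u := A1, v := B1)) (fv s - {h})" by blast
  have Vs: "fv (LetTup u v (Var z) s) - {h} = insert z (fv s - {h} - {v} - {u})"
    using ne by auto
  have e1: "eqt \<tau> (LetTup u v (Var z) s) (LetTup u v (Var z) (App (Fn x r) (App (Var h) t))) D"
    by (rule eqt_Let[OF eqt_refl IH(2)]) (use hy in \<open>auto simp: wt_simps\<close>)
  note w1 = eqt_typed(2)[OF e1]
  from z show ?case
  proof
    \<comment> \<open>\<open>u\<close> and \<open>v\<close> are then both used in \<open>t\<close>,
      so the \<open>let\<close> commutes into the argument of \<open>h\<close>.\<close>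
    assume zS: "tv (A1 \<otimes> B1) \<subseteq> S"
    then have fvt: "fv t = {u, v} \<union> on_side S \<tau> (fv s - {h} - {v} - {u})"
      using IH(3) ne hy(1,5,6) by (auto simp: on_side_upd)
    have uv: "{u, v} \<inter> fv (Fn x r) = {}" "{u, v} \<inter> fv (Var h) = {}"
      using w1 fvt ne by (auto simp: wt_def)
    have e2: "eqt \<tau> (App (Fn x r) (LetTup u v (Var z) (App (Var h) t))) (LetTup u v (Var z) (App (Fn x r) (App (Var h) t))) D"
      by (rule commute_AppR[OF w1 uv(1)])
    note w2 = eqt_typed(1)[OF e2]
    then obtain E where E: "wt \<tau> (Fn x r) (E \<rightarrow> D)" "wt \<tau> (LetTup u v (Var z) (App (Var h) t)) E"
      "fv (Fn x r) \<inter> fv (LetTup u v (Var z) (App (Var h) t)) = {}"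
      unfolding wt_simps(2)[of \<tau> "Fn x r"] by blast
    have e3: "eqt \<tau> (App (Var h) (LetTup u v (Var z) t)) (LetTup u v (Var z) (App (Var h) t)) E"
      by (rule commute_AppR[OF E(2) uv(2)])
    have "eqt \<tau> (App (Fn x r) (LetTup u v (Var z) (App (Var h) t))) (App (Fn x r) (App (Var h) (LetTup u v (Var z) t))) D"
      by (rule eqt_App[OF eqt_refl[OF E(1)] eqt_sym[OF e3] E(3)])
    with e1 e2 have "eqt \<tau> (LetTup u v (Var z) s) (App (Fn x r) (App (Var h) (LetTup u v (Var z) t))) D"
      by (meson eqt_sym eqt_trans)
    moreover have "fv (LetTup u v (Var z) t) = on_side S \<tau> (fv (LetTup u v (Var z) s) - {h})"
      unfolding Vs using fvt zS hy(8) by (auto simp: on_side_def)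
    ultimately show ?thesis
      using IH(1) by blast
  next
    \<comment> \<open>Now neither \<open>u\<close> nor \<open>v\<close> occurs in \<open>t\<close>,
      and the \<open>let\<close> joins the continuation.\<close>
    assume zS: "tv (A1 \<otimes> B1) \<subseteq> - S"
    then have nS: "\<not> tv A1 \<subseteq> S" "\<not> tv B1 \<subseteq> S" "\<not> tv (\<tau> z) \<subseteq> S"
      using tv_sub_compl[of A1 S] tv_sub_compl[of B1 S] tv_sub_compl[of "\<tau> z" S] hy(8) by auto
    then have fvt: "fv t = on_side S \<tau> (fv s - {h} - {v} - {u})"
      using IH(3) by (simp add: on_side_upd)
    then have uv: "u \<notin> fv t" "v \<notin> fv t"
      using on_side_sub[of S \<tau> "fv s - {h} - {v} - {u}"] by auto
    have "eqt \<tau> (LetTup u v (Var z) (App (Fn x r) (App (Var h) t))) (App (Fn x (LetTup u v (Var z) r)) (App (Var h) t)) D"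
      by (rule float_LetR[OF w1]) (use IH(1) hy ne uv in auto)
    with e1 have "eqt \<tau> (LetTup u v (Var z) s) (App (Fn x (LetTup u v (Var z) r)) (App (Var h) t)) D"
      by (rule eqt_trans)
    moreover have "fv t = on_side S \<tau> (fv (LetTup u v (Var z) s) - {h})"
      unfolding Vs using fvt nS by (auto simp: on_side_def)
    ultimately show ?thesis
      using IH(1) by blast
  qed
next
  case (cf_app y X k r1 t1 \<tau> A1 B1 D)
  note hy = cf_app.hyps cf_app.prems
  let ?s = "App (Fn y r1) (App (Var k) t1)"
  have w: "wt \<tau> t1 A1" "wt (\<tau>(y := B1)) r1 D" using hy(9,10) cf_wt by auto
  have wk: "wt \<tau> (App (Var k) t1) B1" using w hy by (auto simp: wt_simps)
  have wf: "wt \<tau> (Fn y r1) (B1 \<rightarrow> D)" using w hy by (auto simp: wt_simps)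
  have dj: "fv (Fn y r1) \<inter> fv (App (Var k) t1) = {}" using hy by auto
  have Xs: "fv t1 \<subseteq> X" "fv r1 \<subseteq> insert y X" using hy by auto
  have neh: "h \<noteq> y" using hy by auto
  have con: "tv (\<tau> x) \<subseteq> - S" if "tv B1 \<subseteq> - S" "h \<notin> fv r1 \<or> h = k" "x \<in> fv r1 - {y}" for x
  proof -
    have "coloured (- S) (\<tau>(y := B1)) (fv r1)"
      by (rule coloured_upd[OF coloured_mono[of _ _ "fv ?s - {h}"]])
        (use that hy in \<open>auto simp: coloured_compl\<close>)
    from cf_connected[OF hy(10) hy(16) this, of x] that(3) show ?thesis by auto
  qed
  show ?case
  proof (cases "k = h")
    case True
    then have AB: "A1 = A" "B1 = B" using hy by auto
    have "coloured S \<tau> (fv t1)"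
      using hy(17) by (rule coloured_mono) (use True hy in auto)
    then have "tv (\<tau> x) \<subseteq> S" if "x \<in> fv t1" for x
      using cf_connected[OF hy(9) _ _ that] hy(14) AB by blast
    then have 1: "on_side S \<tau> (fv t1) = fv t1" by (rule on_side_all)
    have 2: "on_side S \<tau> (fv r1 - {y}) = {}"
      by (rule on_side_none) (use con hy(15) AB True in blast)
    have "fv ?s - {h} = fv t1 \<union> (fv r1 - {y})"
      using True hy by auto
    then have "fv t1 = on_side S \<tau> (fv ?s - {h})"
      using 1 2 by (simp add: on_side_Un)
    moreover have "eqt \<tau> ?s (App (Fn y r1) (App (Var h) t1)) D"
      using True eqt_refl[OF cf_wt[OF cf.cf_app[OF hy(1-10)]]] by simp
    ultimately show ?thesis
      using hy(1) by blast
  next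
    case False
    have k: "tv (A1 \<rightarrow> B1) \<subseteq> S \<or> tv (A1 \<rightarrow> B1) \<subseteq> - S"
      by (rule colouredD[OF hy(17) _ hy(8)]) (use False in auto)
    then have B1: "tv B1 \<subseteq> S \<or> tv B1 \<subseteq> - S" by auto
    have colt: "coloured S \<tau> (fv t1 - {h})"
      using hy(17) by (rule coloured_mono) auto
    have colr: "coloured S (\<tau>(y := B1)) (fv r1 - {h})"
      by (rule coloured_upd[OF coloured_mono[OF hy(17)] B1]) auto
    consider (t) "h \<in> fv t1" "h \<notin> fv r1" | (r) "h \<in> fv r1" "h \<notin> fv t1"
      using hy False by auto
    then show ?thesis
    proof cases
      case t
      \<comment> \<open>Otherwise \<open>r1\<close> would connect \<open>y\<close>, on the side
        \<open>S\<close>, with the goal on the other side, although \<open>h\<close> does not occur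
        in it and all its assumptions are coloured.\<close>
      have kS: "tv (A1 \<rightarrow> B1) \<subseteq> - S"
      proof (rule ccontr)
        assume "\<not> tv (A1 \<rightarrow> B1) \<subseteq> - S"
        then have B: "tv B1 \<subseteq> S" using k by auto
        have "coloured (- S) (\<tau>(y := B1)) (fv r1)"
          using colr t(2) by (simp add: coloured_compl)
        from cf_connected[OF hy(10,16) this hy(3)] B show False
          using tv_sub_compl by simp
      qed
      then have nk: "\<not> tv (\<tau> k) \<subseteq> S" "tv A1 \<subseteq> - S" "tv B1 \<subseteq> - S"
        using tv_sub_compl[of "A1 \<rightarrow> B1" S] hy(8) by auto
      from cf_app.IH(1)[OF Xs(1) t(1) hy(13-15) nk(2) colt] obtain x r t where IH: "x \<notin> X"
        "eqt \<tau> t1 (App (Fn x r) (App (Var h) t)) A1" "fv t = on_side S \<tau> (fv t1 - {h})" by blast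
      have 2: "on_side S \<tau> (fv r1 - {y}) = {}"
        by (rule on_side_none) (use con nk t in blast)
      have "fv ?s - {h} = insert k (fv t1 - {h} \<union> (fv r1 - {y}))"
        using t False by auto
      then have fvt: "fv t = on_side S \<tau> (fv ?s - {h})"
        using IH(3) 2 nk(1) by (auto simp: on_side_def)
      have e1: "eqt \<tau> (App (Var k) t1) (App (Var k) (App (Fn x r) (App (Var h) t))) B1"
        by (rule eqt_App[OF eqt_refl IH(2)]) (use hy in \<open>auto simp: wt_simps\<close>)
      have e2: "eqt \<tau> (App (Var k) (App (Fn x r) (App (Var h) t))) (App (Fn x (App (Var k) r)) (App (Var h) t)) B1"
        by (rule float_AppR[OF eqt_typed(2)[OF e1]]) (use IH(1) hy(2) in auto)
      have e3: "eqt \<tau> ?s (App (Fn y r1) (App (Fn x (App (Var k) r)) (App (Var h) t))) D"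
        by (rule eqt_App[OF eqt_refl[OF wf] eqt_trans[OF e1 e2] dj])
      have e4: "eqt \<tau> (App (Fn y r1) (App (Fn x (App (Var k) r)) (App (Var h) t))) (App (Fn x (App (Fn y r1) (App (Var k) r))) (App (Var h) t)) D"
        by (rule float_AppR[OF eqt_typed(2)[OF e3]]) (use IH(1) hy in auto)
      show ?thesis
        using eqt_trans[OF e3 e4] IH(1) fvt by blast
    next
      case r
      have "\<exists>x r t. x \<notin> insert y X \<and> eqt (\<tau>(y := B1)) r1 (App (Fn x r) (App (Var h) t)) D
          \<and> fv t = on_side S (\<tau>(y := B1)) (fv r1 - {h})"
        by (rule cf_app.IH(2)[OF Xs(2) r(1) _ hy(14-16) colr]) (use neh hy in simp)
      then obtain x r t where IH: "x \<notin> insert y X"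
        "eqt (\<tau>(y := B1)) r1 (App (Fn x r) (App (Var h) t)) D"
        "fv t = on_side S (\<tau>(y := B1)) (fv r1 - {h})" by blast
      have e1: "eqt \<tau> (Fn y r1) (Fn y (App (Fn x r) (App (Var h) t))) (B1 \<rightarrow> D)"
        by (rule eqt_Fn[OF IH(2) hy(3)])
      have e2: "eqt \<tau> ?s (App (Fn y (App (Fn x r) (App (Var h) t))) (App (Var k) t1)) D"
        by (rule eqt_App[OF e1 eqt_refl[OF wk] dj])
      have Vs: "fv ?s - {h} = insert k (fv t1 \<union> (fv r1 - {h} - {y}))"
        using r False by auto
      have colt': "coloured S \<tau> (fv t1)" using colt r by simp
      from k show ?thesis
      proof
        assume kS: "tv (A1 \<rightarrow> B1) \<subseteq> - S"
        then have nk: "\<not> tv (\<tau> k) \<subseteq> S" "tv A1 \<subseteq> - S" "\<not> tv B1 \<subseteq> S"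
          using tv_sub_compl[of "A1 \<rightarrow> B1" S] tv_sub_compl[of B1 S] hy(8) by auto
        have "on_side S \<tau> (fv t1) = {}"
          by (rule on_side_none)
            (use cf_connected[OF hy(9) nk(2)] colt' in \<open>simp add: coloured_compl\<close>)
        then have fvt: "fv t = on_side S \<tau> (fv ?s - {h})"
          unfolding Vs using IH(3) nk by (auto simp: on_side_def)
        then have yt: "y \<notin> fv t"
          unfolding Vs using hy by (auto simp: on_side_def)
        have e3: "eqt \<tau> (Fn y (App (Fn x r) (App (Var h) t))) (App (Fn x (Fn y r)) (App (Var h) t)) (B1 \<rightarrow> D)"
          by (rule float_Fn[OF eqt_typed(2)[OF e1]]) (use IH(1) yt neh in auto)
        have dj': "fv (Fn y (App (Fn x r) (App (Var h) t))) \<inter> fv (App (Var k) t1) = {}"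
          using eqt_typed(3)[OF e1] dj by simp
        have e4: "eqt \<tau> ?s (App (App (Fn x (Fn y r)) (App (Var h) t)) (App (Var k) t1)) D"
          by (rule eqt_trans[OF e2 eqt_App[OF e3 eqt_refl[OF wk] dj']])
        have e5: "eqt \<tau> (App (App (Fn x (Fn y r)) (App (Var h) t)) (App (Var k) t1))
            (App (Fn x (App (Fn y r) (App (Var k) t1))) (App (Var h) t)) D"
          by (rule float_AppL[OF eqt_typed(2)[OF e4]]) (use IH(1) hy(2) Xs in auto)
        show ?thesis
          using eqt_trans[OF e4 e5] IH(1) fvt by blast
      next
        \<comment> \<open>\<open>y\<close> is used in \<open>t\<close>: the redex that names
          \<open>k t1\<close> moves into the argument of \<open>h\<close>.\<close>
        assume kS: "tv (A1 \<rightarrow> B1) \<subseteq> S"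
        then have nk: "tv (\<tau> k) \<subseteq> S" "tv A1 \<subseteq> S" "tv B1 \<subseteq> S"
          using hy(8) by auto
        have t1: "on_side S \<tau> (fv t1) = fv t1"
          by (rule on_side_all)
            (use cf_connected[OF hy(9) nk(2)] colt' in simp)
        have fvt: "fv t = insert y (on_side S \<tau> (fv r1 - {h} - {y}))"
          using IH(3) nk(3) hy(3) neh by (auto simp: on_side_upd)
        let ?W = "App (Var k) t1"
        have wz: "wt (\<tau>(y := B1)) (App (Fn x r) (App (Var h) t)) D"
          by (rule eqt_typed(2)[OF IH(2)])
        then have yr: "y \<notin> fv (Fn x r)"
          using fvt by (auto simp: wt_def)
        from wz obtain E where E: "wt (\<tau>(y := B1)) (Fn x r) (E \<rightarrow> D)" "wt (\<tau>(y := B1)) (App (Var h) t) E"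
          "fv (Fn x r) \<inter> fv (App (Var h) t) = {}"
          unfolding wt_simps(2)[of _ "Fn x r"] by blast
        from E(2) obtain F where F: "\<tau> h = F \<rightarrow> E" "wt (\<tau>(y := B1)) t F" "h \<notin> fv t"
          using neh by (auto simp: wt_simps)
        have fveq: "fv (Fn x r) \<union> insert h (fv t) = fv r1"
          using eqt_typed(3)[OF IH(2)] by simp
        have wt': "wt \<tau> (App (Fn y t) ?W) F"
          using F(2) wk fvt fveq hy by (auto simp: wt_simps)
        have wht: "wt \<tau> (App (Var h) (App (Fn y t) ?W)) E"
          using F wt' fveq False r hy neh by (auto simp: wt_simps(1,2))
        have e3: "eqt \<tau> (App (Var h) (App (Fn y t) ?W)) (App (Fn y (App (Var h) t)) ?W) E"
          by (rule float_AppR[OF wht]) (use neh in simp)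
        have dj': "fv (Fn x r) \<inter> fv (App (Var h) (App (Fn y t) ?W)) = {}"
          using E(3) fveq dj yr by auto
        have e4: "eqt \<tau> (App (Fn x r) (App (Var h) (App (Fn y t) ?W))) (App (Fn x r) (App (Fn y (App (Var h) t)) ?W)) D"
          by (rule eqt_App[OF eqt_refl e3 dj']) (use E(1) yr in \<open>simp add: wt_upd_fresh\<close>)
        have e5: "eqt \<tau> (App (Fn x r) (App (Fn y (App (Var h) t)) ?W)) (App (Fn y (App (Fn x r) (App (Var h) t))) ?W) D"
          by (rule float_AppR[OF eqt_typed(2)[OF e4] yr])
        have "eqt \<tau> ?s (App (Fn x r) (App (Var h) (App (Fn y t) ?W))) D"
          by (rule eqt_trans[OF e2 eqt_sym[OF eqt_trans[OF e4 e5]]])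
        moreover have "fv (App (Fn y t) ?W) = on_side S \<tau> (fv ?s - {h})"
        proof -
          have "y \<notin> on_side S \<tau> (fv r1 - {h} - {y})" by (simp add: on_side_def)
          then have "fv (App (Fn y t) ?W) = on_side S \<tau> (fv r1 - {h} - {y}) \<union> insert k (fv t1)"
            using fvt by auto
          also have "\<dots> = on_side S \<tau> (fv ?s - {h})"
            unfolding Vs using t1 nk(1) by (auto simp: on_side_def)
          finally show ?thesis .
        qed
        ultimately show ?thesis
          using IH(1) by blast
      qed
    qed
  qed
qed

text \<open>The counterpart of \<open>cf_permute_app\<close> for the other rule that splits the
  assumptions. The remaining two rules are invertible by eta expansion and need no
  permutation.\<close>

lemma cf_permute_tup:
  assumes "cf X \<tau> s C" "C = A \<otimes> B" "fv s \<subseteq> X" "tv A \<subseteq> S" "tv B \<subseteq> - S" "coloured S \<tau> (fv s)"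
  shows "\<exists>p q. eqt \<tau> s (Tup p q) C \<and> fv p = on_side S \<tau> (fv s)"
  using assms
proof (induction rule: cf.induct)
  case (cf_tup X \<tau> p A1 q B1)
  note hy = cf_tup.hyps cf_tup.prems
  have sub: "tv A1 \<subseteq> S" "tv B1 \<subseteq> - S" using hy by auto
  have col: "coloured S \<tau> (fv p)" "coloured (- S) \<tau> (fv q)"
    using hy(8) by (auto simp: coloured_compl intro: coloured_mono)
  have "on_side S \<tau> (fv p) = fv p"
    by (rule on_side_all) (rule cf_connected[OF hy(1) sub(1) col(1)])
  moreover have "on_side S \<tau> (fv q) = {}"
    by (rule on_side_none) (rule cf_connected[OF hy(2) sub(2) col(2)])
  ultimately show ?case
    using eqt_refl[OF cf_wt[OF cf.cf_tup[OF hy(1-3)]]]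
    by (intro exI[of _ p] exI[of _ q]) (simp add: on_side_Un)
next
  case (cf_let u v X z s \<tau> A1 B1 C)
  note hy = cf_let.hyps cf_let.prems
  have Xs: "fv s \<subseteq> {u, v} \<union> X" using hy by auto
  have z: "tv (A1 \<otimes> B1) \<subseteq> S \<or> tv (A1 \<otimes> B1) \<subseteq> - S"
    by (rule colouredD[OF hy(14) _ hy(8)]) simp
  then have AB: "tv A1 \<subseteq> S \<or> tv A1 \<subseteq> - S" "tv B1 \<subseteq> S \<or> tv B1 \<subseteq> - S" by auto
  have col: "coloured S (\<tau>(u := A1, v := B1)) (fv s)"
    by (rule coloured_upd2[OF coloured_mono[OF hy(14)] AB]) auto
  have "\<exists>p q. eqt (\<tau>(u := A1, v := B1)) s (Tup p q) C \<and> fv p = on_side S (\<tau>(u := A1, v := B1)) (fv s)"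
    by (rule cf_let.IH[OF hy(10) Xs hy(12,13) col])
  then obtain p q where IH: "eqt (\<tau>(u := A1, v := B1)) s (Tup p q) C"
    "fv p = on_side S (\<tau>(u := A1, v := B1)) (fv s)" by blast
  have Vs: "fv (LetTup u v (Var z) s) = insert z (fv s - {v} - {u})" by auto
  have e1: "eqt \<tau> (LetTup u v (Var z) s) (LetTup u v (Var z) (Tup p q)) C"
    by (rule eqt_Let[OF eqt_refl IH(1)]) (use hy in \<open>auto simp: wt_simps\<close>)
  note w1 = eqt_typed(2)[OF e1]
  from z show ?case
  proof
    assume zS: "tv (A1 \<otimes> B1) \<subseteq> S"
    then have fvp: "fv p = {u, v} \<union> on_side S \<tau> (fv s - {v} - {u})"
      using IH(2) hy(1,5,6) by (auto simp: on_side_upd)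
    have "{u, v} \<inter> fv q = {}"
      using w1 fvp by (auto simp: wt_def)
    from eqt_trans[OF e1 eqt_sym[OF commute_TupL[OF w1 this]]]
    have "eqt \<tau> (LetTup u v (Var z) s) (Tup (LetTup u v (Var z) p) q) C" .
    moreover have "fv (LetTup u v (Var z) p) = on_side S \<tau> (fv (LetTup u v (Var z) s))"
      unfolding Vs using fvp zS hy(8) by (auto simp: on_side_def)
    ultimately show ?thesis by blast
  next
    assume zS: "tv (A1 \<otimes> B1) \<subseteq> - S"
    then have nS: "\<not> tv A1 \<subseteq> S" "\<not> tv B1 \<subseteq> S" "\<not> tv (\<tau> z) \<subseteq> S"
      using tv_sub_compl[of A1 S] tv_sub_compl[of B1 S] tv_sub_compl[of "\<tau> z" S] hy(8) by auto
    then have fvp: "fv p = on_side S \<tau> (fv s - {v} - {u})"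
      using IH(2) by (simp add: on_side_upd)
    then have "{u, v} \<inter> fv p = {}"
      using on_side_sub[of S \<tau> "fv s - {v} - {u}"] by auto
    from eqt_trans[OF e1 eqt_sym[OF commute_TupR[OF w1 this]]]
    have "eqt \<tau> (LetTup u v (Var z) s) (Tup p (LetTup u v (Var z) q)) C" .
    moreover have "fv p = on_side S \<tau> (fv (LetTup u v (Var z) s))"
      unfolding Vs using fvp nS by (auto simp: on_side_def)
    ultimately show ?thesis by blast
  qed
next
  case (cf_app y X k r1 t1 \<tau> A1 B1 C)
  note hy = cf_app.hyps cf_app.prems
  let ?W = "App (Var k) t1"
  let ?s = "App (Fn y r1) ?W"
  have w: "wt \<tau> t1 A1" "wt (\<tau>(y := B1)) r1 C" using hy(9,10) cf_wt by auto
  have wk: "wt \<tau> ?W B1" using w hy by (auto simp: wt_simps)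
  have dj: "fv (Fn y r1) \<inter> fv ?W = {}" using hy by auto
  have Xs: "fv r1 \<subseteq> insert y X" using hy by auto
  have k: "tv (A1 \<rightarrow> B1) \<subseteq> S \<or> tv (A1 \<rightarrow> B1) \<subseteq> - S"
    by (rule colouredD[OF hy(15) _ hy(8)]) simp
  then have B1: "tv B1 \<subseteq> S \<or> tv B1 \<subseteq> - S" by auto
  have colt: "coloured S \<tau> (fv t1)"
    using hy(15) by (rule coloured_mono) auto
  have colr: "coloured S (\<tau>(y := B1)) (fv r1)"
    by (rule coloured_upd[OF coloured_mono[OF hy(15)] B1]) auto
  have "\<exists>p q. eqt (\<tau>(y := B1)) r1 (Tup p q) C \<and> fv p = on_side S (\<tau>(y := B1)) (fv r1)"
    by (rule cf_app.IH(2)[OF hy(11) Xs hy(13,14) colr])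
  then obtain p q where IH: "eqt (\<tau>(y := B1)) r1 (Tup p q) C"
    "fv p = on_side S (\<tau>(y := B1)) (fv r1)" by blast
  from eqt_typed(2)[OF IH(1)] have wpq: "wt (\<tau>(y := B1)) p A" "wt (\<tau>(y := B1)) q B" "fv p \<inter> fv q = {}"
    unfolding hy(11) by (auto simp: wt_simps)
  have fvr: "fv r1 = fv p \<union> fv q"
    using eqt_typed(3)[OF IH(1)] by simp
  have Vs: "fv ?s = insert k (fv t1 \<union> (fv r1 - {y}))" by auto
  have e2: "eqt \<tau> ?s (App (Fn y (Tup p q)) ?W) C"
    by (rule eqt_App[OF eqt_Fn[OF IH(1) hy(3)] eqt_refl[OF wk] dj])
  from k show ?case
  proof
    assume kS: "tv (A1 \<rightarrow> B1) \<subseteq> S"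
    then have nk: "tv (\<tau> k) \<subseteq> S" "tv A1 \<subseteq> S" "tv B1 \<subseteq> S"
      using hy(8) by auto
    have t1: "on_side S \<tau> (fv t1) = fv t1"
      by (rule on_side_all) (rule cf_connected[OF hy(9) nk(2) colt])
    have fvp: "fv p = insert y (on_side S \<tau> (fv r1 - {y}))"
      using IH(2) nk(3) hy(3) by (auto simp: on_side_upd)
    then have yq: "y \<notin> fv q" using wpq(3) by auto
    have "wt \<tau> (App (Fn y p) ?W) A"
      using wpq(1) wk fvp fvr dj by (auto simp: wt_simps)
    then have "wt \<tau> (Tup (App (Fn y p) ?W) q) C"
      using wpq yq fvr dj unfolding hy(11) by (auto simp: wt_simps(4) wt_upd_fresh)
    from eqt_trans[OF e2 eqt_sym[OF float_TupL[OF this yq]]]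
    have "eqt \<tau> ?s (Tup (App (Fn y p) ?W) q) C" .
    moreover have "fv (App (Fn y p) ?W) = on_side S \<tau> (fv ?s)"
    proof -
      have "y \<notin> on_side S \<tau> (fv r1 - {y})" by (simp add: on_side_def)
      then have "fv (App (Fn y p) ?W) = on_side S \<tau> (fv r1 - {y}) \<union> insert k (fv t1)"
        using fvp by auto
      also have "\<dots> = on_side S \<tau> (fv ?s)"
        unfolding Vs using t1 nk(1) by (auto simp: on_side_def)
      finally show ?thesis .
    qed
    ultimately show ?thesis by blast
  next
    assume kS: "tv (A1 \<rightarrow> B1) \<subseteq> - S"
    then have nk: "\<not> tv (\<tau> k) \<subseteq> S" "tv A1 \<subseteq> - S" "\<not> tv B1 \<subseteq> S"
      using tv_sub_compl[of "A1 \<rightarrow> B1" S] tv_sub_compl[of B1 S] hy(8) by auto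
    have t1: "on_side S \<tau> (fv t1) = {}"
      by (rule on_side_none) (use cf_connected[OF hy(9) nk(2)] colt in \<open>simp add: coloured_compl\<close>)
    have fvp: "fv p = on_side S \<tau> (fv r1 - {y})"
      using IH(2) nk(3) by (simp add: on_side_upd)
    then have yp: "y \<notin> fv p" by (auto simp: on_side_def)
    then have yq: "y \<in> fv q" using fvr hy(3) by auto
    have "wt \<tau> (App (Fn y q) ?W) B"
      using wpq(2) wk yq fvr dj by (auto simp: wt_simps)
    then have "wt \<tau> (Tup p (App (Fn y q) ?W)) C"
      using wpq yp fvr dj unfolding hy(11) by (auto simp: wt_simps(4) wt_upd_fresh)
    from eqt_trans[OF e2 eqt_sym[OF float_TupR[OF this yp]]]
    have "eqt \<tau> ?s (Tup p (App (Fn y q) ?W)) C" .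
    moreover have "fv p = on_side S \<tau> (fv ?s)"
      unfolding Vs using fvp t1 nk(1) by (auto simp: on_side_def)
    ultimately show ?thesis by blast
  qed
qed auto

text \<open>\<open>atoms True B\<close> collects the occurrences of type variables in an assumption \<open>B\<close> that an axiom
  can use, \<open>atoms False B\<close> those that have to be provided; the roles are swapped in the goal.\<close>

fun atoms :: "bool \<Rightarrow> ty \<Rightarrow> name multiset" where
  "atoms b (TVar a) = (if b then {#a#} else {#})"
| "atoms b (A \<otimes> B) = atoms b A + atoms b B"
| "atoms b (A \<rightarrow> B) = atoms (\<not> b) A + atoms b B"

section \<open>Balance of the occurrences in a sequent\<close>

definition seqa :: "bool \<Rightarrow> (name \<Rightarrow> ty) \<Rightarrow> name set \<Rightarrow> ty \<Rightarrow> name multiset" where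
  "seqa b \<tau> V C = (\<Sum>x \<in> V. atoms b (\<tau> x)) + atoms (\<not> b) C"

lemma tv_atoms: "tv A = set_mset (atoms b A) \<union> set_mset (atoms (\<not> b) A)"
proof -
  have "tv A = set_mset (atoms True A) \<union> set_mset (atoms False A)"
    by (induction A) auto
  then show ?thesis by (cases b) auto
qed

lemma seqa_fn:
  "finite V \<Longrightarrow> x \<in> V \<Longrightarrow> seqa b (\<tau>(x := A)) V B = seqa b \<tau> (V - {x}) (A \<rightarrow> B)"
  by (simp add: seqa_def sum_upd del: fun_upd_apply)

lemma seqa_tup:
  "finite V \<Longrightarrow> finite W \<Longrightarrow> V \<inter> W = {} \<Longrightarrow> seqa b \<tau> (V \<union> W) (A \<otimes> B) = seqa b \<tau> V A + seqa b \<tau> W B"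
  by (simp add: seqa_def sum.union_disjoint)

lemma seqa_let:
  assumes "finite V" "u \<in> V" "v \<in> V" "u \<noteq> v" "z \<notin> V" "\<tau> z = A \<otimes> B"
  shows "seqa b (\<tau>(u := A, v := B)) V C = seqa b \<tau> (insert z (V - {u, v})) C"
  unfolding seqa_def sum_upd2[OF assms(1-4)] using assms by simp

lemma seqa_app:
  assumes "finite V" "finite W" "x \<in> V" "x \<notin> W" "h \<notin> V" "h \<notin> W" "W \<inter> V = {}" "\<tau> h = A \<rightarrow> B"
  shows "seqa b \<tau> ((V - {x}) \<union> insert h W) C = seqa b \<tau> W A + seqa b (\<tau>(x := B)) V C"
proof -
  have "(V - {x}) \<union> insert h W = insert h ((V - {x}) \<union> W)" by auto
  moreover have "(V - {x}) \<inter> W = {}" using assms by auto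
  ultimately show ?thesis
    unfolding seqa_def sum_upd[OF assms(1,3)] using assms by (simp add: sum.union_disjoint)
qed

lemma seqa_tv:
  assumes "finite V"
  shows "tv C \<union> (\<Union>x \<in> V. tv (\<tau> x)) = set_mset (seqa b \<tau> V C) \<union> set_mset (seqa (\<not> b) \<tau> V C)"
proof -
  have "set_mset (\<Sum>x \<in> V. atoms b (\<tau> x)) = (\<Union>x \<in> V. set_mset (atoms b (\<tau> x)))" for b
    using assms by (induction V rule: finite_induct) auto
  then show ?thesis
    unfolding seqa_def using tv_atoms[of _ b] by auto
qed

text \<open>An axiom consumes one providing and one required occurrence of the same variable, and
  all other rules only distribute occurrences over their premises.\<close>

lemma cf_parity: "cf X \<tau> s C \<Longrightarrow> seqa True \<tau> (fv s) C = seqa False \<tau> (fv s) C"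
proof (induction rule: cf.induct)
  case (cf_var \<tau> x a X)
  then show ?case by (simp add: seqa_def)
next
  case (cf_fn x X s \<tau> A B)
  have "seqa True (\<tau>(x := A)) (fv s) B = seqa False (\<tau>(x := A)) (fv s) B"
    by (rule cf_fn.IH)
  then show ?case
    using cf_fn.hyps(2) by (simp add: seqa_fn)
next
  case (cf_tup X \<tau> p A q B)
  then show ?case by (simp add: seqa_tup)
next
  case (cf_let u v X z s \<tau> A B C)
  have "seqa True (\<tau>(u := A, v := B)) (fv s) C = seqa False (\<tau>(u := A, v := B)) (fv s) C"
    by (rule cf_let.IH)
  then show ?case
    using seqa_let[of "fv s" u v z \<tau> A B, OF finite_fv cf_let.hyps(5,6,1,7,8)] by simp
next
  case (cf_app x X h r t \<tau> A B C)
  have "seqa True (\<tau>(x := B)) (fv r) C = seqa False (\<tau>(x := B)) (fv r) C"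
    by (rule cf_app.IH)
  then show ?case
    using seqa_app[of "fv r" "fv t" x h \<tau> A B, OF finite_fv finite_fv cf_app.hyps(3,6,5,4,7,8)] cf_app.IH(1) by simp
qed

lemma rename_Fn:
  assumes "wt \<tau> (Fn x r) C" "y \<notin> fv r - {x}"
  shows "\<exists>r'. eqt \<tau> (Fn x r) (Fn y r') C"
proof (cases "y = x")
  case True
  then show ?thesis using assms eqt_refl by blast
next
  case False
  from assms obtain A B where C: "C = A \<rightarrow> B" "wt (\<tau>(x := A)) r B" "x \<in> fv r"
    by (auto simp: wt_simps)
  obtain r1 where r1: "eqt (\<tau>(x := A)) r r1 B" "bv r1 \<inter> {y} = {}" "fv r1 = fv r"
    using freshen_eqt[OF C(2), of "{y}"] by blast
  have 1: "eqt \<tau> (Fn x r) (Fn x r1) C"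
    unfolding C(1) by (rule eqt_Fn[OF r1(1) C(3)])
  have "y \<notin> fv r1 \<union> bv r1"
    using r1 False assms(2) by auto
  from eqt_trans[OF 1 red_eqt[OF red_alpha_Fn[OF eqt_typed(2)[OF 1] this]]]
  show ?thesis by blast
qed

lemma linear_split:
  fixes M N :: "'a multiset"
  assumes "\<And>a. count (M + N) a \<le> 1"
  shows "(\<And>a. count M a \<le> 1)" "(\<And>a. count N a \<le> 1)" "set_mset M \<inter> set_mset N = {}"
proof -
  have *: "count M a + count N a \<le> 1" for a
    using assms[of a] by simp
  show "count M a \<le> 1" "count N a \<le> 1" for a
    using *[of a] by simp_all
  show "set_mset M \<inter> set_mset N = {}"
  proof (rule ccontr)
    assume "set_mset M \<inter> set_mset N \<noteq> {}"
    then obtain a where "a \<in># M" "a \<in># N" by auto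
    then have "0 < count M a" "0 < count N a" by simp_all
    with *[of a] show False by simp
  qed
qed

text \<open>By \<open>cf_parity\<close> and the assumption on the counts, the premises of the last rule share no type
  variable, so the other term can be permuted to end with the same rule.\<close>

lemma cf_coherence:
  assumes "cf X \<tau> s C" "finite X" "fv s \<subseteq> X" "\<And>a. count (seqa True \<tau> (fv s) C) a \<le> 1"
    "wt \<tau> s' C" "fv s' = fv s"
  shows "eqt \<tau> s s' C"
  using assms
proof (induction arbitrary: s' rule: cf.induct)
  case (cf_var \<tau> x a X)
  obtain s'' where s'': "red \<tau> s' s'' (TVar a)" "cf X \<tau> s'' (TVar a)"
    using red_cf[OF cf_var.prems(4,1)] cf_var.prems(2,5) by auto
  have "fv s'' = {x}"
    using red_fv[OF s''(1)] cf_var.prems(5) by simp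
  \<comment> \<open>A left rule at the root would need a compound type for a free variable, but the
    only one, \<open>x\<close>, has an atomic type.\<close>
  with s''(2) have "s'' = Var x"
    using cf_var.hyps by cases auto
  then show ?case
    using red_eqt[OF s''(1)] eqt_sym by blast
next
  case (cf_fn x X s \<tau> A B)
  note hy = cf_fn.hyps cf_fn.prems
  have x: "x \<notin> fv s'" using hy by auto
  have e: "eqt \<tau> s' (Fn x (App s' (Var x))) (A \<rightarrow> B)"
    using red_eqt[OF red_eta_Fn[OF hy(7) x]] .
  have "eqt (\<tau>(x := A)) s (App s' (Var x)) B"
  proof (rule cf_fn.IH)
    show "count (seqa True (\<tau>(x := A)) (fv s) B) a \<le> 1" for a
      using hy(6)[of a] hy(2) by (simp add: seqa_fn)
    show "wt (\<tau>(x := A)) (App s' (Var x)) B"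
      using hy(7) x by (auto simp: wt_simps wt_upd_fresh)
  qed (use hy in auto)
  from eqt_trans[OF eqt_Fn[OF this hy(2)] eqt_sym[OF e]] show ?case .
next
  case (cf_tup X \<tau> p A q B)
  note hy = cf_tup.hyps cf_tup.prems
  obtain s'' where s'': "red \<tau> s' s'' (A \<otimes> B)" "cf X \<tau> s'' (A \<otimes> B)"
    using red_cf[OF hy(7,4)] hy(5,8) by auto
  have fvs: "fv s'' = fv p \<union> fv q"
    using red_fv[OF s''(1)] hy(8) by simp
  note lin2 = linear_split[OF hy(6)[unfolded fv.simps seqa_tup[OF finite_fv finite_fv hy(3)]]]
  define S where "S = tv A \<union> (\<Union>x \<in> fv p. tv (\<tau> x))"
  define T where "T = tv B \<union> (\<Union>x \<in> fv q. tv (\<tau> x))"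
  have ST: "S \<inter> T = {}"
    unfolding S_def T_def seqa_tv[OF finite_fv, of _ _ _ True]
    using cf_parity[OF hy(1)] cf_parity[OF hy(2)] lin2(3) by simp
  then have pq: "tv (\<tau> x) \<subseteq> S" if "x \<in> fv p" for x
    using that unfolding S_def by auto
  have qq: "tv (\<tau> x) \<subseteq> - S" if "x \<in> fv q" for x
    using that ST unfolding T_def by auto
  have AB: "tv A \<subseteq> S" "tv B \<subseteq> - S"
    using ST unfolding S_def T_def by auto
  have "coloured S \<tau> (fv s'')"
    unfolding coloured_def fvs using pq qq by blast
  from cf_permute_tup[OF s''(2) HOL.refl _ AB this] obtain p' q' where
    *: "eqt \<tau> s'' (Tup p' q') (A \<otimes> B)" "fv p' = on_side S \<tau> (fv s'')"
    using fvs hy(5) by auto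
  have "on_side S \<tau> (fv p) = fv p" "on_side S \<tau> (fv q) = {}"
    by (rule on_side_all[OF pq], assumption, rule on_side_none[OF qq])
  then have fvp: "fv p' = fv p"
    using *(2) fvs by (simp add: on_side_Un)
  have w: "wt \<tau> p' A" "wt \<tau> q' B" "fv p' \<inter> fv q' = {}"
    using eqt_typed(2)[OF *(1)] by (auto simp: wt_simps)
  have "fv p' \<union> fv q' = fv p \<union> fv q"
    using eqt_typed(3)[OF *(1)] fvs by simp
  then have fvq: "fv q' = fv q"
    using fvp w(3) hy(3) by auto
  have "eqt \<tau> (Tup p q) (Tup p' q') (A \<otimes> B)"
    by (rule eqt_Tup[OF cf_tup.IH(1)[OF hy(4) _ lin2(1) w(1) fvp] cf_tup.IH(2)[OF hy(4) _ lin2(2) w(2) fvq] hy(3)])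
      (use hy(5) in auto)
  from eqt_trans[OF this eqt_sym[OF eqt_trans[OF red_eqt[OF s''(1)] *(1)]]]
  show ?case .
next
  case (cf_let u v X z s \<tau> A B C)
  note hy = cf_let.hyps cf_let.prems
  let ?q = "App (Fn z s') (Tup (Var u) (Var v))"
  have uv: "z \<in> fv s'" "u \<notin> fv s'" "v \<notin> fv s'"
    using hy by auto
  have e: "eqt \<tau> s' (LetTup u v (Var z) ?q) C"
    by (rule red_eqt[OF red_eta_Let[OF hy(13) uv(1) hy(8,1) uv(2,3)]])
  have "eqt (\<tau>(u := A, v := B)) s ?q C"
  proof (rule cf_let.IH)
    show "count (seqa True (\<tau>(u := A, v := B)) (fv s) C) a \<le> 1" for a
      using hy(12)[of a] seqa_let[of "fv s" u v z \<tau> A B, OF finite_fv hy(5,6,1,7,8)] by simp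
    show "wt (\<tau>(u := A, v := B)) ?q C"
      using eqt_typed(2)[OF e] hy(8) by (auto simp: wt_simps(1,5))
  qed (use hy in auto)
  from eqt_trans[OF eqt_Let[OF eqt_refl this hy(1,5,6)] eqt_sym[OF e]]
  show ?case
    using hy(7,8) by (auto simp: wt_simps)
next
  case (cf_app x X h r t \<tau> A B C)
  note hy = cf_app.hyps cf_app.prems
  let ?s = "App (Fn x r) (App (Var h) t)"
  obtain s'' where s'': "red \<tau> s' s'' C" "cf X \<tau> s'' C"
    using red_cf[OF hy(14,11)] hy(12,15) by auto
  have fvs: "fv s'' = fv ?s"
    using red_fv[OF s''(1)] hy(15) by simp
  have fvs': "fv ?s = (fv r - {x}) \<union> insert h (fv t)" by simp
  note lin2 = linear_split[OF hy(13)[unfolded fvs' seqa_app[of "fv r" "fv t" x h \<tau> A B, OF finite_fv finite_fv hy(3,6,5,4,7,8)]]]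
  define S where "S = tv A \<union> (\<Union>x \<in> fv t. tv (\<tau> x))"
  define T where "T = tv C \<union> (\<Union>y \<in> fv r. tv ((\<tau>(x := B)) y))"
  have "T = set_mset (seqa True (\<tau>(x := B)) (fv r) C) \<union> set_mset (seqa False (\<tau>(x := B)) (fv r) C)"
    unfolding T_def by (subst seqa_tv[of "fv r" C "\<tau>(x := B)" True]) simp_all
  then have ST: "S \<inter> T = {}"
    unfolding S_def seqa_tv[OF finite_fv, of _ _ _ True]
    using cf_parity[OF hy(9)] cf_parity[OF hy(10)] lin2(3) by simp
  have pq: "tv (\<tau> x) \<subseteq> S" if "x \<in> fv t" for x
    using that unfolding S_def by auto
  have "tv ((\<tau>(x := B)) y) \<subseteq> - S" if "y \<in> fv r" for y
    using that ST unfolding T_def by blast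
  note Tc = this
  have qq: "tv B \<subseteq> - S"
    using Tc[OF hy(3)] by simp
  have qq': "tv (\<tau> y) \<subseteq> - S" if "y \<in> fv r - {x}" for y
    using Tc[of y] that by simp
  have AC: "tv A \<subseteq> S" "tv C \<subseteq> - S"
    using ST unfolding S_def T_def by auto
  have V: "fv s'' - {h} = fv t \<union> (fv r - {x})"
    unfolding fvs using hy by auto
  have "coloured S \<tau> (fv s'' - {h})"
    unfolding coloured_def V using pq qq' by blast
  moreover have "fv s'' \<subseteq> X" "h \<in> fv s''"
    using fvs hy(12) by auto
  ultimately obtain x' r' t' where
    *: "x' \<notin> X" "eqt \<tau> s'' (App (Fn x' r') (App (Var h) t')) C" "fv t' = on_side S \<tau> (fv s'' - {h})"
    using cf_permute_app[OF s''(2) _ _ hy(8) AC(1) qq AC(2)] by blast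
  \<comment> \<open>The permutation describes the assumptions of \<open>t'\<close> by colours alone,
    so they are the assumptions of \<open>t\<close> and the induction hypothesis applies.\<close>
  have "on_side S \<tau> (fv t) = fv t" "on_side S \<tau> (fv r - {x}) = {}"
    by (rule on_side_all[OF pq], assumption, rule on_side_none[OF qq'])
  then have fvt: "fv t' = fv t"
    using *(3) unfolding V by (simp add: on_side_Un)
  from eqt_typed(2)[OF *(2)] obtain E F where w: "wt \<tau> (Fn x' r') (E \<rightarrow> C)" "wt \<tau> (App (Var h) t') E"
    "fv (Fn x' r') \<inter> fv (App (Var h) t') = {}" "wt \<tau> t' F" "\<tau> h = F \<rightarrow> E"
    by (auto simp: wt_simps(1,2))
  with hy(8) have EF: "F = A" "E = B" by auto
  have fvr: "fv (Fn x' r') = fv r - {x}"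
  proof -
    have "fv (Fn x' r') \<union> insert h (fv t) = (fv r - {x}) \<union> insert h (fv t)"
      using eqt_typed(3)[OF *(2)] fvs fvt by simp
    moreover have "fv (Fn x' r') \<inter> insert h (fv t) = {}"
      using w(3) fvt by simp
    moreover have "(fv r - {x}) \<inter> insert h (fv t) = {}"
      using hy by auto
    ultimately show ?thesis by blast
  qed
  \<comment> \<open>The bound name came out of the permutation; it is aligned with \<open>x\<close>
    before the bodies are compared.\<close>
  then have "x \<notin> fv r' - {x'}" by auto
  from rename_Fn[OF w(1) this] obtain r'' where r'': "eqt \<tau> (Fn x' r') (Fn x r'') (E \<rightarrow> C)"
    by blast
  have w'': "wt (\<tau>(x := B)) r'' C" "x \<in> fv r''"
    using eqt_typed(2)[OF r''] EF by (auto simp: wt_simps)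
  have "fv r'' - {x} = fv r - {x}"
    using eqt_typed(3)[OF r''] fvr by simp
  then have fvr'': "fv r'' = fv r"
    using w''(2) hy(3) by auto
  have e1: "eqt \<tau> t t' A"
    by (rule cf_app.IH(1)[OF hy(11) _ lin2(1) _ fvt]) (use hy(12) w(4) EF in auto)
  have e2: "eqt (\<tau>(x := B)) r r'' C"
    by (rule cf_app.IH(2)[OF _ _ lin2(2) w''(1) fvr'']) (use hy(11,12) in auto)
  have e3: "eqt \<tau> (App (Var h) t) (App (Var h) t') B"
    using hy by (intro eqt_App[OF eqt_refl e1]) (auto simp: wt_simps)
  have "eqt \<tau> ?s (App (Fn x r'') (App (Var h) t')) C"
    by (rule eqt_App[OF eqt_Fn[OF e2 hy(3)] e3]) (use hy in auto)
  also have "eqt \<tau> (App (Fn x r'') (App (Var h) t')) (App (Fn x' r') (App (Var h) t')) C"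
  proof (rule eqt_App[OF eqt_sym[OF r''] eqt_refl[OF w(2)]])
    show "fv (Fn x r'') \<inter> fv (App (Var h) t') = {}"
      using w(3) eqt_typed(3)[OF r''] by simp
  qed
  also note eqt_sym[OF *(2)]
  also note eqt_sym[OF red_eqt[OF s''(1)]]
  finally show ?case .
qed

lemma coherence:
  assumes "wt \<tau> s C" "wt \<tau> s' C" "fv s' = fv s" "\<And>a. count (seqa True \<tau> (fv s) C) a \<le> 1"
  shows "eqt \<tau> s s' C"
proof -
  obtain s0 where s0: "red \<tau> s s0 C" "cf (fv s) \<tau> s0 C"
    using red_cf[OF assms(1), of "fv s"] by auto
  from cf_coherence[OF s0(2) _ _ _ assms(2)] have "eqt \<tau> s0 s' C"
    using red_fv[OF s0(1)] assms(3,4) by auto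
  with red_eqt[OF s0(1)] show ?thesis
    by (rule eqt_trans)
qed

subsection \<open>Linkings\<close>

abbreviation ren :: "(name \<Rightarrow> name) \<Rightarrow> ty \<Rightarrow> ty" where
  "ren l \<equiv> tsubst (\<lambda>a. TVar (l a))"

lemma tsubst_cong: "(\<And>a. a \<in> tv A \<Longrightarrow> \<theta> a = \<theta>' a) \<Longrightarrow> tsubst \<theta> A = tsubst \<theta>' A"
  by (induction A) auto

lemma tsubst_tsubst: "tsubst \<theta> (tsubst \<theta>' A) = tsubst (\<lambda>a. tsubst \<theta> (\<theta>' a)) A"
  by (induction A) auto

text \<open>The occurrences at which the traversal of a goal begins. Those in the arguments of an
  arrow are absent: they belong to assumptions.\<close>

fun roots :: "ty \<Rightarrow> name list" where
  "roots (TVar j) = [j]"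
| "roots (A \<otimes> B) = roots A @ roots B"
| "roots (A \<rightarrow> B) = roots B"

text \<open>The types are labelled: every occurrence of a type variable has a name of its own. When an
  assumption is used at the occurrence \<open>i\<close>, the occurrences \<open>G i\<close> in its arguments have to be
  provided next. \<open>groups G B m\<close> says that \<open>G\<close> describes this for the assumption \<open>B\<close>, where \<open>m\<close>
  collects what the arguments supplied so far require.\<close>

fun groups :: "(name \<Rightarrow> name list) \<Rightarrow> ty \<Rightarrow> name list \<Rightarrow> bool"
  and goal_groups :: "(name \<Rightarrow> name list) \<Rightarrow> ty \<Rightarrow> bool" where
  "groups G (TVar i) m \<longleftrightarrow> G i = m"
| "groups G (A \<otimes> B) m \<longleftrightarrow> groups G A m \<and> groups G B []"
| "groups G (A \<rightarrow> B) m \<longleftrightarrow> goal_groups G A \<and> groups G B (m @ roots A)"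
| "goal_groups G (TVar i) \<longleftrightarrow> True"
| "goal_groups G (A \<otimes> B) \<longleftrightarrow> goal_groups G A \<and> goal_groups G B"
| "goal_groups G (A \<rightarrow> B) \<longleftrightarrow> groups G A [] \<and> goal_groups G B"

lemma groups_cong:
  "(\<And>i. i \<in> tv A \<Longrightarrow> G i = G' i) \<Longrightarrow> groups G A m \<longleftrightarrow> groups G' A m"
  "(\<And>i. i \<in> tv A \<Longrightarrow> G i = G' i) \<Longrightarrow> goal_groups G A \<longleftrightarrow> goal_groups G' A"
  by (induction A arbitrary: m) auto

text \<open>The list is a stack of pending occurrences: \<open>j\<close> is answered by
  \<open>l j\<close>, and what this requires in turn is visited before the rest. It is a relation
  because for an arbitrary \<open>l\<close> the traversal need not end.\<close>

inductive trav :: "(name \<Rightarrow> name list) \<Rightarrow> (name \<Rightarrow> name) \<Rightarrow> name list \<Rightarrow> name list \<Rightarrow> bool"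
  for G l where
  trav_nil: "trav G l [] []"
| trav_cons: "trav G l (G (l j) @ js) v \<Longrightarrow> trav G l (j # js) (j # v)"

lemma trav_append: "trav G l js v \<Longrightarrow> trav G l js' v' \<Longrightarrow> trav G l (js @ js') (v @ v')"
  by (induction rule: trav.induct) (auto intro: trav.intros)

lemma trav_split:
  "trav G l xs v \<Longrightarrow> xs = js @ js' \<Longrightarrow> \<exists>v1 v2. v = v1 @ v2 \<and> trav G l js v1 \<and> trav G l js' v2"
proof (induction arbitrary: js js' rule: trav.induct)
  case trav_nil
  then show ?case using trav.trav_nil by auto
next
  case (trav_cons j ks v)
  show ?case
  proof (cases js)
    case Nil
    with trav_cons show ?thesis
      using trav.trav_nil trav.trav_cons by (metis append_Nil)
  next
    case (Cons k js0)
    with trav_cons.prems have "G (l j) @ ks = (G (l j) @ js0) @ js'" "k = j" by auto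
    from trav_cons.IH[OF this(1)] obtain v1 v2 where
      "v = v1 @ v2" "trav G l (G (l j) @ js0) v1" "trav G l js' v2" by blast
    then show ?thesis
      using trav.trav_cons Cons \<open>k = j\<close> by (metis append_Cons)
  qed
qed

lemma trav_det: "trav G l js v \<Longrightarrow> trav G l js v' \<Longrightarrow> v = v'"
proof (induction arbitrary: v' rule: trav.induct)
  case trav_nil
  then show ?case by cases auto
next
  case (trav_cons j js v)
  from trav_cons.prems show ?case
    by cases (auto dest: trav_cons.IH)
qed

text \<open>The stack can be replayed from the letters alone: the next occurrence is its top, and
  what is pushed depends on the letter \<open>l j\<close> and not otherwise on \<open>l\<close>. So
  the letters reveal which occurrence each of them answers.\<close>

lemma trav_decode: "trav G l js v \<Longrightarrow> trav G l' js v' \<Longrightarrow> map l v = map l' v' \<Longrightarrow> v = v'"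
proof (induction arbitrary: v' rule: trav.induct)
  case trav_nil
  then show ?case by simp
next
  case (trav_cons j js v)
  from trav_cons.prems(1) show ?case
  proof cases
    case (trav_cons v1)
    then show ?thesis
      using trav_cons.IH[of v1] trav_cons.prems(2) by simp
  qed
qed

definition labels :: "(name \<Rightarrow> ty) \<Rightarrow> name set \<Rightarrow> ty \<Rightarrow> name set" where
  "labels \<tau> V C = tv C \<union> (\<Union>x \<in> V. tv (\<tau> x))"

lemma labels_seqa:
  "finite V \<Longrightarrow> labels \<tau> V C = set_mset (seqa True \<tau> V C + seqa False \<tau> V C)"
  unfolding labels_def using seqa_tv[of V C \<tau> True] by simp

text \<open>\<open>l\<close> maps an occurrence that has to be provided to the one that provides it. The term that is
  to replace the variable \<open>x\<close> still has to be traversed along \<open>m x\<close>, which yields \<open>w x\<close>.\<close>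

definition linking :: "(name \<Rightarrow> name list) \<Rightarrow> (name \<Rightarrow> name) \<Rightarrow> (name \<Rightarrow> ty) \<Rightarrow> (name \<Rightarrow> name list)
    \<Rightarrow> trm \<Rightarrow> ty \<Rightarrow> (name \<Rightarrow> name) \<Rightarrow> bool" where
  "linking G \<theta> \<tau> m s C l \<longleftrightarrow>
    (\<forall>a \<in># seqa True \<tau> (fv s) C. l a = a) \<and>
    image_mset l (seqa False \<tau> (fv s) C) = seqa True \<tau> (fv s) C \<and>
    (\<forall>a \<in> labels \<tau> (fv s) C. \<theta> (l a) = \<theta> a) \<and>
    has_ty (\<lambda>x. ren l (\<tau> x)) s (ren l C) \<and>
    (\<forall>l' w. (\<forall>a \<in> labels \<tau> (fv s) C. l' a = l a) \<longrightarrow> (\<forall>x \<in> fv s. trav G l' (m x) (w x)) \<longrightarrow>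
      (\<exists>v. trav G l' (roots C) v \<and> mset v = seqa False \<tau> (fv s) C + (\<Sum>x \<in> fv s. mset (w x))))"

lemma linking_cong:
  assumes "linking G \<theta> \<tau> m s C l" "\<And>a. a \<in> labels \<tau> (fv s) C \<Longrightarrow> l' a = l a"
  shows "linking G \<theta> \<tau> m s C l'"
proof -
  have sub: "a \<in># seqa b \<tau> (fv s) C \<Longrightarrow> a \<in> labels \<tau> (fv s) C" for a b
    unfolding labels_seqa[OF finite_fv] by (cases b) auto
  have "image_mset l' (seqa False \<tau> (fv s) C) = image_mset l (seqa False \<tau> (fv s) C)"
    by (rule image_mset_cong) (use assms(2) sub in auto)
  moreover have "ren l' C = ren l C"
    by (rule tsubst_cong) (use assms(2) in \<open>auto simp: labels_def\<close>)
  moreover have "ren l' (\<tau> x) = ren l (\<tau> x)" if "x \<in> fv s" for x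
    by (rule tsubst_cong) (use assms(2) that in \<open>auto simp: labels_def\<close>)
  then have "has_ty (\<lambda>x. ren l' (\<tau> x)) s A \<longleftrightarrow> has_ty (\<lambda>x. ren l (\<tau> x)) s A" for A
    by (rule has_ty_cong)
  ultimately show ?thesis
    using assms sub unfolding linking_def by simp
qed

lemma ren_eq_simps:
  "ren l A = TVar a \<longleftrightarrow> (\<exists>i. A = TVar i \<and> l i = a)"
  "ren l A = B \<otimes> C \<longleftrightarrow> (\<exists>A1 A2. A = A1 \<otimes> A2 \<and> ren l A1 = B \<and> ren l A2 = C)"
  "ren l A = B \<rightarrow> C \<longleftrightarrow> (\<exists>A1 A2. A = A1 \<rightarrow> A2 \<and> ren l A1 = B \<and> ren l A2 = C)"
  by (cases A; auto)+

lemma linear_pair: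
  fixes M1 M2 N1 N2 :: "'a multiset"
  assumes "\<And>a. count (M1 + N1 + (M2 + N2)) a \<le> 1"
  shows "\<And>a. count (M1 + M2) a \<le> 1" "\<And>a. count (N1 + N2) a \<le> 1"
    "set_mset (M1 + M2) \<inter> set_mset (N1 + N2) = {}"
proof -
  have "count (M1 + M2 + (N1 + N2)) a \<le> 1" for a
    using assms[of a] by simp
  from linear_split[of "M1 + M2" "N1 + N2", OF this]
  show "\<And>a. count (M1 + M2) a \<le> 1" "\<And>a. count (N1 + N2) a \<le> 1"
    "set_mset (M1 + M2) \<inter> set_mset (N1 + N2) = {}" by auto
qed

text \<open>Each axiom contributes one link, and typing the proof anew with the labels identified
  only along these links succeeds. A bound name may stand for an assumption that already has
  arguments; \<open>m\<close> and \<open>w\<close> account for these. Since linkings matter only on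
  the labels of the sequent, those of two premises can be glued.\<close>

lemma cf_linking:
  assumes "cf X \<tau> s C" "\<And>x. x \<in> fv s \<Longrightarrow> ren \<theta> (\<tau>l x) = \<tau> x" "ren \<theta> Cl = C"
    "\<And>x. x \<in> fv s \<Longrightarrow> groups G (\<tau>l x) (m x)" "goal_groups G Cl"
    "\<And>a. count (seqa True \<tau>l (fv s) Cl + seqa False \<tau>l (fv s) Cl) a \<le> 1"
  shows "\<exists>l. linking G \<theta> \<tau>l m s Cl l"
  using assms
proof (induction arbitrary: \<tau>l Cl m rule: cf.induct)
  case (cf_var \<tau> x a X)
  from cf_var.prems(1)[of x] cf_var.prems(2) cf_var.hyps
  obtain i j where ij: "\<tau>l x = TVar i" "Cl = TVar j" "\<theta> i = a" "\<theta> j = a"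
    by (auto simp: ren_eq_simps)
  have "i \<noteq> j"
    using cf_var.prems(5)[of i] ij by (auto simp: seqa_def)
  moreover have "G i = m x"
    using cf_var.prems(3)[of x] ij by simp
  \<comment> \<open>The required occurrence \<open>j\<close> in the goal is answered by
    \<open>i\<close>; the group of \<open>i\<close> is \<open>m x\<close>, so \<open>w x\<close>
    follows \<open>j\<close> in the traversal.\<close>
  ultimately have "linking G \<theta> \<tau>l m (Var x) Cl (id(j := i))"
    using ij by (auto simp: linking_def seqa_def labels_def intro!: exI[of _ "j # _"] trav_cons)
  then show ?case by blast
next
  case (cf_fn x X s \<tau> A B)
  note hy = cf_fn.hyps cf_fn.prems
  from hy(5) obtain L1 L2 where L: "Cl = L1 \<rightarrow> L2" "ren \<theta> L1 = A" "ren \<theta> L2 = B"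
    by (auto simp: ren_eq_simps)
  have seq: "seqa b (\<tau>l(x := L1)) (fv s) L2 = seqa b \<tau>l (fv (Fn x s)) Cl" for b
    using hy(2) L(1) by (simp add: seqa_fn)
  have lab: "labels (\<tau>l(x := L1)) (fv s) L2 = labels \<tau>l (fv (Fn x s)) Cl"
    unfolding labels_seqa[OF finite_fv] seq ..
  have "\<exists>l. linking G \<theta> (\<tau>l(x := L1)) (m(x := [])) s L2 l"
  proof (rule cf_fn.IH)
    show "count (seqa True (\<tau>l(x := L1)) (fv s) L2 + seqa False (\<tau>l(x := L1)) (fv s) L2) a \<le> 1" for a
      unfolding seq by (rule hy(8))
  qed (use hy(4-7) L in auto)
  then obtain l where l: "linking G \<theta> (\<tau>l(x := L1)) (m(x := [])) s L2 l" ..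
  have "linking G \<theta> \<tau>l m (Fn x s) Cl l"
    unfolding linking_def
  proof (intro conjI allI impI)
    have "(\<lambda>y. ren l ((\<tau>l(x := L1)) y)) = (\<lambda>y. ren l (\<tau>l y))(x := ren l L1)" by auto
    then show "has_ty (\<lambda>y. ren l (\<tau>l y)) (Fn x s) (ren l Cl)"
      using l unfolding linking_def by (simp add: L(1) del: fun_upd_apply)
    fix l' w
    assume a: "\<forall>a \<in> labels \<tau>l (fv (Fn x s)) Cl. l' a = l a" "\<forall>y \<in> fv (Fn x s). trav G l' (m y) (w y)"
    then have "\<forall>y \<in> fv s. trav G l' ((m(x := [])) y) ((w(x := [])) y)"
      by (auto intro: trav_nil)
    with l a(1) obtain v where v: "trav G l' (roots L2) v"
      "mset v = seqa False (\<tau>l(x := L1)) (fv s) L2 + (\<Sum>y \<in> fv s. mset ((w(x := [])) y))"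
      unfolding linking_def lab by blast
    then show "\<exists>v. trav G l' (roots Cl) v
        \<and> mset v = seqa False \<tau>l (fv (Fn x s)) Cl + (\<Sum>x \<in> fv (Fn x s). mset (w x))"
      unfolding seq sum_upd[OF finite_fv hy(2)] by (auto simp: L(1))
  qed (use l in \<open>auto simp: linking_def seq lab\<close>)
  then show ?case by blast
next
  case (cf_tup X \<tau> p A q B)
  note hy = cf_tup.hyps cf_tup.prems
  from hy(5) obtain L1 L2 where L: "Cl = L1 \<otimes> L2" "ren \<theta> L1 = A" "ren \<theta> L2 = B"
    by (auto simp: ren_eq_simps)
  have seq: "seqa b \<tau>l (fv (Tup p q)) Cl = seqa b \<tau>l (fv p) L1 + seqa b \<tau>l (fv q) L2" for b
    using hy(3) L(1) by (simp add: seqa_tup)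
  note lin2 = linear_pair[OF hy(8)[unfolded seq]]
  have "\<exists>l. linking G \<theta> \<tau>l m p L1 l"
    by (rule cf_tup.IH(1)) (use hy L lin2 in auto)
  then obtain l1 where l1: "linking G \<theta> \<tau>l m p L1 l1" ..
  have "\<exists>l. linking G \<theta> \<tau>l m q L2 l"
    by (rule cf_tup.IH(2)) (use hy L lin2 in auto)
  then obtain l2 where l2: "linking G \<theta> \<tau>l m q L2 l2" ..
  define l where "l = (\<lambda>a. if a \<in> labels \<tau>l (fv p) L1 then l1 a else l2 a)"
  have 1: "linking G \<theta> \<tau>l m p L1 l"
    by (rule linking_cong[OF l1]) (simp add: l_def)
  have 2: "linking G \<theta> \<tau>l m q L2 l"
    by (rule linking_cong[OF l2]) (use lin2(3) in \<open>auto simp: l_def labels_seqa\<close>)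
  have lab: "labels \<tau>l (fv (Tup p q)) Cl = labels \<tau>l (fv p) L1 \<union> labels \<tau>l (fv q) L2"
    unfolding labels_def L(1) by auto
  have "linking G \<theta> \<tau>l m (Tup p q) Cl l"
    unfolding linking_def seq lab
  proof (intro conjI allI impI)
    fix l' w
    assume a: "\<forall>a \<in> labels \<tau>l (fv p) L1 \<union> labels \<tau>l (fv q) L2. l' a = l a"
      "\<forall>y \<in> fv (Tup p q). trav G l' (m y) (w y)"
    from a 1 obtain v1 where v1: "trav G l' (roots L1) v1"
      "mset v1 = seqa False \<tau>l (fv p) L1 + (\<Sum>x \<in> fv p. mset (w x))"
      unfolding linking_def by (auto; blast)
    from a 2 obtain v2 where v2: "trav G l' (roots L2) v2"
      "mset v2 = seqa False \<tau>l (fv q) L2 + (\<Sum>x \<in> fv q. mset (w x))"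
      unfolding linking_def by (auto; blast)
    have "(\<Sum>x \<in> fv (Tup p q). mset (w x)) = (\<Sum>x \<in> fv p. mset (w x)) + (\<Sum>x \<in> fv q. mset (w x))"
      using hy(3) by (simp add: sum.union_disjoint)
    then show "\<exists>v. trav G l' (roots Cl) v
        \<and> mset v = seqa False \<tau>l (fv p) L1 + seqa False \<tau>l (fv q) L2 + (\<Sum>x \<in> fv (Tup p q). mset (w x))"
      using trav_append[OF v1(1) v2(1)] v1(2) v2(2) by (intro exI[of _ "v1 @ v2"]) (simp add: L(1))
  qed (use 1 2 in \<open>auto simp: linking_def L(1)\<close>)
  then show ?case by blast
next
  case (cf_let u v X z s \<tau> A B C)
  note hy = cf_let.hyps cf_let.prems
  let ?s = "LetTup u v (Var z) s"
  from hy(10)[of z] hy(8) obtain L1 L2 where L: "\<tau>l z = L1 \<otimes> L2" "ren \<theta> L1 = A" "ren \<theta> L2 = B"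
    by (auto simp: ren_eq_simps)
  let ?\<tau> = "\<tau>l(u := L1, v := L2)"
  have seq: "seqa b ?\<tau> (fv s) Cl = seqa b \<tau>l (fv ?s) Cl" for b
    using seqa_let[of "fv s" u v z \<tau>l L1 L2, OF finite_fv hy(5,6,1,7) L(1)] by simp
  have lab: "labels ?\<tau> (fv s) Cl = labels \<tau>l (fv ?s) Cl"
    unfolding labels_seqa[OF finite_fv] seq ..
  \<comment> \<open>As in \<open>groups\<close>, what the arguments so far require is charged to the
    first component.\<close>
  have "\<exists>l. linking G \<theta> ?\<tau> (m(u := m z, v := [])) s Cl l"
  proof (rule cf_let.IH)
    show "groups G (?\<tau> x) ((m(u := m z, v := [])) x)" if "x \<in> fv s" for x
      using hy(12)[of x] hy(12)[of z] that L(1) hy(1) by auto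
    show "ren \<theta> (?\<tau> x) = (\<tau>(u := A, v := B)) x" if "x \<in> fv s" for x
      using hy(10)[of x] that L by auto
    show "count (seqa True ?\<tau> (fv s) Cl + seqa False ?\<tau> (fv s) Cl) a \<le> 1" for a
      unfolding seq by (rule hy(14))
  qed (use hy(11,13) in auto)
  then obtain l where l: "linking G \<theta> ?\<tau> (m(u := m z, v := [])) s Cl l" ..
  have "linking G \<theta> \<tau>l m ?s Cl l"
    unfolding linking_def
  proof (intro conjI allI impI)
    have "(\<lambda>y. ren l (?\<tau> y)) = (\<lambda>y. ren l (\<tau>l y))(u := ren l L1, v := ren l L2)" by auto
    then show "has_ty (\<lambda>y. ren l (\<tau>l y)) ?s (ren l Cl)"
      using l unfolding linking_def by (simp add: L(1) del: fun_upd_apply)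
    fix l' w
    assume a: "\<forall>a \<in> labels \<tau>l (fv ?s) Cl. l' a = l a" "\<forall>y \<in> fv ?s. trav G l' (m y) (w y)"
    let ?w = "w(u := w z, v := [])"
    have "\<forall>y \<in> fv s. trav G l' ((m(u := m z, v := [])) y) (?w y)"
      using a(2) by (auto intro: trav_nil)
    with l a(1) obtain vs where v: "trav G l' (roots Cl) vs"
      "mset vs = seqa False ?\<tau> (fv s) Cl + (\<Sum>y \<in> fv s. mset (?w y))"
      unfolding linking_def lab by blast
    have "(\<Sum>y \<in> fv s. mset (?w y)) = (\<Sum>y \<in> fv ?s. mset (w y))"
      unfolding sum_upd2[OF finite_fv hy(5,6,1)] using hy(7) by simp
    then show "\<exists>v. trav G l' (roots Cl) v
        \<and> mset v = seqa False \<tau>l (fv ?s) Cl + (\<Sum>x \<in> fv ?s. mset (w x))"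
      using v unfolding seq by auto
  qed (use l in \<open>auto simp: linking_def seq lab\<close>)
  then show ?case by blast
next
  case (cf_app x X h r t \<tau> A B C)
  note hy = cf_app.hyps cf_app.prems
  let ?s = "App (Fn x r) (App (Var h) t)"
  from hy(11)[of h] hy(8) obtain L1 L2 where L: "\<tau>l h = L1 \<rightarrow> L2" "ren \<theta> L1 = A" "ren \<theta> L2 = B"
    by (auto simp: ren_eq_simps)
  \<comment> \<open>\<open>x\<close> stands for \<open>h\<close> with one more argument, whose roots
    are required in addition to those of the earlier arguments.\<close>
  let ?\<tau> = "\<tau>l(x := L2)" and ?m = "m(x := m h @ roots L1)"
  have seq: "seqa b \<tau>l (fv ?s) Cl = seqa b \<tau>l (fv t) L1 + seqa b ?\<tau> (fv r) Cl" for b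
    using seqa_app[of "fv r" "fv t" x h \<tau>l L1 L2, OF finite_fv finite_fv hy(3,6,5,4,7) L(1)] by simp
  note lin2 = linear_pair[OF hy(15)[unfolded seq]]
  have gh: "goal_groups G L1" "groups G L2 (m h @ roots L1)"
    using hy(13)[of h] L(1) by auto
  have "\<exists>l. linking G \<theta> \<tau>l m t L1 l"
    by (rule cf_app.IH(1)[OF _ L(2) _ gh(1) lin2(1)]) (use hy in auto)
  then obtain l1 where l1: "linking G \<theta> \<tau>l m t L1 l1" ..
  have "\<exists>l. linking G \<theta> ?\<tau> ?m r Cl l"
    by (rule cf_app.IH(2)[OF _ hy(12) _ hy(14) lin2(2)]) (use hy L gh in auto)
  then obtain l2 where l2: "linking G \<theta> ?\<tau> ?m r Cl l2" ..
  define l where "l = (\<lambda>a. if a \<in> labels \<tau>l (fv t) L1 then l1 a else l2 a)"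
  have 1: "linking G \<theta> \<tau>l m t L1 l"
    by (rule linking_cong[OF l1]) (simp add: l_def)
  have 2: "linking G \<theta> ?\<tau> ?m r Cl l"
    by (rule linking_cong[OF l2]) (use lin2(3) in \<open>auto simp: l_def labels_seqa\<close>)
  have lab: "labels \<tau>l (fv ?s) Cl = labels \<tau>l (fv t) L1 \<union> labels ?\<tau> (fv r) Cl"
    unfolding labels_seqa[OF finite_fv] seq by auto
  have "linking G \<theta> \<tau>l m ?s Cl l"
    unfolding linking_def seq lab
  proof (intro conjI allI impI)
    have "(\<lambda>y. ren l (?\<tau> y)) = (\<lambda>y. ren l (\<tau>l y))(x := ren l L2)" by auto
    then show "has_ty (\<lambda>y. ren l (\<tau>l y)) ?s (ren l Cl)"
      using 1 2 unfolding linking_def by (auto simp: L(1) simp del: fun_upd_apply)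
    fix l' w
    assume a: "\<forall>a \<in> labels \<tau>l (fv t) L1 \<union> labels ?\<tau> (fv r) Cl. l' a = l a"
      "\<forall>y \<in> fv ?s. trav G l' (m y) (w y)"
    have "\<forall>a \<in> labels \<tau>l (fv t) L1. l' a = l a" "\<forall>y \<in> fv t. trav G l' (m y) (w y)"
      using a by auto
    with 1 obtain v1 where v1: "trav G l' (roots L1) v1"
      "mset v1 = seqa False \<tau>l (fv t) L1 + (\<Sum>x \<in> fv t. mset (w x))"
      unfolding linking_def by blast
    let ?w = "w(x := w h @ v1)"
    have "\<forall>y \<in> fv r. trav G l' (?m y) (?w y)"
      using a(2) v1(1) by (auto intro: trav_append)
    moreover have "\<forall>a \<in> labels ?\<tau> (fv r) Cl. l' a = l a"
      using a by blast
    ultimately obtain v2 where v2: "trav G l' (roots Cl) v2"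
      "mset v2 = seqa False ?\<tau> (fv r) Cl + (\<Sum>y \<in> fv r. mset (?w y))"
      using 2 unfolding linking_def by blast
    have "fv ?s = insert h ((fv r - {x}) \<union> fv t)" by auto
    moreover have "(fv r - {x}) \<inter> fv t = {}" using hy by auto
    ultimately have "(\<Sum>x \<in> fv ?s. mset (w x))
        = mset (w h) + (\<Sum>x \<in> fv r - {x}. mset (w x)) + (\<Sum>x \<in> fv t. mset (w x))"
      using hy(4,5) by (simp add: sum.union_disjoint)
    then show "\<exists>v. trav G l' (roots Cl) v
        \<and> mset v = seqa False \<tau>l (fv t) L1 + seqa False ?\<tau> (fv r) Cl + (\<Sum>x \<in> fv ?s. mset (w x))"
      using v2 v1(2) unfolding sum_upd[OF finite_fv hy(3)] by (intro exI[of _ v2]) simp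
  qed (use 1 2 in \<open>auto simp: linking_def\<close>)
  then show ?case by blast
qed

subsection \<open>Observing a linking\<close>

abbreviation idt :: trm where
  "idt \<equiv> Fn 0 (Var 0)"

text \<open>Every type variable is instantiated by a type of state transformers. \<open>obs c B\<close> turns an
  element of \<open>B\<close> into the composition of the transformers that it provides, \<open>dfl c B\<close> builds an
  element of \<open>B\<close> from a transformer that is run first; each use of the occurrence \<open>i\<close> of an
  assumption contributes the letter \<open>c i\<close>.\<close>

fun obs :: "(name \<Rightarrow> trm) \<Rightarrow> ty \<Rightarrow> trm" and dfl :: "(name \<Rightarrow> trm) \<Rightarrow> ty \<Rightarrow> trm" where
  "obs c (TVar j) = idt"
| "obs c (A \<otimes> B) = Fn 0 (LetTup 1 2 (Var 0)
    (Fn 3 (App (App (obs c B) (Var 2)) (App (App (obs c A) (Var 1)) (Var 3)))))"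
| "obs c (A \<rightarrow> B) = Fn 0 (App (obs c B) (App (Var 0) (App (dfl c A) idt)))"
| "dfl c (TVar i) = Fn 0 (Fn 1 (App (Var 0) (App (c i) (Var 1))))"
| "dfl c (A \<otimes> B) = Fn 0 (Tup (App (dfl c A) (Var 0)) (App (dfl c B) idt))"
| "dfl c (A \<rightarrow> B) = Fn 0 (Fn 1 (App (dfl c B)
    (Fn 2 (App (App (obs c A) (Var 1)) (App (Var 0) (Var 2))))))"

text \<open>Read \<open>st i\<close> and \<open>en i\<close> as the times at which the run of the
  letter \<open>i\<close> starts and ends. The runs that answer the listed occurrences have to
  follow one another without a gap.\<close>

fun chain :: "(name \<Rightarrow> nat) \<Rightarrow> (name \<Rightarrow> nat) \<Rightarrow> (name \<Rightarrow> name) \<Rightarrow> name list \<Rightarrow> nat \<Rightarrow> nat \<Rightarrow> bool" where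
  "chain st en l [] a b \<longleftrightarrow> a = b"
| "chain st en l (j # js) a b \<longleftrightarrow> st (l j) = a \<and> chain st en l js (en (l j)) b"

lemma chain_append:
  "chain st en l (js @ ks) a b \<longleftrightarrow> (\<exists>c. chain st en l js a c \<and> chain st en l ks c b)"
  by (induction js arbitrary: a) auto

lemma chain_det: "chain st en l js a b \<Longrightarrow> chain st en l js a b' \<Longrightarrow> b = b'"
  by (induction js arbitrary: a) auto

text \<open>The occurrence to which \<open>groups\<close> charges what has been collected so far,
  and the one at which \<open>dfl\<close> uses its transformer; for a tensor both take the first
  component.\<close>

fun head_atom :: "ty \<Rightarrow> name" where
  "head_atom (TVar i) = i"
| "head_atom (A \<otimes> B) = head_atom A"
| "head_atom (A \<rightarrow> B) = head_atom B"

lemma head_atom_atoms: "head_atom B \<in># atoms True B"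
  by (induction B) auto

lemma groups_prefix: "groups G B m \<Longrightarrow> \<exists>k. G (head_atom B) = m @ k"
  by (induction B arbitrary: m) fastforce+

section \<open>Positions in the word of letters as times\<close>

definition idx :: "'a list \<Rightarrow> 'a \<Rightarrow> nat" where
  "idx w i = length (takeWhile (\<lambda>x. x \<noteq> i) w)"

lemma idx_append: "i \<notin> set u \<Longrightarrow> idx (u @ i # z) i = length u"
proof -
  assume "i \<notin> set u"
  then have "takeWhile (\<lambda>x. x \<noteq> i) (u @ i # z) = u"
    by (subst takeWhile_append2) auto
  then show ?thesis by (simp add: idx_def)
qed

lemma idx_less: "i \<in> set w \<Longrightarrow> idx w i < length w"
  by (auto dest!: split_list_first simp: idx_append)

lemma nth_idx: "i \<in> set w \<Longrightarrow> w ! idx w i = i"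
  by (auto dest!: split_list_first simp: idx_append)

text \<open>In depth-first order, the traversal started by the visit of \<open>j\<close> is a
  contiguous block directly after it. Hence the run of a letter is an interval of time.\<close>

lemma trav_visit:
  "trav G l js v \<Longrightarrow> v = v1 @ j # v2 \<Longrightarrow> \<exists>v3 v4. v2 = v3 @ v4 \<and> trav G l (G (l j)) v3"
proof (induction arbitrary: v1 rule: trav.induct)
  case (trav_cons k js v)
  show ?case
  proof (cases v1)
    case Nil
    with trav_cons.prems have "j = k" "v2 = v" by auto
    with trav_split[OF trav_cons.hyps HOL.refl] show ?thesis by blast
  next
    case (Cons k' v1')
    with trav_cons show ?thesis by auto
  qed
qed auto

text \<open>One step for the letter itself and then the length of its block, which is unique by
  \<open>trav_det\<close>.\<close>

definition run_end :: "(name \<Rightarrow> name list) \<Rightarrow> (name \<Rightarrow> name) \<Rightarrow> name list \<Rightarrow> name \<Rightarrow> nat" where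
  "run_end G l w i = Suc (idx w i) + length (THE v. trav G l (G i) v)"

lemma run_end_eq: "trav G l (G i) v \<Longrightarrow> run_end G l w i = Suc (idx w i) + length v"
proof -
  assume v: "trav G l (G i) v"
  then have "(THE v. trav G l (G i) v) = v"
    using trav_det by blast
  then show ?thesis by (simp add: run_end_def)
qed

text \<open>The blocks of consecutive stack entries are adjacent in the word. The induction is on
  the length because \<open>trav_split\<close> cuts the tail into two shorter traversals.\<close>

lemma trav_chain:
  assumes "distinct w"
  shows "trav G l js v \<Longrightarrow> w = u @ map l v @ z \<Longrightarrow>
    chain (idx w) (run_end G l w) l js (length u) (length u + length v)"
proof (induction v arbitrary: js u z rule: length_induct)
  case (1 v)
  from 1(2) show ?case
  proof cases
    case trav_nil
    then show ?thesis by simp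
  next
    case (trav_cons j js0 v0)
    from trav_split[OF trav_cons(3) HOL.refl] obtain v1 v2 where
      v: "v0 = v1 @ v2" "trav G l (G (l j)) v1" "trav G l js0 v2" by blast
    have w: "w = u @ l j # (map l v1 @ map l v2 @ z)"
      using 1(3) trav_cons(2) v(1) by simp
    have "idx w (l j) = length u"
      unfolding w by (rule idx_append) (use assms w in auto)
    moreover from this have "run_end G l w (l j) = length (u @ l j # map l v1)"
      using run_end_eq[of G l "l j" v1 w] v(2) by simp
    moreover have "chain (idx w) (run_end G l w) l js0 (length (u @ l j # map l v1))
        (length (u @ l j # map l v1) + length v2)"
      by (rule 1(1)[rule_format, OF _ v(3), of _ z]) (use v(1) trav_cons(2) w in simp_all)
    ultimately show ?thesis
      using trav_cons v(1) by (simp add: add.assoc)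
  qed
qed

lemma trav_chain_groups:
  assumes "distinct (map l v)" "trav G l js v" "i \<in> set (map l v)"
  shows "chain (idx (map l v)) (run_end G l (map l v)) l (G i) (Suc (idx (map l v) i)) (run_end G l (map l v) i)"
proof -
  let ?w = "map l v"
  from assms(3) obtain j where j: "j \<in> set v" "i = l j" by auto
  then obtain v1 v2 where v: "v = v1 @ j # v2"
    using split_list by fastforce
  from trav_visit[OF assms(2) v] obtain v3 v4 where v3: "v2 = v3 @ v4" "trav G l (G i) v3"
    using j(2) by blast
  have w: "?w = map l v1 @ i # map l v2"
    using v j by simp
  have "idx ?w i = length v1"
    unfolding w using idx_append[of i "map l v1"] assms(1) unfolding w by simp
  moreover have "?w = (map l v1 @ [i]) @ map l v3 @ map l v4"
    using w v3(1) by simp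
  from trav_chain[OF assms(1) v3(2) this]
  have "chain (idx ?w) (run_end G l ?w) l (G i) (Suc (length v1)) (Suc (length v1) + length v3)"
    by simp
  ultimately show ?thesis
    using run_end_eq[OF v3(2), of ?w] by simp
qed

lemma fv_obs:
  assumes "\<And>i. fv (c i) \<inter> {0, 1, 2, 3} = {}"
  shows "fv (dfl c B) = (\<Union>i \<in> set_mset (atoms True B). fv (c i))"
    "fv (obs c B) = (\<Union>i \<in> set_mset (atoms False B). fv (c i))"
proof (induction B)
  case (TVar i)
  case 1
  show ?case using assms[of i] by auto
next
  case (Tensor A B)
  have "0 \<notin> fv (c i)" "Suc 0 \<notin> fv (c i)" "2 \<notin> fv (c i)" "3 \<notin> fv (c i)" for i
    using assms[of i] by auto
  note f = this
  {
    case 1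
    show ?case using Tensor.IH f by auto
  next
    case 2
    show ?case using Tensor.IH f by auto
  }
next
  case (Lolli A B)
  have "0 \<notin> fv (c i)" "Suc 0 \<notin> fv (c i)" "2 \<notin> fv (c i)" "3 \<notin> fv (c i)" for i
    using assms[of i] by auto
  note f = this
  {
    case 1
    show ?case using Lolli.IH f by auto
  next
    case 2
    show ?case using Lolli.IH f by auto
  }
qed auto

lemma fresh_obs:
  assumes "\<And>i. fv (c i) \<inter> {0, 1, 2, 3} = {}" "x \<in> {0, 1, 2, 3}"
  shows "x \<notin> fv (dfl c B)" "x \<notin> fv (obs c B)"
  unfolding fv_obs[OF assms(1)] using assms by blast+

text \<open>The letter \<open>i\<close> takes the state from type \<open>T (st i)\<close> to type \<open>T (mid i)\<close>, and the letters of
  the run that it starts take it further to \<open>T (en i)\<close>.\<close>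

lemma has_ty_obs:
  fixes st mid en :: "name \<Rightarrow> nat" and l :: "name \<Rightarrow> name" and T :: "nat \<Rightarrow> ty"
    and G :: "name \<Rightarrow> name list" and c :: "name \<Rightarrow> trm" and \<tau> :: "name \<Rightarrow> ty"
  assumes fresh: "\<And>i. fv (c i) \<inter> {0, 1, 2, 3} = {}"
  defines "\<rho> \<equiv> \<lambda>a. T (st (l a)) \<rightarrow> T (en (l a))"
    and "ok \<equiv> \<lambda>i. l i = i \<and> chain st en l (G i) (mid i) (en i) \<and> has_ty \<tau> (c i) (T (st i) \<rightarrow> T (mid i))"
  shows "groups G B m \<Longrightarrow> (\<And>i. i \<in># atoms True B \<Longrightarrow> ok i) \<Longrightarrow> chain st en l m (mid (head_atom B)) b \<Longrightarrow>
      has_ty \<tau> (dfl c B) ((T (mid (head_atom B)) \<rightarrow> T b) \<rightarrow> tsubst \<rho> B)"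
    "goal_groups G B \<Longrightarrow> (\<And>i. i \<in># atoms False B \<Longrightarrow> ok i) \<Longrightarrow> chain st en l (roots B) a b \<Longrightarrow>
      has_ty \<tau> (obs c B) (tsubst \<rho> B \<rightarrow> (T a \<rightarrow> T b))"
proof (induction B arbitrary: m a b)
  case (TVar i)
  {
    case 1
    have "0 \<notin> fv (c i)" "Suc 0 \<notin> fv (c i)"
      using fresh[of i] by auto
    moreover from 1(2)[of i] have "ok i" by simp
    moreover from this have "b = en i"
      using 1(1,3) chain_det[of st en l m "mid i" b "en i"] by (simp add: ok_def)
    ultimately show ?case
      by (auto simp: has_ty_upd_fresh ok_def \<rho>_def)
  next
    case 2
    then show ?case by (simp add: \<rho>_def)
  }
next
  case (Tensor A B)
  have upd: "has_ty (\<tau>'(x := C)) (dfl c D) E \<longleftrightarrow> has_ty \<tau>' (dfl c D) E"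
    "has_ty (\<tau>'(x := C)) (obs c D) E \<longleftrightarrow> has_ty \<tau>' (obs c D) E" if "x \<in> {0, 1, 2, 3}" for \<tau>' x C D E
    using fresh_obs[OF fresh that] by (simp_all add: has_ty_upd_fresh)
  {
    case 1
    have "has_ty \<tau> (dfl c A) ((T (mid (head_atom A)) \<rightarrow> T b) \<rightarrow> tsubst \<rho> A)"
      by (rule Tensor.IH(1)) (use 1 in auto)
    \<comment> \<open>The second component starts from \<open>idt\<close>, which takes no time;
      hence the empty list and equal end points.\<close>
    moreover have "has_ty \<tau> (dfl c B) ((T (mid (head_atom B)) \<rightarrow> T (mid (head_atom B))) \<rightarrow> tsubst \<rho> B)"
      by (rule Tensor.IH(3)[where m = "[]"]) (use 1 in auto)
    ultimately show ?case by (auto simp: upd)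
  next
    case 2
    then obtain d where d: "chain st en l (roots A) a d" "chain st en l (roots B) d b"
      by (auto simp: chain_append)
    have "has_ty \<tau> (obs c A) (tsubst \<rho> A \<rightarrow> (T a \<rightarrow> T d))"
      by (rule Tensor.IH(2)[OF _ _ d(1)]) (use 2 in auto)
    moreover have "has_ty \<tau> (obs c B) (tsubst \<rho> B \<rightarrow> (T d \<rightarrow> T b))"
      by (rule Tensor.IH(4)[OF _ _ d(2)]) (use 2 in auto)
    ultimately show ?case by (auto simp: upd)
  }
next
  case (Lolli A B)
  have upd: "has_ty (\<tau>'(x := C)) (dfl c D) E \<longleftrightarrow> has_ty \<tau>' (dfl c D) E"
    "has_ty (\<tau>'(x := C)) (obs c D) E \<longleftrightarrow> has_ty \<tau>' (obs c D) E" if "x \<in> {0, 1, 2, 3}" for \<tau>' x C D E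
    using fresh_obs[OF fresh that] by (simp_all add: has_ty_upd_fresh)
  {
    case 1
    let ?h = "head_atom B"
    have g: "goal_groups G A" "groups G B (m @ roots A)"
      using 1 by auto
    \<comment> \<open>The argument is observed from time \<open>b\<close> to a time \<open>d\<close>
      that has to be found. The run of the head passes through it, since the group of the head
      begins with \<open>m @ roots A\<close>.\<close>
    then obtain k where "G ?h = (m @ roots A) @ k"
      using groups_prefix by blast
    moreover have "ok ?h"
      using 1(2) head_atom_atoms by simp
    ultimately obtain d' d where d: "chain st en l m (mid ?h) d'" "chain st en l (roots A) d' d"
      by (auto simp: ok_def chain_append)
    have "chain st en l m (mid ?h) b"
      using 1(3) by simp
    then have d': "d' = b"
      by (rule chain_det[OF d(1)])
    then have md: "chain st en l (m @ roots A) (mid ?h) d"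
      using d by (auto simp: chain_append)
    have "has_ty \<tau> (obs c A) (tsubst \<rho> A \<rightarrow> (T b \<rightarrow> T d))"
      by (rule Lolli.IH(2)[OF g(1)]) (use 1(2) d d' in auto)
    moreover have "has_ty \<tau> (dfl c B) ((T (mid ?h) \<rightarrow> T d) \<rightarrow> tsubst \<rho> B)"
      by (rule Lolli.IH(3)[OF g(2) _ md]) (use 1(2) in auto)
    ultimately show ?case by (auto simp: upd)
  next
    case 2
    have "has_ty \<tau> (dfl c A) ((T (mid (head_atom A)) \<rightarrow> T (mid (head_atom A))) \<rightarrow> tsubst \<rho> A)"
      by (rule Lolli.IH(1)[where m = "[]"]) (use 2 in auto)
    moreover have "has_ty \<tau> (obs c B) (tsubst \<rho> B \<rightarrow> (T a \<rightarrow> T b))"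
      by (rule Lolli.IH(4)) (use 2 in auto)
    ultimately show ?case by (auto simp: upd)
  }
qed

section \<open>Types whose occurrences carry distinct labels\<close>

definition labelled :: "ty \<Rightarrow> bool" where
  "labelled B \<longleftrightarrow> (\<forall>a. count (atoms True B + atoms False B) a \<le> 1)"

lemma labelled_split:
  assumes "labelled (A \<otimes> B) \<or> labelled (A \<rightarrow> B)"
  shows "labelled A" "labelled B" "tv A \<inter> tv B = {}"
proof -
  have "count (atoms True A + atoms True B + (atoms False A + atoms False B)) a \<le> 1
      \<or> count (atoms False A + atoms True B + (atoms True A + atoms False B)) a \<le> 1" for a
    using assms by (auto simp: labelled_def)
  then have "count (atoms True A + atoms True B + (atoms False A + atoms False B)) a \<le> 1" for a
    by (simp add: ac_simps)
  note lin2 = linear_pair[OF this]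
  show "labelled A" "labelled B"
    unfolding labelled_def using lin2(1,2) by blast+
  show "tv A \<inter> tv B = {}"
    using lin2(3) unfolding tv_atoms[of _ True] by simp
qed

lemma UN_disjoint_family:
  assumes "\<And>i j. i \<noteq> j \<Longrightarrow> F i \<inter> F j = {}" "A \<inter> B = {}"
  shows "(\<Union>i \<in> A. F i) \<inter> (\<Union>i \<in> B. F i) = {}"
proof -
  have "F i \<inter> F j = {}" if "i \<in> A" "j \<in> B" for i j
    by (rule assms(1)) (use that assms(2) in auto)
  then show ?thesis
    by (simp add: Int_UN_distrib2)
qed

text \<open>The letters may be open terms; distinct labels ensure that none of them is used at two
  places.\<close>

lemma lin_obs:
  assumes "\<And>i. lin (c i)" "\<And>i. fv (c i) \<inter> {0, 1, 2, 3} = {}"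
    "\<And>i j. i \<noteq> j \<Longrightarrow> fv (c i) \<inter> fv (c j) = {}"
  shows "labelled B \<Longrightarrow> lin (dfl c B) \<and> lin (obs c B)"
proof (induction B)
  case (TVar i)
  show ?case using assms(1,2)[of i] by auto
next
  case (Tensor A B)
  note l = labelled_split[of A B, OF disjI1[OF Tensor.prems]]
  note fr = fresh_obs[of c, OF assms(2)]
  have "fv (dfl c A) \<inter> fv (dfl c B) = {}" "fv (obs c A) \<inter> fv (obs c B) = {}"
    unfolding fv_obs[OF assms(2)] using l(3)
    by (intro UN_disjoint_family assms(3); auto simp: tv_atoms[of _ True])+
  then show ?case
    using Tensor.IH l fr[of 0] fr[of 1] fr[of 2] fr[of 3] by auto
next
  case (Lolli A B)
  note l = labelled_split[of A B, OF disjI2[OF Lolli.prems]]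
  note fr = fresh_obs[of c, OF assms(2)]
  have "fv (obs c A) \<inter> fv (dfl c B) = {}" "fv (dfl c A) \<inter> fv (obs c B) = {}"
    unfolding fv_obs[OF assms(2)] using l(3)
    by (intro UN_disjoint_family assms(3); auto simp: tv_atoms[of _ True])+
  then show ?case
    using Lolli.IH l fr[of 0] fr[of 1] fr[of 2] fr[of 3] by auto
qed

lemma merge_groups:
  fixes P Q :: "(name \<Rightarrow> name list) \<Rightarrow> bool"
  assumes "\<And>G G'. (\<And>i. i \<in> tv A \<Longrightarrow> G i = G' i) \<Longrightarrow> P G \<longleftrightarrow> P G'"
    "\<And>G G'. (\<And>i. i \<in> tv B \<Longrightarrow> G i = G' i) \<Longrightarrow> Q G \<longleftrightarrow> Q G'"
    "tv A \<inter> tv B = {}" "\<exists>G. P G" "\<exists>G. Q G"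
  shows "\<exists>G. P G \<and> Q G"
proof -
  obtain G1 G2 where *: "P G1" "Q G2"
    using assms(4,5) by blast
  let ?G = "\<lambda>i. if i \<in> tv A then G1 i else G2 i"
  have "P ?G"
    using * assms(1)[of ?G G1] by simp
  moreover have "i \<in> tv B \<Longrightarrow> ?G i = G2 i" for i
    using assms(3) by auto
  then have "Q ?G"
    using * assms(2)[of ?G G2] by blast
  ultimately show ?thesis by blast
qed

text \<open>The clauses of \<open>groups\<close> for the two parts of a type constrain
  \<open>G\<close> at disjoint sets of labels, so they cannot conflict.\<close>

lemma ex_groups:
  "labelled B \<Longrightarrow> \<exists>G. groups G B m"
  "labelled B \<Longrightarrow> \<exists>G. goal_groups G B"
proof (induction B arbitrary: m)
  case (TVar i)
  {
    case 1
    show ?case by (intro exI[of _ "\<lambda>_. m"]) simp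
  next
    case 2
    show ?case by simp
  }
next
  case (Tensor A B)
  {
    case 1
    note l = labelled_split[of A B, OF disjI1[OF 1]]
    show ?case
      unfolding groups.simps
      by (rule merge_groups[OF groups_cong(1) groups_cong(1) l(3) Tensor.IH(1)[OF l(1)] Tensor.IH(3)[OF l(2)]])
  next
    case 2
    note l = labelled_split[of A B, OF disjI1[OF 2]]
    show ?case
      unfolding goal_groups.simps
      by (rule merge_groups[OF groups_cong(2) groups_cong(2) l(3) Tensor.IH(2)[OF l(1)] Tensor.IH(4)[OF l(2)]])
  }
next
  case (Lolli A B)
  {
    case 1
    note l = labelled_split[of A B, OF disjI2[OF 1]]
    show ?case
      unfolding groups.simps
      by (rule merge_groups[OF groups_cong(2) groups_cong(1) l(3) Lolli.IH(2)[OF l(1)] Lolli.IH(3)[OF l(2)]])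
  next
    case 2
    note l = labelled_split[of A B, OF disjI2[OF 2]]
    show ?case
      unfolding goal_groups.simps
      by (rule merge_groups[OF groups_cong(1) groups_cong(2) l(3) Lolli.IH(1)[OF l(1)] Lolli.IH(4)[OF l(2)]])
  }
qed

lemma atoms_ren: "atoms b (ren f A) = image_mset f (atoms b A)"
  by (induction A arbitrary: b) auto

lemma count_image_inj: "inj f \<Longrightarrow> count (image_mset f M) (f a) = count M a"
  by (induction M) (auto dest: injD)

lemma count_even_odd:
  assumes "\<And>a. count M a \<le> 1" "\<And>a. count N a \<le> 1"
  shows "count (image_mset (\<lambda>n :: nat. 2 * n) M + image_mset (\<lambda>n. 2 * n + 1) N) a \<le> 1"
proof -
  have inj: "inj (\<lambda>n :: nat. 2 * n)" "inj (\<lambda>n :: nat. 2 * n + 1)"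
    by (auto simp: inj_def)
  have z: "a \<notin> range f \<Longrightarrow> count (image_mset f K) a = 0" for f :: "nat \<Rightarrow> nat" and K
    by (auto simp: count_eq_zero_iff)
  show ?thesis
  proof (cases "even a")
    case True
    then obtain k where k: "a = 2 * k" by blast
    have "a \<notin> range (\<lambda>n :: nat. 2 * n + 1)"
      using True by auto
    then have "count (image_mset (\<lambda>n. 2 * n + 1) N) a = 0"
      by (rule z)
    then show ?thesis
      using count_image_inj[OF inj(1), of M k] assms(1)[of k] k by simp
  next
    case False
    then obtain k where k: "a = 2 * k + 1" using oddE by blast
    have "a \<notin> range (\<lambda>n :: nat. 2 * n)"
      using False by auto
    then have "count (image_mset (\<lambda>n. 2 * n) M) a = 0"
      by (rule z)
    then show ?thesis
      using count_image_inj[OF inj(2), of N k] assms(2)[of k] k by simp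
  qed
qed

lemma ex_labelled: "\<exists>L f. labelled L \<and> ren f L = A"
proof -
  have combine: "\<exists>L1 L2 f. labelled (L1 \<otimes> L2) \<and> labelled (L1 \<rightarrow> L2) \<and> ren f L1 = A \<and> ren f L2 = B"
    if IH: "\<exists>L f. labelled L \<and> ren f L = A" "\<exists>L f. labelled L \<and> ren f L = B" for A B
  proof -
    obtain L1 f1 L2 f2 where *: "labelled L1" "ren f1 L1 = A" "labelled L2" "ren f2 L2 = B"
      using IH by blast
    \<comment> \<open>Even and odd labels keep the two parts apart, and the parity tells which of
      the two labellings has to be undone.\<close>
    let ?L1 = "ren (\<lambda>n. 2 * n) L1" and ?L2 = "ren (\<lambda>n. 2 * n + 1) L2"
    let ?f = "\<lambda>n :: nat. if even n then f1 (n div 2) else f2 (n div 2)"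
    have "labelled (?L1 \<otimes> ?L2)" "labelled (?L1 \<rightarrow> ?L2)"
      using count_even_odd[of "atoms True L1 + atoms False L1" "atoms True L2 + atoms False L2"] *(1,3)
      by (simp_all add: labelled_def atoms_ren ac_simps)
    moreover have "ren ?f ?L1 = A" "ren ?f ?L2 = B"
      using * by (simp_all add: tsubst_tsubst)
    ultimately show ?thesis
      by (intro exI[of _ ?L1] exI[of _ ?L2] exI[of _ ?f] conjI)
  qed
  show ?thesis
  proof (induction A)
    case (TVar a)
    show ?case by (intro exI[of _ "TVar a"] exI[of _ id]) (simp add: labelled_def)
  next
    case (Tensor A B)
    from combine[OF this] show ?case by (metis tsubst.simps(2))
  next
    case (Lolli A B)
    from combine[OF this] show ?case by (metis tsubst.simps(3))
  qed
qed

text \<open>The letters at the first place of difference form the pair: each occurs later in the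
  word in which the other one comes first.\<close>

lemma ex_transposed:
  assumes "distinct w1" "distinct w2" "set w1 = set w2" "w1 \<noteq> w2"
  shows "\<exists>a b. a \<in> set w1 \<and> b \<in> set w1 \<and> idx w1 a < idx w1 b \<and> idx w2 b < idx w2 a"
proof -
  have len: "length w1 = length w2"
    using assms by (metis distinct_card)
  then obtain p a x b y where w: "w1 = p @ a # x" "w2 = p @ b # y" "a \<noteq> b"
    using same_length_different[OF assms(4)] by (auto simp: len)
  have b: "b \<in> set x" and a: "a \<in> set y"
    using assms w by auto
  obtain x1 x2 where x: "x = x1 @ b # x2" using split_list[OF b] by blast
  obtain y1 y2 where y: "y = y1 @ a # y2" using split_list[OF a] by blast
  have "idx w1 a = length p" "idx w2 b = length p"
    using assms(1,2) w by (auto intro: idx_append)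
  moreover have "idx w1 b = length (p @ a # x1)"
    using idx_append[of b "p @ a # x1" x2] assms(1) w(1) x by auto
  moreover have "idx w2 a = length (p @ b # y1)"
    using idx_append[of a "p @ b # y1" y2] assms(2) w(2) y by auto
  moreover have "a \<in> set w1" "b \<in> set w1"
    using w b by auto
  ultimately show ?thesis
    by (intro exI[of _ a] exI[of _ b]) simp
qed

lemma observe:
  assumes "goal_groups G L" "trav G l (roots L) v" "distinct (map l v)"
    "set (map l v) = set_mset (atoms False L)" "\<And>i. i \<in># atoms False L \<Longrightarrow> l i = i"
    "\<And>i. fv (c i) \<inter> {0, 1, 2, 3} = {}"
    "a \<in> set (map l v)" "b \<in> set (map l v)" "idx (map l v) a < idx (map l v) b"
    "has_ty \<tau> (c a) (P \<rightarrow> Q)" "has_ty \<tau> (c b) (Q \<rightarrow> R)"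
    "\<And>i. i \<noteq> a \<Longrightarrow> i \<noteq> b \<Longrightarrow> c i = idt"
  shows "\<exists>\<theta>. has_ty \<tau> (obs c L) (tsubst \<theta> (ren l L) \<rightarrow> (P \<rightarrow> R))"
proof -
  let ?w = "map l v"
  \<comment> \<open>The state has type \<open>P\<close> until the letter \<open>a\<close>, then
    \<open>Q\<close> until \<open>b\<close>, then \<open>R\<close>. The letter at position
    \<open>k\<close> acts between the times \<open>k\<close> and \<open>k + 1\<close>, hence the
    non-strict comparisons; every other letter meets the same type before and after.\<close>
  define T where "T = (\<lambda>k. if k \<le> idx ?w a then P else if k \<le> idx ?w b then Q else R)"
  define en where "en = run_end G l ?w"
  have root: "chain (idx ?w) en l (roots L) 0 (length v)"
    using trav_chain[OF assms(3,2), of "[]" "[]"] by (simp add: en_def)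
  have run: "chain (idx ?w) en l (G i) (Suc (idx ?w i)) (en i)" if "i \<in># atoms False L" for i
    unfolding en_def by (rule trav_chain_groups[OF assms(3,2)]) (use that assms(4) in simp)
  have letter: "has_ty \<tau> (c i) (T (idx ?w i) \<rightarrow> T (Suc (idx ?w i)))" if "i \<in># atoms False L" for i
  proof -
    consider "i = a" | "i = b" | "i \<noteq> a" "i \<noteq> b" by blast
    then show ?thesis
    proof cases
      case 3
      have "i \<in> set ?w" using that assms(4) by simp
      then have "idx ?w i \<noteq> idx ?w a" "idx ?w i \<noteq> idx ?w b"
        using nth_idx[of i ?w] nth_idx[of a ?w] nth_idx[of b ?w] assms(7,8) 3 by metis+
      then have "T (Suc (idx ?w i)) = T (idx ?w i)"
        by (auto simp: T_def)
      then show ?thesis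
        using 3 assms(12) by simp
    qed (use assms(9-11) in \<open>simp_all add: T_def\<close>)
  qed
  have "has_ty \<tau> (obs c L) (tsubst (\<lambda>x. T (idx ?w (l x)) \<rightarrow> T (en (l x))) L \<rightarrow> (T 0 \<rightarrow> T (length v)))"
    by (rule has_ty_obs(2)[OF assms(6,1) _ root]) (use letter run assms(5) in auto)
  moreover have "T 0 = P" "T (length v) = R"
    using idx_less[OF assms(8)] assms(9) by (auto simp: T_def)
  moreover have "tsubst (\<lambda>x. T (idx ?w (l x)) \<rightarrow> T (en (l x))) L
      = tsubst (\<lambda>x. T (idx ?w x) \<rightarrow> T (en x)) (ren l L)"
    by (simp add: tsubst_tsubst)
  ultimately show ?thesis by metis
qed

lemma closed_wt:
  assumes "[] \<turnstile> t \<^bold>: A"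
  shows "fv t = {}" "lin t" "has_ty \<tau> t A" "wt \<tau> t A"
  using assms closed_typing_iff[of t A \<tau>] by (auto simp: wt_def)

lemma closed_typingI: "fv t = {} \<Longrightarrow> lin t \<Longrightarrow> has_ty \<tau> t A \<Longrightarrow> [] \<turnstile> t \<^bold>: A"
  using closed_typing_iff[of t A \<tau>] by (auto simp: wt_def)

lemma subst_closed: "fv t = {} \<Longrightarrow> subst \<sigma> t = t"
  by (rule subst_ident) simp

lemma closed_tsubst: "[] \<turnstile> t \<^bold>: A \<Longrightarrow> [] \<turnstile> t \<^bold>: tsubst \<theta> A"
  using typing_tsubst[of "[]"] by simp

lemma closed_eq_tsubst: "[] \<turnstile> t \<doteq> s \<^bold>: A \<Longrightarrow> [] \<turnstile> t \<doteq> s \<^bold>: tsubst \<theta> A"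
  using equality_tsubst[of "[]"] by simp

lemma closed_App: "[] \<turnstile> t \<^bold>: A \<rightarrow> B \<Longrightarrow> [] \<turnstile> s \<^bold>: A \<Longrightarrow> [] \<turnstile> App t s \<^bold>: B"
  using typing.app[of "[]" t A B "[]" s] by simp

lemma closed_AppE:
  assumes "[] \<turnstile> App t s \<^bold>: B"
  obtains A where "[] \<turnstile> t \<^bold>: A \<rightarrow> B" "[] \<turnstile> s \<^bold>: A"
  using assms closed_typing_iff[of _ _ TVar] by (auto simp: wt_simps)

lemma closed_eq_App:
  "[] \<turnstile> t \<doteq> t' \<^bold>: A \<rightarrow> B \<Longrightarrow> [] \<turnstile> s \<doteq> s' \<^bold>: A \<Longrightarrow> [] \<turnstile> App t s \<doteq> App t' s' \<^bold>: B"
  using equality.cong_app[of "[]" t t' A B "[]" s s'] by simp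

lemma closed_beta:
  assumes "[] \<turnstile> App (Fn x t) u \<^bold>: C"
  shows "[] \<turnstile> App (Fn x t) u \<doteq> subst (Var(x := u)) t \<^bold>: C"
proof -
  have "wt TVar (App (Fn x t) u) C" "fv (App (Fn x t) u) = {}"
    using closed_wt[OF assms] by auto
  then show ?thesis
    using red_eqt[OF red_beta_Fn[of TVar x t u C]] eqt_closed_iff[of _ _ C TVar] by auto
qed

lemma closed_coherence:
  assumes "[] \<turnstile> s \<^bold>: C" "[] \<turnstile> s' \<^bold>: C" "\<And>a. count (atoms False C) a \<le> 1"
  shows "[] \<turnstile> s \<doteq> s' \<^bold>: C"
proof -
  have "eqt TVar s s' C"
    by (rule coherence) (use assms closed_wt in \<open>auto simp: seqa_def\<close>)
  then show ?thesis
    using closed_wt(1)[OF assms(1)] eqt_closed_iff[of s s' C TVar] by simp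
qed

lemma closed_linking:
  assumes "[] \<turnstile> s \<^bold>: ren f L" "labelled L" "goal_groups G L"
  shows "\<exists>l v. [] \<turnstile> s \<^bold>: ren l L \<and> trav G l (roots L) v \<and> mset v = atoms True L
    \<and> image_mset l (atoms True L) = atoms False L \<and> (\<forall>a \<in># atoms False L. l a = a)
    \<and> (\<forall>a \<in> tv L. f (l a) = f a)"
proof -
  have fv: "fv s = {}" using closed_wt[OF assms(1)] by simp
  obtain s0 where s0: "red TVar s s0 (ren f L)" "cf {} TVar s0 (ren f L)"
    using red_cf[OF closed_wt(4)[OF assms(1)], of "{}"] fv by auto
  have fv0: "fv s0 = {}" using red_fv[OF s0(1)] fv by simp
  have "\<exists>l. linking G f TVar (\<lambda>_. []) s0 L l"
    by (rule cf_linking[OF s0(2)]) (use fv0 assms(2,3) in \<open>auto simp: seqa_def labelled_def add.commute\<close>)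
  then obtain l where l: "linking G f TVar (\<lambda>_. []) s0 L l" ..
  then have l': "has_ty (\<lambda>x. ren l (TVar x)) s0 (ren l L)" "\<forall>a \<in># atoms False L. l a = a"
    "image_mset l (atoms True L) = atoms False L" "\<forall>a \<in> tv L. f (l a) = f a"
    "\<exists>v. trav G l (roots L) v \<and> mset v = atoms True L"
    unfolding linking_def by (auto simp: fv0 seqa_def labels_def)
  \<comment> \<open>The typing was found for the cut-free form \<open>s0\<close>; since
    \<open>red\<close> reflects typings, it also holds for \<open>s\<close> itself.\<close>
  have "[] \<turnstile> s \<^bold>: ren l L"
    by (rule closed_typingI[OF fv _ red_has_ty[OF s0(1) l'(1)]]) (use closed_wt[OF assms(1)] in auto)
  with l' show ?thesis by blast
qed

section \<open>Separating the two closed terms by types\<close>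

lemma distinct_mset_count: "(\<And>a. count (mset w) a \<le> 1) \<Longrightarrow> distinct w"
proof -
  assume *: "\<And>a. count (mset w) a \<le> 1"
  have "count (mset w) a = (if a \<in> set w then 1 else 0)" for a
    using *[of a] count_greater_zero_iff[of "mset w" a] by (auto simp: le_Suc_eq simp del: count_greater_zero_iff)
  then show ?thesis
    by (simp add: distinct_count_atmost_1)
qed

text \<open>Every type variable occurs once in each polarity of \<open>ty1\<close> and of
  \<open>ty2\<close>, so coherence leaves one closed term up to equality: with \<open>ty1\<close>
  the first argument is run before the second, with \<open>ty2\<close> after it.\<close>

abbreviation ty1 :: ty where
  "ty1 \<equiv> (TVar 0 \<rightarrow> TVar 1) \<rightarrow> (TVar 1 \<rightarrow> TVar 2) \<rightarrow> (TVar 0 \<rightarrow> TVar 2)"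

abbreviation ty2 :: ty where
  "ty2 \<equiv> (TVar 1 \<rightarrow> TVar 2) \<rightarrow> (TVar 0 \<rightarrow> TVar 1) \<rightarrow> (TVar 0 \<rightarrow> TVar 2)"

text \<open>\<open>K\<close> is a single term used at two typings: its state types, and with them
  the type of its argument, depend on which of the letters \<open>a\<close> and \<open>b\<close> is
  met first.\<close>

lemma separate:
  assumes "[] \<turnstile> s1 \<^bold>: A" "[] \<turnstile> s2 \<^bold>: A" "\<not> [] \<turnstile> s1 \<doteq> s2 \<^bold>: A"
  shows "\<exists>K. [] \<turnstile> App K s1 \<^bold>: ty1 \<and> [] \<turnstile> App K s2 \<^bold>: ty2"
proof -
  obtain L f where L: "labelled L" "ren f L = A"
    using ex_labelled by blast
  obtain G where G: "goal_groups G L"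
    using ex_groups(2)[OF L(1)] by blast
  obtain l1 v1 where 1: "[] \<turnstile> s1 \<^bold>: ren l1 L" "trav G l1 (roots L) v1" "mset v1 = atoms True L"
    "image_mset l1 (atoms True L) = atoms False L" "\<forall>a \<in># atoms False L. l1 a = a"
    "\<forall>a \<in> tv L. f (l1 a) = f a"
    using closed_linking[of s1 f L G] assms(1) L G by auto
  obtain l2 v2 where 2: "[] \<turnstile> s2 \<^bold>: ren l2 L" "trav G l2 (roots L) v2" "mset v2 = atoms True L"
    "image_mset l2 (atoms True L) = atoms False L" "\<forall>a \<in># atoms False L. l2 a = a"
    "\<forall>a \<in> tv L. f (l2 a) = f a"
    using closed_linking[of s2 f L G] assms(2) L G by auto
  have m: "mset (map l1 v1) = atoms False L" "mset (map l2 v2) = atoms False L"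
    using 1(3,4) 2(3,4) by simp_all
  have cnt: "count (atoms False L) a \<le> 1" for a
    using L(1) unfolding labelled_def by (simp add: add_leE[of "count (atoms True L) a"]) (metis add_leD2)
  have d: "distinct (map l1 v1)" "distinct (map l2 v2)"
    by (rule distinct_mset_count; use cnt m in simp)+
  have set: "set (map l1 v1) = set_mset (atoms False L)" "set (map l2 v2) = set_mset (atoms False L)"
    using m by (metis set_mset_mset)+
  have ne: "map l1 v1 \<noteq> map l2 v2"
  proof
    assume eq: "map l1 v1 = map l2 v2"
    from trav_decode[OF 1(2) 2(2) eq] have v: "v2 = v1" by simp
    have "l1 a = l2 a" if "a \<in># atoms True L" for a
    proof -
      have "a \<in> set v1" using that 1(3) by (metis set_mset_mset)
      then show ?thesis using eq v by simp
    qed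
    then have "ren l2 L = ren l1 L"
      using 1(5) 2(5) by (intro tsubst_cong) (auto simp: tv_atoms[of _ True])
    \<comment> \<open>Equal linkings give both terms the type \<open>ren l1 L\<close>. There the
      required labels are still distinct, so coherence applies, which it need not do at
      \<open>A\<close>.\<close>
    then have "[] \<turnstile> s1 \<doteq> s2 \<^bold>: ren l1 L"
    proof (intro closed_coherence)
      have "atoms False (ren l1 L) = image_mset id (atoms False L)"
        unfolding atoms_ren using 1(5) by (intro image_mset_cong) auto
      then show "count (atoms False (ren l1 L)) a \<le> 1" for a
        using cnt by simp
    qed (use 1 2 in auto)
    from closed_eq_tsubst[OF this, of "\<lambda>a. TVar (f a)"]
    have "[] \<turnstile> s1 \<doteq> s2 \<^bold>: ren f (ren l1 L)" .
    moreover have "ren f (ren l1 L) = ren f L"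
      unfolding tsubst_tsubst using 1(6) by (intro tsubst_cong) auto
    ultimately show False
      using assms(3) L(2) by simp
  qed
  obtain a b where ab: "a \<in> set (map l1 v1)" "b \<in> set (map l1 v1)"
    "idx (map l1 v1) a < idx (map l1 v1) b" "idx (map l2 v2) b < idx (map l2 v2) a"
    using ex_transposed[OF d _ ne] set by blast
  then have ab2: "a \<in> set (map l2 v2)" "b \<in> set (map l2 v2)" "a \<noteq> b"
    using set by auto
  \<comment> \<open>The two letters are left as variables, over which \<open>K\<close> abstracts.
    Their names only have to differ from those bound in \<open>obs\<close> and \<open>dfl\<close>,
    and \<open>12\<close> and \<open>13\<close> are reserved for the state and the observed
    term.\<close>
  define c where "c = (\<lambda>i. if i = a then Var 10 else if i = b then Var 11 else idt)"
  have c: "fv (c i) \<inter> {0, 1, 2, 3} = {}" "lin (c i)" "i \<noteq> j \<Longrightarrow> fv (c i) \<inter> fv (c j) = {}" for i j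
    by (auto simp: c_def)
  have lin: "lin (obs c L)"
    using lin_obs[OF c(2,1,3) L(1)] by simp
  have fv: "fv (obs c L) = {10, 11}"
  proof -
    have "fv (obs c L) = (\<Union>i \<in> set (map l1 v1). fv (c i))"
      using fv_obs(2)[OF c(1)] set by simp
    then show ?thesis
      using ab ab2(3) by (auto simp: c_def split: if_splits)
  qed
  define K where "K = Fn 13 (Fn 10 (Fn 11 (Fn 12 (App (App (obs c L) (Var 13)) (Var 12)))))"
  have K: "fv K = {}" "lin K"
    using lin fv by (auto simp: K_def)
  have typeK: "[] \<turnstile> App K s \<^bold>: X \<rightarrow> Y \<rightarrow> (P \<rightarrow> Q)"
    if s: "[] \<turnstile> s \<^bold>: ren l L" and "has_ty ((\<lambda>_. TVar 0)(10 := X, 11 := Y)) (obs c L) (tsubst \<theta> (ren l L) \<rightarrow> (P \<rightarrow> Q))"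
    for s l X Y P Q \<theta>
  proof -
    let ?R = "tsubst \<theta> (ren l L)"
    let ?\<tau> = "(\<lambda>_. TVar 0)(13 := ?R, 10 := X, 11 := Y, 12 := P)"
    have "has_ty ?\<tau> (obs c L) (?R \<rightarrow> (P \<rightarrow> Q))"
      using that(2) by (rule has_ty_cong[THEN iffD1, rotated]) (auto simp: fv)
    then have "has_ty (\<lambda>_. TVar 0) K (?R \<rightarrow> X \<rightarrow> Y \<rightarrow> (P \<rightarrow> Q))"
      unfolding K_def by (auto simp del: fun_upd_apply) (auto)
    then show ?thesis
      using closed_typingI[OF K] closed_tsubst[OF s] closed_App by blast
  qed
  have w1: "has_ty ((\<lambda>_. TVar 0)(10 := TVar 0 \<rightarrow> TVar 1, 11 := TVar 1 \<rightarrow> TVar 2)) (c a) (TVar 0 \<rightarrow> TVar 1)"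
    "has_ty ((\<lambda>_. TVar 0)(10 := TVar 0 \<rightarrow> TVar 1, 11 := TVar 1 \<rightarrow> TVar 2)) (c b) (TVar 1 \<rightarrow> TVar 2)"
    "has_ty ((\<lambda>_. TVar 0)(10 := TVar 1 \<rightarrow> TVar 2, 11 := TVar 0 \<rightarrow> TVar 1)) (c b) (TVar 0 \<rightarrow> TVar 1)"
    "has_ty ((\<lambda>_. TVar 0)(10 := TVar 1 \<rightarrow> TVar 2, 11 := TVar 0 \<rightarrow> TVar 1)) (c a) (TVar 1 \<rightarrow> TVar 2)"
    using ab2(3) by (simp_all add: c_def)
  have "\<exists>\<theta>. has_ty ((\<lambda>_. TVar 0)(10 := TVar 0 \<rightarrow> TVar 1, 11 := TVar 1 \<rightarrow> TVar 2)) (obs c L)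
      (tsubst \<theta> (ren l1 L) \<rightarrow> (TVar 0 \<rightarrow> TVar 2))"
    by (rule observe[OF G 1(2) d(1) set(1) _ c(1) ab(1-3) w1(1,2)]) (use 1(5) in \<open>auto simp: c_def\<close>)
  then have "[] \<turnstile> App K s1 \<^bold>: ty1"
    using typeK[OF 1(1)] by blast
  moreover have "\<exists>\<theta>. has_ty ((\<lambda>_. TVar 0)(10 := TVar 1 \<rightarrow> TVar 2, 11 := TVar 0 \<rightarrow> TVar 1)) (obs c L)
      (tsubst \<theta> (ren l2 L) \<rightarrow> (TVar 0 \<rightarrow> TVar 2))"
    by (rule observe[OF G 2(2) d(2) set(2) _ c(1) ab2(2,1) ab(4) w1(3,4)]) (use 2(5) in \<open>auto simp: c_def\<close>)
  then have "[] \<turnstile> App K s2 \<^bold>: ty2"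
    using typeK[OF 2(1)] by blast
  ultimately show ?thesis by blast
qed

section \<open>Erasing closed terms\<close>

lemma chain_zero: "chain (\<lambda>_. 0) (\<lambda>_. 0) l js 0 0"
  by (induction js) auto

text \<open>\<open>E\<close> is fixed before \<open>q\<close>, since one and the same letter will be
  used at several types of the state.\<close>

lemma erase: "\<exists>E. \<forall>q. [] \<turnstile> E \<^bold>: tsubst (\<lambda>_. q \<rightarrow> q) B \<rightarrow> (q \<rightarrow> q)"
proof -
  obtain L f where L: "labelled L" "ren f L = B"
    using ex_labelled by blast
  let ?E = "obs (\<lambda>_. idt) L"
  have "lin ?E"
    using lin_obs[of "\<lambda>_. idt" L] L(1) by simp
  moreover have "fv ?E = {}"
    using fv_obs(2)[of "\<lambda>_. idt" L] by simp
  moreover obtain G where "goal_groups G L"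
    using ex_groups(2)[OF L(1)] by blast
  \<comment> \<open>No letter changes the state, so one state type and a single time 0 are
    enough.\<close>
  then have "has_ty TVar ?E (tsubst (\<lambda>_. q \<rightarrow> q) L \<rightarrow> (q \<rightarrow> q))" for q
    using has_ty_obs(2)[of "\<lambda>_. idt" G L id "\<lambda>_. 0" "\<lambda>_. 0" "\<lambda>_. 0" TVar "\<lambda>_. q" 0 0] chain_zero by simp
  moreover have "tsubst (\<lambda>_. q \<rightarrow> q) L = tsubst (\<lambda>_. q \<rightarrow> q) B" for q
    unfolding L(2)[symmetric] tsubst_tsubst by simp
  ultimately show ?thesis
    using closed_typingI by metis
qed

text \<open>Coherence applies at \<open>TVar 0 \<rightarrow> TVar 0\<close>; the equation at
  \<open>q \<rightarrow> q\<close> is an instance of it.\<close>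

lemma erase_eq:
  assumes "\<And>q. [] \<turnstile> E \<^bold>: tsubst (\<lambda>_. q \<rightarrow> q) B \<rightarrow> (q \<rightarrow> q)" "[] \<turnstile> v \<^bold>: B"
  shows "[] \<turnstile> App E v \<doteq> idt \<^bold>: q \<rightarrow> q"
proof -
  have "[] \<turnstile> App E v \<doteq> idt \<^bold>: TVar 0 \<rightarrow> TVar 0"
  proof (rule closed_coherence)
    show "[] \<turnstile> App E v \<^bold>: TVar 0 \<rightarrow> TVar 0"
      using closed_App[OF assms(1) closed_tsubst[OF assms(2)]] .
    show "[] \<turnstile> idt \<^bold>: TVar 0 \<rightarrow> TVar 0"
      by (rule closed_typingI[of _ TVar]) auto
  qed simp
  from closed_eq_tsubst[OF this, of "\<lambda>_. q"] show ?thesis by simp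
qed

subsection \<open>Selecting a closed term\<close>

text \<open>The old state \<open>Var 0\<close> is erased to an identity, which is then applied to
  the new state \<open>u\<close>.\<close>

definition letter :: "trm \<Rightarrow> trm \<Rightarrow> trm" where
  "letter E u = Fn 0 (App (App E (Var 0)) u)"

lemma letter_typing:
  assumes "[] \<turnstile> E \<^bold>: X \<rightarrow> (D \<rightarrow> D)" "[] \<turnstile> u \<^bold>: D"
  shows "[] \<turnstile> letter E u \<^bold>: X \<rightarrow> D"
  using closed_wt[OF assms(1)] closed_wt[OF assms(2)]
  by (intro closed_typingI[of _ TVar]) (auto simp: letter_def intro!: exI[of _ D])

lemma letter_eq:
  assumes "\<And>q. [] \<turnstile> E \<^bold>: tsubst (\<lambda>_. q \<rightarrow> q) B \<rightarrow> (q \<rightarrow> q)" "[] \<turnstile> v \<^bold>: B" "[] \<turnstile> u \<^bold>: D"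
  shows "[] \<turnstile> App (letter E u) v \<doteq> u \<^bold>: D"
proof -
  have "[] \<turnstile> App (letter E u) v \<^bold>: D"
    using closed_App[OF letter_typing[OF assms(1,3)] closed_tsubst[OF assms(2)]] .
  then have "[] \<turnstile> App (letter E u) v \<doteq> subst (Var(0 := v)) (App (App E (Var 0)) u) \<^bold>: D"
    unfolding letter_def by (rule closed_beta)
  also have "subst (Var(0 := v)) (App (App E (Var 0)) u) = App (App E v) u"
    using closed_wt(1)[OF assms(1)] closed_wt(1)[OF assms(3)] by (simp add: subst_fresh)
  finally have "[] \<turnstile> App (letter E u) v \<doteq> App (App E v) u \<^bold>: D" .
  moreover have *: "[] \<turnstile> App (App E v) u \<doteq> App idt u \<^bold>: D"
    by (rule closed_eq_App[OF erase_eq[OF assms(1,2)] equality.refl[OF assms(3)]])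
  moreover have "[] \<turnstile> App idt u \<doteq> u \<^bold>: D"
    using closed_beta[of 0 "Var 0" u D] equality_typed[OF *] by simp
  ultimately show ?thesis
    using equality.trans by blast
qed


text \<open>\<open>a\<close> and \<open>b\<close> are the two overwriting letters, and
  \<open>z\<close> is the initial state.\<close>

definition selector :: "trm \<Rightarrow> trm \<Rightarrow> trm \<Rightarrow> trm \<Rightarrow> trm" where
  "selector K a b z = Fn 0 (App (App (App (App K (Var 0)) a) b) z)"

lemma selector_typing:
  assumes "[] \<turnstile> K \<^bold>: R \<rightarrow> (X \<rightarrow> Y \<rightarrow> (Z \<rightarrow> D))" "[] \<turnstile> a \<^bold>: X" "[] \<turnstile> b \<^bold>: Y" "[] \<turnstile> z \<^bold>: Z"
  shows "[] \<turnstile> selector K a b z \<^bold>: R \<rightarrow> D"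
proof (rule closed_typingI[of _ TVar])
  note c = closed_wt[OF assms(1)] closed_wt[OF assms(2)] closed_wt[OF assms(3)] closed_wt[OF assms(4)]
  have "has_ty (TVar(0 := R)) (App (App (App (App K (Var 0)) a) b) z) D"
    unfolding has_ty.simps(2) using c(3,7,11,15) by (metis fun_upd_same has_ty.simps(1))
  then show "has_ty TVar (selector K a b z) (R \<rightarrow> D)"
    unfolding selector_def by simp
qed (use closed_wt[OF assms(1)] closed_wt[OF assms(2)] closed_wt[OF assms(3)] closed_wt[OF assms(4)]
    in \<open>auto simp: selector_def\<close>)

lemma selector_eq:
  assumes "[] \<turnstile> App K s \<^bold>: X \<rightarrow> Y \<rightarrow> (Z \<rightarrow> D)" "[] \<turnstile> a \<^bold>: X" "[] \<turnstile> b \<^bold>: Y" "[] \<turnstile> z \<^bold>: Z"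
  shows "[] \<turnstile> App (selector K a b z) s \<doteq> App (App (App (App K s) a) b) z \<^bold>: D"
proof -
  obtain R where R: "[] \<turnstile> K \<^bold>: R \<rightarrow> (X \<rightarrow> Y \<rightarrow> (Z \<rightarrow> D))" "[] \<turnstile> s \<^bold>: R"
    using assms(1) by (rule closed_AppE)
  have "[] \<turnstile> App (selector K a b z) s \<doteq> subst (Var(0 := s)) (App (App (App (App K (Var 0)) a) b) z) \<^bold>: D"
    using closed_App[OF selector_typing[OF R(1) assms(2-4)] R(2)] unfolding selector_def
    by (rule closed_beta)
  then show ?thesis
    using closed_wt(1)[OF R(1)] closed_wt(1)[OF assms(2)] closed_wt(1)[OF assms(3)]
      closed_wt(1)[OF assms(4)] by (simp add: subst_fresh)
qed

lemma closed_beta3: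
  assumes "[] \<turnstile> p \<doteq> Fn 0 (Fn 1 (Fn 2 t)) \<^bold>: X \<rightarrow> Y \<rightarrow> (Z \<rightarrow> D)"
    "[] \<turnstile> a \<^bold>: X" "[] \<turnstile> b \<^bold>: Y" "[] \<turnstile> z \<^bold>: Z"
  shows "[] \<turnstile> App (App (App p a) b) z
    \<doteq> subst (Var(2 := z)) (subst (Var(1 := b)) (subst (Var(0 := a)) t)) \<^bold>: D"
proof -
  have step: "[] \<turnstile> App q c \<doteq> subst (Var(x := c)) r \<^bold>: C"
    if "[] \<turnstile> q \<doteq> Fn x r \<^bold>: W \<rightarrow> C" "[] \<turnstile> c \<^bold>: W" for q x r c W C
  proof -
    note e = closed_eq_App[OF that(1) equality.refl[OF that(2)]]
    from equality.trans[OF e closed_beta[OF conjunct2[OF equality_typed[OF e]]]] show ?thesis .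
  qed
  have tw: "Var(0 := a, 1 := Var 1, 2 := Var 2) = Var(0 := a)" "Var(1 := b, 2 := Var 2) = Var(1 := b)"
    by auto
  from step[OF assms(1,2)] have "[] \<turnstile> App p a \<doteq> Fn 1 (Fn 2 (subst (Var(0 := a)) t)) \<^bold>: Y \<rightarrow> (Z \<rightarrow> D)"
    unfolding subst.simps tw .
  from step[OF this assms(3)]
  have "[] \<turnstile> App (App p a) b \<doteq> Fn 2 (subst (Var(1 := b)) (subst (Var(0 := a)) t)) \<^bold>: Z \<rightarrow> D"
    unfolding subst.simps tw .
  from step[OF this assms(4)] show ?thesis .
qed

text \<open>By coherence the type alone identifies \<open>p\<close> with the explicit composition,
  which can then be contracted.\<close>

lemma apply_ty1:
  assumes "[] \<turnstile> p \<^bold>: ty1" "[] \<turnstile> a \<^bold>: X \<rightarrow> Y" "[] \<turnstile> b \<^bold>: Y \<rightarrow> Z" "[] \<turnstile> z \<^bold>: X"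
  shows "[] \<turnstile> App (App (App p a) b) z \<doteq> App b (App a z) \<^bold>: Z"
proof -
  let ?P = "Fn 0 (Fn 1 (Fn 2 (App (Var 1) (App (Var 0) (Var 2)))))"
  have "[] \<turnstile> p \<doteq> ?P \<^bold>: ty1"
    by (rule closed_coherence[OF assms(1) closed_typingI[of _ TVar]]) auto
  from closed_eq_tsubst[OF this, of "\<lambda>n. if n = 0 then X else if n = 1 then Y else Z"]
  have "[] \<turnstile> p \<doteq> ?P \<^bold>: (X \<rightarrow> Y) \<rightarrow> (Y \<rightarrow> Z) \<rightarrow> (X \<rightarrow> Z)" by simp
  from closed_beta3[OF this assms(2-4)] show ?thesis
    using assms(2-4)[THEN closed_wt(1)] by (simp add: subst_closed)
qed

lemma apply_ty2:
  assumes "[] \<turnstile> p \<^bold>: ty2" "[] \<turnstile> a \<^bold>: Y \<rightarrow> Z" "[] \<turnstile> b \<^bold>: X \<rightarrow> Y" "[] \<turnstile> z \<^bold>: X"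
  shows "[] \<turnstile> App (App (App p a) b) z \<doteq> App a (App b z) \<^bold>: Z"
proof -
  let ?P = "Fn 0 (Fn 1 (Fn 2 (App (Var 0) (App (Var 1) (Var 2)))))"
  have "[] \<turnstile> p \<doteq> ?P \<^bold>: ty2"
    by (rule closed_coherence[OF assms(1) closed_typingI[of _ TVar]]) auto
  from closed_eq_tsubst[OF this, of "\<lambda>n. if n = 0 then X else if n = 1 then Y else Z"]
  have "[] \<turnstile> p \<doteq> ?P \<^bold>: (Y \<rightarrow> Z) \<rightarrow> (X \<rightarrow> Y) \<rightarrow> (X \<rightarrow> Z)" by simp
  from closed_beta3[OF this assms(2-4)] show ?thesis
    using assms(2-4)[THEN closed_wt(1)] by (simp add: subst_closed)
qed

text \<open>The letters overwrite the state, so the letter that is run last decides. Overwriting means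
  erasing the old state, which is only possible at a type of the form \<open>tsubst (\<lambda>_. q \<rightarrow> q) B\<close>;
  therefore the type of the state changes in the course of the computation, differently for
  \<open>s1\<close> and \<open>s2\<close>.\<close>

lemma select:
  assumes "[] \<turnstile> s1 \<^bold>: A" "[] \<turnstile> s2 \<^bold>: A" "\<not> [] \<turnstile> s1 \<doteq> s2 \<^bold>: A"
  shows "\<exists>R. \<forall>u1 u2. [] \<turnstile> u1 \<^bold>: B \<longrightarrow> [] \<turnstile> u2 \<^bold>: B \<longrightarrow>
    (\<exists>t. [] \<turnstile> t \<^bold>: R \<rightarrow> B \<and> (\<forall>D. [] \<turnstile> u1 \<^bold>: D \<longrightarrow> [] \<turnstile> App t s1 \<doteq> u1 \<^bold>: D)
      \<and> (\<forall>D. [] \<turnstile> u2 \<^bold>: D \<longrightarrow> [] \<turnstile> App t s2 \<doteq> u2 \<^bold>: D))"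
proof -
  obtain K where K: "[] \<turnstile> App K s1 \<^bold>: ty1" "[] \<turnstile> App K s2 \<^bold>: ty2"
    using separate[OF assms] by blast
  obtain E where E: "\<And>q. [] \<turnstile> E \<^bold>: tsubst (\<lambda>_. q \<rightarrow> q) B \<rightarrow> (q \<rightarrow> q)"
    using erase[of B] by blast
  \<comment> \<open>Backwards from the final type \<open>D\<close>: the last letter erases a state
    of type \<open>?Y D\<close>. That state was written by the earlier letter, which erased one of
    type \<open>?X D\<close>.\<close>
  let ?Y = "\<lambda>D. tsubst (\<lambda>_. D \<rightarrow> D) B"
  let ?X = "\<lambda>D. ?Y (?Y D)"
  let ?\<theta> = "\<lambda>D n. if n = 0 then ?X D else if n = 1 then ?Y D else D"
  have K1: "[] \<turnstile> App K s1 \<^bold>: (?X D \<rightarrow> ?Y D) \<rightarrow> (?Y D \<rightarrow> D) \<rightarrow> (?X D \<rightarrow> D)" for D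
    using closed_tsubst[OF K(1), of "?\<theta> D"] by simp
  have K2: "[] \<turnstile> App K s2 \<^bold>: (?Y D \<rightarrow> D) \<rightarrow> (?X D \<rightarrow> ?Y D) \<rightarrow> (?X D \<rightarrow> D)" for D
    using closed_tsubst[OF K(2), of "?\<theta> D"] by simp
  obtain R where R: "[] \<turnstile> K \<^bold>: R \<rightarrow> ((?X B \<rightarrow> ?Y B) \<rightarrow> (?Y B \<rightarrow> B) \<rightarrow> (?X B \<rightarrow> B))"
    using K1[of B] by (rule closed_AppE)
  show ?thesis
  proof (intro exI[of _ R] allI impI)
    fix u1 u2
    assume u: "[] \<turnstile> u1 \<^bold>: B" "[] \<turnstile> u2 \<^bold>: B"
    have lt: "[] \<turnstile> letter E v \<^bold>: ?Y D \<rightarrow> D" if "[] \<turnstile> v \<^bold>: D" for v D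
      by (rule letter_typing[OF E that])
    have lY: "[] \<turnstile> letter E v \<^bold>: ?X D \<rightarrow> ?Y D" if "[] \<turnstile> v \<^bold>: B" for v D
      by (rule lt[OF closed_tsubst[OF that]])
    have z: "[] \<turnstile> u1 \<^bold>: ?X D" for D
      by (rule closed_tsubst[OF u(1)])
    have last: "[] \<turnstile> App (letter E v) (App (letter E v') u1) \<doteq> v \<^bold>: D"
      if "[] \<turnstile> v' \<^bold>: B" "[] \<turnstile> v \<^bold>: D" for v v' D
    proof -
      have "[] \<turnstile> App (letter E v') u1 \<doteq> v' \<^bold>: ?Y D"
        by (rule letter_eq[OF E u(1) closed_tsubst[OF that(1)]])
      from closed_eq_App[OF equality.refl[OF lt[OF that(2)]] this] letter_eq[OF E that]
      show ?thesis by (rule equality.trans)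
    qed
    \<comment> \<open>With \<open>ty1\<close> the second letter is run last, with \<open>ty2\<close>
      the first one; so \<open>s1\<close> yields \<open>u1\<close> and \<open>s2\<close> yields
      \<open>u2\<close>. The final \<open>u1\<close> merely supplies a closed initial state, which
      is overwritten in both cases.\<close>
    let ?t = "selector K (letter E u2) (letter E u1) u1"
    have "[] \<turnstile> ?t \<^bold>: R \<rightarrow> B"
      by (rule selector_typing[OF R lY[OF u(2)] lt[OF u(1)] z])
    moreover have "[] \<turnstile> App ?t s1 \<doteq> u1 \<^bold>: D" if "[] \<turnstile> u1 \<^bold>: D" for D
    proof -
      note ab = lY[OF u(2), of D] lt[OF that] z[of D]
      show ?thesis
        using selector_eq[OF K1 ab] apply_ty1[OF K(1) ab] last[OF u(2) that] equality.trans by blast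
    qed
    moreover have "[] \<turnstile> App ?t s2 \<doteq> u2 \<^bold>: D" if "[] \<turnstile> u2 \<^bold>: D" for D
    proof -
      note ab = lt[OF that] lY[OF u(1), of D] z[of D]
      show ?thesis
        using selector_eq[OF K2 ab] apply_ty2[OF K(2) ab] last[OF u(1) that] equality.trans by blast
    qed
    ultimately show "\<exists>t. [] \<turnstile> t \<^bold>: R \<rightarrow> B \<and> (\<forall>D. [] \<turnstile> u1 \<^bold>: D \<longrightarrow> [] \<turnstile> App t s1 \<doteq> u1 \<^bold>: D)
        \<and> (\<forall>D. [] \<turnstile> u2 \<^bold>: D \<longrightarrow> [] \<turnstile> App t s2 \<doteq> u2 \<^bold>: D)"
      by blast
  qed
qed

section \<open>Iteration over the arguments\<close>

lemma apps_Cons: "apps t (s # ss) = apps (App t s) ss"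
  by (simp add: apps_def)

lemma apps_Nil: "apps t [] = t"
  by (simp add: apps_def)

lemma arrows_simps: "arrows [] B = B" "arrows (A # As) B = A \<rightarrow> arrows As B"
  by (simp_all add: arrows_def)

lemma apps_typingD:
  "[] \<turnstile> apps t ss \<^bold>: B \<Longrightarrow> \<exists>As. [] \<turnstile> t \<^bold>: arrows As B \<and> list_all2 (\<lambda>s A. [] \<turnstile> s \<^bold>: A) ss As"
proof (induction ss arbitrary: t)
  case Nil
  then show ?case by (intro exI[of _ "[]"]) (simp add: apps_Nil arrows_simps)
next
  case (Cons s ss)
  then obtain As where As: "[] \<turnstile> App t s \<^bold>: arrows As B" "list_all2 (\<lambda>s A. [] \<turnstile> s \<^bold>: A) ss As"
    by (auto simp: apps_Cons)
  from As(1) obtain C where "[] \<turnstile> t \<^bold>: C \<rightarrow> arrows As B" "[] \<turnstile> s \<^bold>: C"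
    by (rule closed_AppE)
  with As(2) show ?case
    by (intro exI[of _ "C # As"]) (simp add: arrows_simps)
qed

lemma apps_eq:
  "[] \<turnstile> t \<doteq> t' \<^bold>: arrows As B \<Longrightarrow> list_all2 (\<lambda>s A. [] \<turnstile> s \<^bold>: A) ss As \<Longrightarrow> [] \<turnstile> apps t ss \<doteq> apps t' ss \<^bold>: B"
proof (induction ss arbitrary: t t' As)
  case Nil
  then show ?case by (simp add: apps_Nil arrows_simps)
next
  case (Cons s ss)
  then obtain C Bs where As: "As = C # Bs" "[] \<turnstile> s \<^bold>: C" "list_all2 (\<lambda>s A. [] \<turnstile> s \<^bold>: A) ss Bs"
    by (auto simp: list_all2_Cons1)
  have "[] \<turnstile> App t s \<doteq> App t' s \<^bold>: arrows Bs B"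
    using Cons.prems(1) As by (intro closed_eq_App[OF _ equality.refl]) (auto simp: arrows_simps)
  from Cons.IH[OF this As(3)] show ?case
    by (simp add: apps_Cons)
qed

text \<open>The first argument selects between the terms for the two restrictions of
  \<open>f\<close>. For \<open>select\<close> these need a common type, so \<open>B\<close> may
  depend on \<open>n\<close> but not on \<open>f\<close>.\<close>

lemma decision_terms:
  assumes "[] \<turnstile> s1 \<^bold>: A" "[] \<turnstile> s2 \<^bold>: A" "\<not> [] \<turnstile> s1 \<doteq> s2 \<^bold>: A"
    "enc = (\<lambda>b. if b then s2 else s1)"
  shows "\<exists>B. \<forall>f. \<exists>t. [] \<turnstile> t \<^bold>: B \<and> (\<forall>xs. length xs = n \<longrightarrow> [] \<turnstile> apps t (map enc xs) \<doteq> enc (f xs) \<^bold>: A)"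
proof (induction n)
  case 0
  have "[] \<turnstile> enc b \<^bold>: A" for b
    using assms by simp
  then show ?case
    by (intro exI[of _ A]) (auto simp: apps_Nil intro!: exI equality.refl)
next
  case (Suc n)
  then obtain B where B: "\<And>f. \<exists>t. [] \<turnstile> t \<^bold>: B
      \<and> (\<forall>xs. length xs = n \<longrightarrow> [] \<turnstile> apps t (map enc xs) \<doteq> enc (f xs) \<^bold>: A)"
    by blast
  obtain R where R: "\<And>u1 u2. [] \<turnstile> u1 \<^bold>: B \<Longrightarrow> [] \<turnstile> u2 \<^bold>: B \<Longrightarrow>
    (\<exists>t. [] \<turnstile> t \<^bold>: R \<rightarrow> B \<and> (\<forall>D. [] \<turnstile> u1 \<^bold>: D \<longrightarrow> [] \<turnstile> App t s1 \<doteq> u1 \<^bold>: D)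
      \<and> (\<forall>D. [] \<turnstile> u2 \<^bold>: D \<longrightarrow> [] \<turnstile> App t s2 \<doteq> u2 \<^bold>: D))"
    using select[OF assms(1-3), of B] by blast
  show ?case
  proof (intro exI[of _ "R \<rightarrow> B"] allI)
    fix f :: "bool list \<Rightarrow> bool"
    have "\<exists>u. [] \<turnstile> u \<^bold>: B
        \<and> (\<forall>xs. length xs = n \<longrightarrow> [] \<turnstile> apps u (map enc xs) \<doteq> enc (f (b # xs)) \<^bold>: A)" for b
      by (rule B)
    then obtain u where u: "\<And>b. [] \<turnstile> u b \<^bold>: B"
      "\<And>b xs. length xs = n \<Longrightarrow> [] \<turnstile> apps (u b) (map enc xs) \<doteq> enc (f (b # xs)) \<^bold>: A"
      by metis
    obtain t where t: "[] \<turnstile> t \<^bold>: R \<rightarrow> B" "\<And>D. [] \<turnstile> u False \<^bold>: D \<Longrightarrow> [] \<turnstile> App t s1 \<doteq> u False \<^bold>: D"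
      "\<And>D. [] \<turnstile> u True \<^bold>: D \<Longrightarrow> [] \<turnstile> App t s2 \<doteq> u True \<^bold>: D"
      using R[OF u(1) u(1), of False True] by blast
    have sel: "[] \<turnstile> App t (enc b) \<doteq> u b \<^bold>: D" if "[] \<turnstile> u b \<^bold>: D" for b D
      using t(2,3) that assms(4) by (cases b) auto
    have "[] \<turnstile> apps t (map enc xs) \<doteq> enc (f xs) \<^bold>: A" if len: "length xs = Suc n" for xs
    proof -
      obtain b ys where xs: "xs = b # ys" "length ys = n"
        using len by (auto simp: length_Suc_conv)
      note e = u(2)[OF xs(2), of b]
      \<comment> \<open>The remaining arguments dictate the type at which \<open>u b\<close> is
        used, and it may differ from \<open>B\<close>; this is why \<open>select\<close> speaks of
        every type \<open>D\<close> of the selected term.\<close>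
      obtain As where As: "[] \<turnstile> u b \<^bold>: arrows As A" "list_all2 (\<lambda>s A. [] \<turnstile> s \<^bold>: A) (map enc ys) As"
        using apps_typingD equality_typed[OF e] by blast
      from equality.trans[OF apps_eq[OF sel[OF As(1)] As(2)] e] show ?thesis
        by (simp add: xs(1) apps_Cons)
    qed
    with t(1) show "\<exists>t. [] \<turnstile> t \<^bold>: R \<rightarrow> B
        \<and> (\<forall>xs. length xs = Suc n \<longrightarrow> [] \<turnstile> apps t (map enc xs) \<doteq> enc (f xs) \<^bold>: A)"
      by blast
  qed
qed

subsection \<open>Principal types\<close>

instance ty :: countable
  by countable_datatype

text \<open>Anti-unification. Coding the pair of mismatched types as the variable gives equal pairs
  the same variable, so that both types are recovered by one substitution each.\<close>

fun lgg :: "ty \<Rightarrow> ty \<Rightarrow> ty" where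
  "lgg (A \<otimes> B) (C \<otimes> D) = lgg A C \<otimes> lgg B D"
| "lgg (A \<rightarrow> B) (C \<rightarrow> D) = lgg A C \<rightarrow> lgg B D"
| "lgg A B = TVar (to_nat (A, B))"

lemma tsubst_lgg:
  "tsubst (\<lambda>n. fst (from_nat n :: ty \<times> ty)) (lgg A B) = A"
  "tsubst (\<lambda>n. snd (from_nat n :: ty \<times> ty)) (lgg A B) = B"
  by (induction A B rule: lgg.induct) auto

text \<open>The typing conditions only match shapes and compare types, and \<open>lgg\<close>
  commutes with both constructors; so two typings combine at every subterm.\<close>

lemma has_ty_lgg:
  "has_ty \<tau>1 t A \<Longrightarrow> has_ty \<tau>2 t B \<Longrightarrow> has_ty (\<lambda>x. lgg (\<tau>1 x) (\<tau>2 x)) t (lgg A B)"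
proof (induction t arbitrary: \<tau>1 \<tau>2 A B)
  case (App t s)
  then obtain C D where "has_ty \<tau>1 t (C \<rightarrow> A)" "has_ty \<tau>1 s C" "has_ty \<tau>2 t (D \<rightarrow> B)" "has_ty \<tau>2 s D"
    by auto
  from App.IH(1)[OF this(1,3)] App.IH(2)[OF this(2,4)] show ?case by auto
next
  case (Fn x t)
  then obtain A1 A2 B1 B2 where *: "A = A1 \<rightarrow> A2" "B = B1 \<rightarrow> B2"
    "has_ty (\<tau>1(x := A1)) t A2" "has_ty (\<tau>2(x := B1)) t B2"
    by auto
  have "has_ty (\<lambda>y. lgg ((\<tau>1(x := A1)) y) ((\<tau>2(x := B1)) y)) t (lgg A2 B2)"
    by (rule Fn.IH[OF *(3,4)])
  moreover have "(\<lambda>y. lgg ((\<tau>1(x := A1)) y) ((\<tau>2(x := B1)) y)) = (\<lambda>y. lgg (\<tau>1 y) (\<tau>2 y))(x := lgg A1 B1)"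
    by auto
  ultimately show ?case
    using * by (auto simp del: fun_upd_apply)
next
  case (Tup t s)
  then obtain A1 A2 B1 B2 where *: "A = A1 \<otimes> A2" "B = B1 \<otimes> B2" "has_ty \<tau>1 t A1" "has_ty \<tau>1 s A2"
    "has_ty \<tau>2 t B1" "has_ty \<tau>2 s B2"
    by auto
  from Tup.IH(1)[OF *(3,5)] Tup.IH(2)[OF *(4,6)] *(1,2) show ?case by auto
next
  case (LetTup x y s t)
  then obtain A1 A2 B1 B2 where *: "has_ty \<tau>1 s (A1 \<otimes> A2)" "has_ty \<tau>2 s (B1 \<otimes> B2)"
    "has_ty (\<tau>1(x := A1, y := A2)) t A" "has_ty (\<tau>2(x := B1, y := B2)) t B"
    by auto
  have "has_ty (\<lambda>z. lgg ((\<tau>1(x := A1, y := A2)) z) ((\<tau>2(x := B1, y := B2)) z)) t (lgg A B)"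
    by (rule LetTup.IH(2)[OF *(3,4)])
  moreover have "(\<lambda>z. lgg ((\<tau>1(x := A1, y := A2)) z) ((\<tau>2(x := B1, y := B2)) z))
      = (\<lambda>z. lgg (\<tau>1 z) (\<tau>2 z))(x := lgg A1 B1, y := lgg A2 B2)"
    by auto
  ultimately show ?case
    using LetTup.IH(1)[OF *(1,2)] by (auto simp del: fun_upd_apply)
qed auto

lemma tsz_tsubst: "tsz C \<le> tsz (tsubst \<theta> C)"
  by (induction C) auto

lemma tsz_tsubst_eq: "tsz (tsubst \<theta> C) = tsz C \<Longrightarrow> a \<in> tv C \<Longrightarrow> \<exists>b. \<theta> a = TVar b"
proof (induction C)
  case (TVar c)
  then show ?case by (cases "\<theta> c") auto
next
  case (Tensor A B)
  then show ?case
    using tsz_tsubst[of A \<theta>] tsz_tsubst[of B \<theta>] by auto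
next
  case (Lolli A B)
  then show ?case
    using tsz_tsubst[of A \<theta>] tsz_tsubst[of B \<theta>] by auto
qed

lemma finite_tv [simp]: "finite (tv A)"
  by (induction A) auto

lemma card_tv: "card (tv A) \<le> Suc (tsz A)"
proof (induction A)
  case (Tensor A B)
  then show ?case using card_Un_le[of "tv A" "tv B"] by simp
next
  case (Lolli A B)
  then show ?case using card_Un_le[of "tv A" "tv B"] by simp
qed simp

lemma tv_ren: "tv (ren f A) = f ` tv A"
  by (induction A) auto

text \<open>Typings are closed under least general generalisation; a type of minimal size with as many
  type variables as possible is therefore principal.\<close>

lemma closed_most_general:
  assumes "[] \<turnstile> t \<^bold>: A0"
  shows "\<exists>P. [] \<turnstile> t \<^bold>: P \<and> (\<forall>B. [] \<turnstile> t \<^bold>: B \<longrightarrow> (\<exists>\<theta>. B = tsubst \<theta> P))"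
proof -
  obtain A1 where A1: "[] \<turnstile> t \<^bold>: A1" "\<And>B. [] \<turnstile> t \<^bold>: B \<Longrightarrow> tsz A1 \<le> tsz B"
    using ex_has_least_nat[of "\<lambda>A. [] \<turnstile> t \<^bold>: A" A0 tsz] assms by blast
  let ?P = "\<lambda>A. [] \<turnstile> t \<^bold>: A \<and> tsz A = tsz A1"
  have "\<forall>A. ?P A \<longrightarrow> card (tv A) < Suc (Suc (tsz A1))"
    using card_tv by (metis less_Suc_eq_le)
  then obtain A where A: "?P A" "\<And>B. ?P B \<Longrightarrow> card (tv B) \<le> card (tv A)"
    using ex_has_greatest_nat[of ?P A1 "\<lambda>A. card (tv A)" "Suc (Suc (tsz A1))"] A1(1) by blast
  have "\<exists>\<theta>. B = tsubst \<theta> A" if B: "[] \<turnstile> t \<^bold>: B" for B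
  proof -
    let ?C = "lgg A B"
    define \<theta>1 \<theta>2 :: "nat \<Rightarrow> ty" where "\<theta>1 = (\<lambda>n. fst (from_nat n :: ty \<times> ty))" and "\<theta>2 = (\<lambda>n. snd (from_nat n :: ty \<times> ty))"
    have C: "tsubst \<theta>1 ?C = A" "tsubst \<theta>2 ?C = B"
      unfolding \<theta>1_def \<theta>2_def by (rule tsubst_lgg)+
    have tC: "[] \<turnstile> t \<^bold>: ?C"
      using closed_typingI[OF _ _ has_ty_lgg] closed_wt[of t A] closed_wt[OF B] A(1) by blast
    \<comment> \<open>\<open>A\<close> is an instance of \<open>?C\<close> and has minimal size, so
      \<theta>\<open>1\<close> can only rename the variables of \<open>?C\<close>.\<close>
    have "tsz ?C = tsz A"
      using A1(2)[OF tC] tsz_tsubst[of ?C \<theta>1] C(1) A(1) by simp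
    then have "\<forall>a \<in> tv ?C. \<exists>b. \<theta>1 a = TVar b"
      using tsz_tsubst_eq[of \<theta>1 ?C] C(1) by simp
    then obtain r where r: "\<And>a. a \<in> tv ?C \<Longrightarrow> \<theta>1 a = TVar (r a)"
      by metis
    then have AC: "A = ren r ?C"
      using tsubst_cong[of ?C \<theta>1 "\<lambda>a. TVar (r a)"] C(1) by simp
    then have tvA: "tv A = r ` tv ?C"
      by (metis tv_ren)
    \<comment> \<open>If the renaming identified two variables, \<open>A\<close> would have fewer of
      them than \<open>?C\<close>, against its choice.\<close>
    have "card (tv ?C) \<le> card (tv A)"
      using A(2)[of ?C] tC \<open>tsz ?C = tsz A\<close> A(1) by simp
    then have "card (r ` tv ?C) = card (tv ?C)"
      unfolding tvA using card_image_le[of "tv ?C" r] by simp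
    then have inj: "inj_on r (tv ?C)"
      by (simp add: eq_card_imp_inj_on)
    have "tsubst (\<lambda>b. \<theta>2 (inv_into (tv ?C) r b)) (ren r ?C) = tsubst \<theta>2 ?C"
      unfolding tsubst_tsubst by (rule tsubst_cong) (simp add: inj)
    then show ?thesis
      using AC C(2) by metis
  qed
  with A(1) show ?thesis by blast
qed

lemma principal_type_closedI:
  assumes "[] \<turnstile> t \<^bold>: P" "\<And>B. [] \<turnstile> t \<^bold>: B \<Longrightarrow> \<exists>\<theta>. B = tsubst \<theta> P"
  shows "principal_type t P"
  unfolding principal_type_def
proof (intro exI[of _ "[]"] conjI allI impI)
  fix \<Delta> B
  assume D: "\<Delta> \<turnstile> t \<^bold>: B"
  then have "dom_ctxt \<Delta> = {}"
    using typing_imp closed_wt(1)[OF assms(1)] by simp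
  then have "\<Delta> = []"
    by (simp add: dom_ctxt_def)
  with assms(2) D show "\<exists>\<theta>. mset \<Delta> = mset (map (map_prod id (tsubst \<theta>)) []) \<and> B = tsubst \<theta> P"
    by simp
qed (rule assms(1))

text \<open>The tag \<open>k\<close> yields variants of the principal type without common variables,
  so that one substitution can instantiate each of them independently.\<close>

lemma closed_principal:
  assumes "[] \<turnstile> t \<^bold>: A"
  shows "\<exists>P. (\<forall>k. principal_type t (ren (\<lambda>v. prod_encode (k, v)) P))
    \<and> (\<forall>B. [] \<turnstile> t \<^bold>: B \<longrightarrow> (\<exists>\<theta>. B = tsubst \<theta> P))"
proof -
  obtain P where P: "[] \<turnstile> t \<^bold>: P" "\<And>B. [] \<turnstile> t \<^bold>: B \<Longrightarrow> \<exists>\<theta>. B = tsubst \<theta> P"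
    using closed_most_general[OF assms] by blast
  have "principal_type t (ren (\<lambda>v. prod_encode (k, v)) P)" for k
  proof (rule principal_type_closedI)
    fix B
    assume "[] \<turnstile> t \<^bold>: B"
    then obtain \<theta> where "B = tsubst \<theta> P" using P(2) by blast
    then have "B = tsubst (\<lambda>n. \<theta> (snd (prod_decode n))) (ren (\<lambda>v. prod_encode (k, v)) P)"
      by (simp add: tsubst_tsubst)
    then show "\<exists>\<theta>. B = tsubst \<theta> (ren (\<lambda>v. prod_encode (k, v)) P)" by blast
  qed (rule closed_tsubst[OF P(1)])
  with P(2) show ?thesis by blast
qed

lemma poly_typableI:
  assumes "[] \<turnstile> apps t ss \<^bold>: B" "list_all2 (\<lambda>s A. [] \<turnstile> s \<^bold>: A) ss As"
  shows "poly_typable t As B ss"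
proof -
  obtain As' where As': "[] \<turnstile> t \<^bold>: arrows As' B" "list_all2 (\<lambda>s A. [] \<turnstile> s \<^bold>: A) ss As'"
    using apps_typingD[OF assms(1)] by blast
  have len: "length As' = length ss"
    using As'(2) by (simp add: list_all2_lengthD)
  have ty: "[] \<turnstile> ss ! i \<^bold>: As' ! i" if "i < length ss" for i
    using As'(2) that by (simp add: list_all2_conv_all_nth)
  obtain P \<theta>0 where P: "principal_type t (ren (\<lambda>v. prod_encode (0, v)) P)" "arrows As' B = tsubst \<theta>0 P"
    using closed_principal[OF As'(1)] As'(1) by blast
  have "\<forall>i. i < length ss \<longrightarrow> (\<exists>Q \<theta>. principal_type (ss ! i) (ren (\<lambda>v. prod_encode (Suc i, v)) Q)
      \<and> As' ! i = tsubst \<theta> Q)"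
    using closed_principal ty by metis
  then obtain Q \<Theta> where Q: "\<And>i. i < length ss \<Longrightarrow> principal_type (ss ! i) (ren (\<lambda>v. prod_encode (Suc i, v)) (Q i))"
    "\<And>i. i < length ss \<Longrightarrow> As' ! i = tsubst (\<Theta> i) (Q i)"
    by metis
  \<comment> \<open>Tag 0 belongs to \<open>t\<close> and tag \<open>Suc i\<close> to the argument
    at position \<open>i\<close>; each tag gets the substitution found for it alone.\<close>
  define \<theta> where "\<theta> = (\<lambda>n. case prod_decode n of (0, v) \<Rightarrow> \<theta>0 v | (Suc i, v) \<Rightarrow> \<Theta> i v)"
  define Ps where "Ps = map (\<lambda>i. ren (\<lambda>v. prod_encode (Suc i, v)) (Q i)) [0..<length ss]"
  have "tsubst \<theta> (ren (\<lambda>v. prod_encode (0, v)) P) = arrows As' B"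
    unfolding P(2) tsubst_tsubst by (simp add: \<theta>_def)
  moreover have "list_all2 principal_type ss Ps"
    using Q(1) by (simp add: Ps_def list_all2_conv_all_nth)
  moreover have "map (tsubst \<theta>) Ps = As'"
    by (rule nth_equalityI) (use len Q(2) in \<open>simp_all add: Ps_def tsubst_tsubst \<theta>_def\<close>)
  ultimately show ?thesis
    unfolding poly_typable_def using As'(1) len assms(2) P(1) by blast
qed

theorem theorem3:
  fixes A :: ty and s1 s2 :: trm
  assumes "[] \<turnstile> s1 \<^bold>: A" and "[] \<turnstile> s2 \<^bold>: A"
    and "\<not> ([] \<turnstile> s1 \<doteq> s2 \<^bold>: A)"
  shows "functionally_complete A s1 s2"
proof -
  let ?enc = "\<lambda>b. if b then s2 else s1"
  have "\<exists>t. (\<forall>ss. length ss = n \<and> set ss \<subseteq> {s1, s2} \<longrightarrow> poly_typable t (replicate n A) A ss) \<and>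
      (\<forall>xs y. length xs = n \<longrightarrow> (f xs = y \<longleftrightarrow> [] \<turnstile> apps t (map ?enc xs) \<doteq> ?enc y \<^bold>: A))"
    for n and f :: "bool list \<Rightarrow> bool"
  proof -
    obtain t where t: "\<And>xs. length xs = n \<Longrightarrow> [] \<turnstile> apps t (map ?enc xs) \<doteq> ?enc (f xs) \<^bold>: A"
      using decision_terms[OF assms HOL.refl, of n] by blast
    show ?thesis
    proof (intro exI[of _ t] conjI allI impI)
      fix ss
      assume ss: "length ss = n \<and> set ss \<subseteq> {s1, s2}"
      \<comment> \<open>Every sequence of arguments from \<open>s1\<close> and \<open>s2\<close>
        encodes a list of bits, and the equation for that list contains the typability of the
        application.\<close>
      then have "map ?enc (map (\<lambda>s. s = s2) ss) = ss"
        unfolding map_map by (intro map_idI) auto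
      then have "[] \<turnstile> apps t ss \<^bold>: A"
        using equality_typed[OF t[of "map (\<lambda>s. s = s2) ss"]] ss by simp
      then show "poly_typable t (replicate n A) A ss"
        by (rule poly_typableI) (use ss assms(1,2) in \<open>auto simp: list_all2_conv_all_nth dest: nth_mem\<close>)
    next
      fix xs :: "bool list" and y
      assume xs: "length xs = n"
      show "f xs = y \<longleftrightarrow> [] \<turnstile> apps t (map ?enc xs) \<doteq> ?enc y \<^bold>: A"
      proof
        assume "[] \<turnstile> apps t (map ?enc xs) \<doteq> ?enc y \<^bold>: A"
        \<comment> \<open>The application equals the code of the true value as well; two different
          values would make \<open>s1\<close> and \<open>s2\<close> equal.\<close>
        then have "[] \<turnstile> ?enc (f xs) \<doteq> ?enc y \<^bold>: A"
          using t[OF xs] equality.sym equality.trans by blast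
        then show "f xs = y"
          using assms(3) equality.sym by (auto split: if_splits)
      qed (use t[OF xs] in blast)
    qed
  qed
  then show ?thesis
    unfolding functionally_complete_def Let_def by blast
qed

end
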